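(* Let $R=R(X,S_1,S_2)$ be a reduced non-simply laced extended affine root system with Weyl group $\mathcal W$, and let $\psi:\hat{\mathcal W}\to\mathcal W$ be the epimorphism $\hat w_\alpha\mapsto w_\alpha$. Then $\ker(\psi)$ is isomorphic to a direct sum of at most $|\mathcal J|$ copies of $\mathbb Z_2$.
   Context: Setting. $X$ is one of $B_\ell$ ($\ell\ge 2$), $C_\ell$ ($\ell\ge 3$), $F_4$, $G_2$; $k=3$ if $X=G_2$ and $k=2$ otherwise. A semilattice in a finite-dimensional real vector space $U$ is a discrete spanning subset $S\subseteq U$ with $0\in S$ and $S=S\pm 2S$; $\langle S\rangle$ is its $\mathbb Z$-span, and $S$ is a lattice if $S=\langle S\rangle$. A reduced non-simply laced extended affine root system of type $X$, rank $\ell$, nullity $\nu$ and twist number $t$ is described as follows: $\mathcal V=\dot{\mathcal V}\oplus\mathcal V^0$ is a real vector space with a positive semidefinite symmetric bilinear form $(\cdot,\cdot)$ with radical $\mathcal V^0=\mathcal V^0_1\oplus\mathcal V^0_2$, $\dim\mathcal V^0_1=t$, $\dim\mathcal V_2^0=\nu-t$; $\dot R=\{0\}\cup\dot R_{sh}\cup\dot R_{lg}$ is an irreducible finite root system of type $X$ and rank $\ell$ spanning $\dot{\mathcal V}$ ($\dot R_{sh}$ short roots, $\dot R_{lg}$ long roots); $S_i$ is a semilattice in $\mathcal V^0_i$ ($i=1,2$), where $S_2$ is a lattice if $X=B_\ell$ with $\ell\ge3$, $S_1$ is a lattice if $X=C_\ell$ with $\ell\ge3$, and both are lattices if $X=F_4,G_2$;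 and with $S:=S_1\oplus\langle S_2\rangle$, $$R=R(X,S_1,S_2)=(S+S)\cup(\dot R_{sh}+S_1\oplus\langle S_2\rangle)\cup(\dot R_{lg}+k\langle S_1\rangle\oplus S_2).$$ $R^\times=\{\alpha\in R:(\alpha,\alpha)\ne0\}$ and $\alpha^\vee=2\alpha/(\alpha,\alpha)$. Let $\tilde{\mathcal V}=\mathcal V\oplus(\mathcal V^0)^*$ with the form extended by $(\dot\beta_1+\delta_1+\lambda_1,\dot\beta_2+\delta_2+\lambda_2)=(\dot\beta_1,\dot\beta_2)+\lambda_1(\delta_2)+\lambda_2(\delta_1)$ for $\dot\beta_i\in\dot{\mathcal V},\delta_i\in\mathcal V^0,\lambda_i\in(\mathcal V^0)^*$. The extended affine Weyl group $\mathcal W$ is the subgroup of $GL(\tilde{\mathcal V})$ generated by the reflections $w_\alpha(u)=u-(u,\alpha^\vee)\alpha$, $\alpha\in R^\times$. $\hat{\mathcal W}$ is the group with generators $\hat w_\alpha$ ($\alpha\in R^\times$) and relations $\hat w_\alpha^2=1$, $\hat w_\alpha\hat w_\beta\hat w_\alpha=\hat w_{w_\alpha(\beta)}$ ($\alpha,\beta\in R^\times$); $\psi:\hat{\mathcal W}\to\mathcal W$ is the epimorphism with $\psi(\hat w_\alpha)=w_\alpha$. $J_n=\{1,\dots,n\}$, $J_\nu^t=\{t+1,\dots,\nu\}$. Fix $\sigma_1,\dots,\sigma_t\in S_1$ forming a $\mathbb Z$-basis of $\langle S_1\rangle$ and $\sigma_{t+1},\dots,\sigma_\nu\in S_2$ forming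 a $\mathbb Z$-basis of $\langle S_2\rangle$. For $J\subseteq J_\nu$, $\tau_J=\sum_{r\in J}\sigma_r$. $\mathrm{supp}(S_1)=\{J\subseteq J_t:\tau_J\in S_1\}$, $\mathrm{supp}(S_2)=\{J\subseteq J_\nu^t:\tau_J\in S_2\}$, $\mathrm{Esupp}(S_j)=\{J\in\mathrm{supp}(S_j):|J|\ge3\}$. $\mathcal J=\mathrm{Esupp}(S_1)\cup\mathrm{Esupp}(S_2)$ if $X=B_2$; $\mathcal J=\mathrm{Esupp}(S_1)$ if $X=B_\ell$, $\ell\ge3$; $\mathcal J=\mathrm{Esupp}(S_2)$ if $X=C_\ell$, $\ell\ge3$; $\mathcal J=\emptyset$ if $X=F_4,G_2$. *)

theory Defs
  imports
    "HOL-Analysis.Bounded_Linear_Function"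
    "HOL-Analysis.Isolated"
    "HOL-Library.Set_Algebras"
    "HOL-Algebra.Bij"
    "HOL-Algebra.Product_Groups"
begin

section \<open>Groups given by generators and relations\<close>

text \<open>
  A letter \<open>(x, True)\<close> stands for the generator \<open>x\<close> and \<open>(x, False)\<close> for its formal inverse.
  A relation \<open>u = v\<close> is a pair of words. Every word that occurs in the congruence is a word
  over \<open>X\<close>; a relation mentioning a letter outside \<open>X\<close> is ignored.
\<close>

definition words :: "'a set \<Rightarrow> ('a \<times> bool) list set" where
  "words X = lists (X \<times> UNIV)"

inductive_set pres_rel ::
    "'a set \<Rightarrow> (('a \<times> bool) list \<times> ('a \<times> bool) list) set
      \<Rightarrow> (('a \<times> bool) list \<times> ('a \<times> bool) list) set"
  for X E where
  pres_refl: "u \<in> words X \<Longrightarrow> (u, u) \<in> pres_rel X E"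
| pres_sym: "(u, v) \<in> pres_rel X E \<Longrightarrow> (v, u) \<in> pres_rel X E"
| pres_trans: "(u, v) \<in> pres_rel X E \<Longrightarrow> (v, w) \<in> pres_rel X E \<Longrightarrow> (u, w) \<in> pres_rel X E"
| pres_append: "(u, u') \<in> pres_rel X E \<Longrightarrow> (v, v') \<in> pres_rel X E
    \<Longrightarrow> (u @ v, u' @ v') \<in> pres_rel X E"
| pres_cancel: "x \<in> X \<Longrightarrow> ([(x, b), (x, \<not> b)], []) \<in> pres_rel X E"
| pres_relator: "(u, v) \<in> E \<Longrightarrow> u \<in> words X \<Longrightarrow> v \<in> words X \<Longrightarrow> (u, v) \<in> pres_rel X E"

definition presented_group ::
    "'a set \<Rightarrow> (('a \<times> bool) list \<times> ('a \<times> bool) list) set \<Rightarrow> ('a \<times> bool) list set monoid" where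
  "presented_group X E =
    \<lparr>carrier = words X // pres_rel X E,
     mult = (\<lambda>A B. \<Union>u\<in>A. \<Union>v\<in>B. pres_rel X E `` {u @ v}),
     one = pres_rel X E `` {[]}\<rparr>"

definition pres_gen ::
    "'a set \<Rightarrow> (('a \<times> bool) list \<times> ('a \<times> bool) list) set \<Rightarrow> 'a \<Rightarrow> ('a \<times> bool) list set" where
  "pres_gen X E x = pres_rel X E `` {[(x, True)]}"

lemma words_simps [simp]:
  "[] \<in> words X" "u @ v \<in> words X \<longleftrightarrow> u \<in> words X \<and> v \<in> words X"
  "a # u \<in> words X \<longleftrightarrow> fst a \<in> X \<and> u \<in> words X"
  by (cases a; auto simp: words_def)+

lemma pres_rel_words: "(u, v) \<in> pres_rel X E \<Longrightarrow> u \<in> words X \<and> v \<in> words X"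
  by (induction rule: pres_rel.induct) auto

lemma equiv_pres_rel: "equiv (words X) (pres_rel X E)"
proof (rule equivI)
  show "pres_rel X E \<subseteq> words X \<times> words X" using pres_rel_words by fast
  show "refl_on (words X) (pres_rel X E)" by (auto intro!: refl_onI pres_refl)
  show "sym (pres_rel X E)" by (auto intro: symI pres_sym)
  show "trans (pres_rel X E)" by (rule transI) (rule pres_trans)
qed

abbreviation (input) pres_class where "pres_class X E u \<equiv> pres_rel X E `` {u}"

lemma pres_class_eq:
  "u \<in> words X \<Longrightarrow> v \<in> words X \<Longrightarrow>
    pres_class X E u = pres_class X E v \<longleftrightarrow> (u, v) \<in> pres_rel X E"
  using eq_equiv_class_iff[OF equiv_pres_rel] by blast

lemma presented_group_carrier: 
  "A \<in> carrier (presented_group X E) \<longleftrightarrow> (\<exists>u\<in>words X. A = pres_class X E u)"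
  by (auto simp: presented_group_def quotient_def)

lemma presented_group_mult:
  assumes "u \<in> words X" "v \<in> words X"
  shows "pres_class X E u \<otimes>\<^bsub>presented_group X E\<^esub> pres_class X E v = pres_class X E (u @ v)"
proof -
  have "congruent2 (pres_rel X E) (pres_rel X E) (\<lambda>u v. pres_class X E (u @ v))"
    by (rule congruent2I') (metis pres_append pres_class_eq pres_rel_words words_simps(2))
  from UN_equiv_class2[OF equiv_pres_rel equiv_pres_rel this assms]
  show ?thesis by (simp add: presented_group_def)
qed

lemma presented_group_one: "\<one>\<^bsub>presented_group X E\<^esub> = pres_class X E []"
  by (simp add: presented_group_def)

definition word_inv :: "('a \<times> bool) list \<Rightarrow> ('a \<times> bool) list" where
  "word_inv u = map (\<lambda>(x, b). (x, \<not> b)) (rev u)"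

lemma word_inv_cancel:
  "u \<in> words X \<Longrightarrow> word_inv u \<in> words X \<and> (word_inv u @ u, []) \<in> pres_rel X E"
proof (induction u)
  case Nil
  then show ?case by (auto simp: word_inv_def intro: pres_refl)
next
  case (Cons a u)
  obtain x b where a: "a = (x, b)" by force
  with Cons have x: "x \<in> X" and u: "u \<in> words X" and iu: "word_inv u \<in> words X"
    and IH: "(word_inv u @ u, []) \<in> pres_rel X E" by auto
  have w: "word_inv (a # u) = word_inv u @ [(x, \<not> b)]" by (simp add: word_inv_def a)
  have "([(x, \<not> b), (x, b)], []) \<in> pres_rel X E" using pres_cancel[OF x, of "\<not> b"] by simp
  then have "([(x, \<not> b), (x, b)] @ u, [] @ u) \<in> pres_rel X E"
    by (rule pres_append) (rule pres_refl[OF u])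
  then have "(word_inv u @ ([(x, \<not> b), (x, b)] @ u), word_inv u @ ([] @ u)) \<in> pres_rel X E"
    by (rule pres_append[OF pres_refl[OF iu]])
  then have "(word_inv u @ ([(x, \<not> b), (x, b)] @ u), []) \<in> pres_rel X E"
    using IH pres_trans by fastforce
  then show ?case using w x iu a by simp
qed

lemma group_presented_group: "group (presented_group X E)"
proof (rule groupI)
  fix A assume "A \<in> carrier (presented_group X E)"
  then obtain u where u: "u \<in> words X" "A = pres_class X E u"
    by (auto simp: presented_group_carrier)
  have "pres_class X E (word_inv u) \<otimes>\<^bsub>presented_group X E\<^esub> A = \<one>\<^bsub>presented_group X E\<^esub>"
    using u word_inv_cancel[OF u(1)]
    by (simp add: presented_group_mult presented_group_one pres_class_eq)
  then show "\<exists>A'\<in>carrier (presented_group X E). A' \<otimes>\<^bsub>presented_group X E\<^esub> A = \<one>\<^bsub>presented_group X E\<^esub>"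
    using word_inv_cancel[OF u(1)] presented_group_carrier by blast
next
  fix A C assume "A \<in> carrier (presented_group X E)" "C \<in> carrier (presented_group X E)"
  then show "A \<otimes>\<^bsub>presented_group X E\<^esub> C \<in> carrier (presented_group X E)"
    unfolding presented_group_carrier using presented_group_mult words_simps(2) by metis
next
  show "\<one>\<^bsub>presented_group X E\<^esub> \<in> carrier (presented_group X E)"
    unfolding presented_group_carrier presented_group_one using words_simps(1) by blast
next
  fix A C D assume "A \<in> carrier (presented_group X E)" "C \<in> carrier (presented_group X E)"
    "D \<in> carrier (presented_group X E)"
  then show "A \<otimes>\<^bsub>presented_group X E\<^esub> C \<otimes>\<^bsub>presented_group X E\<^esub> D =
      A \<otimes>\<^bsub>presented_group X E\<^esub> (C \<otimes>\<^bsub>presented_group X E\<^esub> D)"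
    unfolding presented_group_carrier by (elim bexE) (simp add: presented_group_mult)
next
  fix A assume "A \<in> carrier (presented_group X E)"
  then show "\<one>\<^bsub>presented_group X E\<^esub> \<otimes>\<^bsub>presented_group X E\<^esub> A = A"
    unfolding presented_group_carrier presented_group_one
    by (elim bexE) (simp add: presented_group_mult)
qed

lemma pres_gen_carrier: "x \<in> X \<Longrightarrow> pres_gen X E x \<in> carrier (presented_group X E)"
  by (auto simp: pres_gen_def presented_group_carrier intro!: bexI[of _ "[(x, True)]"])

primrec word_eval :: "('b, 'm) monoid_scheme \<Rightarrow> ('a \<Rightarrow> 'b) \<Rightarrow> ('a \<times> bool) list \<Rightarrow> 'b" where
  "word_eval G f [] = \<one>\<^bsub>G\<^esub>"
| "word_eval G f (a # u) =
    (if snd a then f (fst a) else inv\<^bsub>G\<^esub> (f (fst a))) \<otimes>\<^bsub>G\<^esub> word_eval G f u"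

context group begin

lemma word_eval_closed: "f \<in> X \<rightarrow> carrier G \<Longrightarrow> u \<in> words X \<Longrightarrow> word_eval G f u \<in> carrier G"
  by (induction u) auto

lemma word_eval_append:
  "f \<in> X \<rightarrow> carrier G \<Longrightarrow> u \<in> words X \<Longrightarrow> v \<in> words X \<Longrightarrow>
    word_eval G f (u @ v) = word_eval G f u \<otimes> word_eval G f v"
proof (induction u)
  case Nil then show ?case by (simp add: word_eval_closed)
next
  case (Cons a u)
  then have "f (fst a) \<in> carrier G" by auto
  then show ?case using Cons word_eval_closed[OF Cons.prems(1)] by (simp add: m_assoc)
qed

text \<open>Universal property of a presentation.\<close>

lemma presented_group_universal:
  assumes f: "f \<in> X \<rightarrow> carrier G"
    and E: "\<And>u v. (u, v) \<in> E \<Longrightarrow> u \<in> words X \<Longrightarrow> v \<in> words X \<Longrightarrow> word_eval G f u = word_eval G f v"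
  shows "\<exists>h \<in> hom (presented_group X E) G. \<forall>x\<in>X. h (pres_gen X E x) = f x"
proof -
  have inv: "word_eval G f u = word_eval G f v" if "(u, v) \<in> pres_rel X E" for u v
    using that
  proof (induction rule: pres_rel.induct)
    case (pres_append u u' v v')
    then show ?case using word_eval_append[OF f] pres_rel_words by metis
  next
    case (pres_cancel x b)
    then have "f x \<in> carrier G" using f by auto
    then show ?case by (cases b) auto
  qed (use E in auto)
  define h where "h A = word_eval G f (SOME u. u \<in> A)" for A
  have h: "h (pres_class X E u) = word_eval G f u" if "u \<in> words X" for u
  proof -
    have "u \<in> pres_class X E u" using pres_refl[OF that] by blast
    then have "(SOME v. v \<in> pres_class X E u) \<in> pres_class X E u" by (rule someI)
    then show ?thesis unfolding h_def using inv by force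
  qed
  have "h \<in> hom (presented_group X E) G"
    by (rule homI)
       (auto simp: presented_group_carrier presented_group_mult h word_eval_append[OF f]
          word_eval_closed[OF f])
  moreover have "h (pres_gen X E x) = f x" if "x \<in> X" for x
  proof -
    have "f x \<in> carrier G" using f that by auto
    then show ?thesis using h[of "[(x, True)]"] that by (simp add: pres_gen_def)
  qed
  ultimately show ?thesis by blast
qed

end


section \<open>Semilattices\<close>

definition zspan :: "'v::real_vector set \<Rightarrow> 'v set" where
  "zspan S = {\<Sum>x\<in>F. of_int (c x) *\<^sub>R x | (F :: 'v set) (c :: 'v \<Rightarrow> int). finite F \<and> F \<subseteq> S}"

definition semilattice_in :: "'v::euclidean_space set \<Rightarrow> 'v set \<Rightarrow> bool" where
  "semilattice_in U S \<longleftrightarrow>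
     S \<subseteq> U \<and> span S = U \<and> discrete S \<and> 0 \<in> S \<and>
     S = {x + 2 *\<^sub>R y | x y. x \<in> S \<and> y \<in> S} \<union> {x - 2 *\<^sub>R y | x y. x \<in> S \<and> y \<in> S}"

definition is_lattice :: "'v::real_vector set \<Rightarrow> bool" where
  "is_lattice S \<longleftrightarrow> S = zspan S"

definition zbasis :: "'i set \<Rightarrow> ('i \<Rightarrow> 'v::real_vector) \<Rightarrow> 'v set \<Rightarrow> bool" where
  "zbasis I \<sigma> L \<longleftrightarrow>
     L = {\<Sum>i\<in>I. of_int (c i) *\<^sub>R \<sigma> i | c :: 'i \<Rightarrow> int. True} \<and>
     (\<forall>c :: 'i \<Rightarrow> int. (\<Sum>i\<in>I. of_int (c i) *\<^sub>R \<sigma> i) = 0 \<longrightarrow> (\<forall>i\<in>I. c i = 0))"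


section \<open>Finite root systems of non-simply laced type\<close>

definition reflection :: "('v \<Rightarrow> 'v \<Rightarrow> real) \<Rightarrow> 'v \<Rightarrow> 'v \<Rightarrow> 'v::real_vector" where
  "reflection B \<alpha> u = u - B u ((2 / B \<alpha> \<alpha>) *\<^sub>R \<alpha>) *\<^sub>R \<alpha>"

datatype nsl_type = TypeB nat | TypeC nat | TypeF4 | TypeG2

fun admissible :: "nsl_type \<Rightarrow> bool" where
  "admissible (TypeB l) \<longleftrightarrow> 2 \<le> l"
| "admissible (TypeC l) \<longleftrightarrow> 3 \<le> l"
| "admissible TypeF4 \<longleftrightarrow> True"
| "admissible TypeG2 \<longleftrightarrow> True"

fun type_rank :: "nsl_type \<Rightarrow> nat" where
  "type_rank (TypeB l) = l"
| "type_rank (TypeC l) = l"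
| "type_rank TypeF4 = 4"
| "type_rank TypeG2 = 2"

fun type_k :: "nsl_type \<Rightarrow> real" where
  "type_k TypeG2 = 3"
| "type_k _ = 2"

text \<open>
  Cartan matrices in Bourbaki's numbering, with \<open>(i, j)\<close> entry
  \<open>2 (\<alpha>\<^sub>i, \<alpha>\<^sub>j) / (\<alpha>\<^sub>j, \<alpha>\<^sub>j)\<close>, \<open>1 \<le> i, j \<le> l\<close>. Only the off-diagonal entries of absolute
  value greater than 1 distinguish the types (all four diagrams are paths).
\<close>

fun multiple_bond :: "nsl_type \<Rightarrow> nat \<Rightarrow> nat \<Rightarrow> int" where
  "multiple_bond (TypeB l) i j = (if i + 1 = l \<and> j = l then 2 else 1)"
| "multiple_bond (TypeC l) i j = (if i = l \<and> j + 1 = l then 2 else 1)"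
| "multiple_bond TypeF4 i j = (if i = 2 \<and> j = 3 then 2 else 1)"
| "multiple_bond TypeG2 i j = (if i = 2 \<and> j = 1 then 3 else 1)"

definition cartan_entry :: "nsl_type \<Rightarrow> nat \<Rightarrow> nat \<Rightarrow> int" where
  "cartan_entry X i j =
     (if i = j then 2 else if i = j + 1 \<or> j = i + 1 then - multiple_bond X i j else 0)"

text \<open>Root systems here contain \<open>0\<close>. Reducedness is part of the definition.\<close>

definition finite_root_system :: "('v::real_vector \<Rightarrow> 'v \<Rightarrow> real) \<Rightarrow> 'v set \<Rightarrow> 'v set \<Rightarrow> bool" where
  "finite_root_system B V \<Phi> \<longleftrightarrow>
     finite \<Phi> \<and> 0 \<in> \<Phi> \<and> span \<Phi> = V \<and>
     (\<forall>\<alpha>\<in>\<Phi> - {0}. 0 < B \<alpha> \<alpha>) \<and>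
     (\<forall>\<alpha>\<in>\<Phi> - {0}. \<forall>\<beta>\<in>\<Phi>. reflection B \<alpha> \<beta> \<in> \<Phi>) \<and>
     (\<forall>\<alpha>\<in>\<Phi> - {0}. \<forall>\<beta>\<in>\<Phi>. 2 * B \<beta> \<alpha> / B \<alpha> \<alpha> \<in> \<int>) \<and>
     (\<forall>\<alpha>\<in>\<Phi> - {0}. \<forall>c. c *\<^sub>R \<alpha> \<in> \<Phi> - {0} \<longrightarrow> c = 1 \<or> c = -1)"

definition irreducible_roots :: "('v::real_vector \<Rightarrow> 'v \<Rightarrow> real) \<Rightarrow> 'v set \<Rightarrow> bool" where
  "irreducible_roots B \<Phi> \<longleftrightarrow> \<Phi> - {0} \<noteq> {} \<and>
     \<not> (\<exists>P Q. P \<noteq> {} \<and> Q \<noteq> {} \<and> P \<union> Q = \<Phi> - {0} \<and> P \<inter> Q = {} \<and> (\<forall>\<alpha>\<in>P. \<forall>\<beta>\<in>Q. B \<alpha> \<beta> = 0))"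

definition root_base :: "'v::real_vector set \<Rightarrow> nat \<Rightarrow> (nat \<Rightarrow> 'v) \<Rightarrow> bool" where
  "root_base \<Phi> l b \<longleftrightarrow>
     inj_on b {1..l} \<and> b ` {1..l} \<subseteq> \<Phi> - {0} \<and> independent (b ` {1..l}) \<and>
     (\<forall>\<beta>\<in>\<Phi>. \<exists>c :: nat \<Rightarrow> nat.
        \<beta> = (\<Sum>i\<in>{1..l}. of_nat (c i) *\<^sub>R b i) \<or> \<beta> = - (\<Sum>i\<in>{1..l}. of_nat (c i) *\<^sub>R b i))"

definition root_system_of_type ::
    "nsl_type \<Rightarrow> ('v::real_vector \<Rightarrow> 'v \<Rightarrow> real) \<Rightarrow> 'v set \<Rightarrow> 'v set \<Rightarrow> bool" where
  "root_system_of_type X B V \<Phi> \<longleftrightarrow>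
     finite_root_system B V \<Phi> \<and> irreducible_roots B \<Phi> \<and>
     (\<exists>b. root_base \<Phi> (type_rank X) b \<and>
        (\<forall>i\<in>{1..type_rank X}. \<forall>j\<in>{1..type_rank X}.
           2 * B (b i) (b j) / B (b j) (b j) = of_int (cartan_entry X i j)))"

definition short_roots :: "('v::zero \<Rightarrow> 'v \<Rightarrow> real) \<Rightarrow> 'v set \<Rightarrow> 'v set" where
  "short_roots B \<Phi> = {\<alpha> \<in> \<Phi> - {0}. \<forall>\<beta>\<in>\<Phi> - {0}. B \<alpha> \<alpha> \<le> B \<beta> \<beta>}"

definition long_roots :: "('v::zero \<Rightarrow> 'v \<Rightarrow> real) \<Rightarrow> 'v set \<Rightarrow> 'v set" where
  "long_roots B \<Phi> = {\<alpha> \<in> \<Phi> - {0}. \<forall>\<beta>\<in>\<Phi> - {0}. B \<beta> \<beta> \<le> B \<alpha> \<alpha>}"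


section \<open>Reduced non-simply laced extended affine root systems\<close>

text \<open>
  The space \<open>\<V>\<close> is the whole type \<open>'v\<close>. The class \<^class>\<open>euclidean_space\<close> only supplies finite
  dimension and the vector space topology (used for discreteness); its inner product plays
  no role, the form of the root system being the parameter \<open>B\<close>. The subspaces \<open>Vd\<close>, \<open>V1\<close>, \<open>V2\<close>
  are \<open>\<V>\<close>-dot and the two summands of the radical \<open>V1 + V2\<close>; sums of sets are elementwise.
\<close>

locale ears_data =
  fixes X :: nsl_type
    and \<nu> t :: nat
    and B :: "'v::euclidean_space \<Rightarrow> 'v \<Rightarrow> real"
    and Vd V1 V2 :: "'v set"
    and Rd :: "'v set"
    and S1 S2 :: "'v set"
  assumes type_X: "admissible X"
    and form_bilinear: "bilinear B"
    and form_sym: "\<And>u v. B u v = B v u"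
    and form_psd: "\<And>v. 0 \<le> B v v"
    and subspaces: "subspace Vd" "subspace V1" "subspace V2"
    and radical: "{v. \<forall>u. B v u = 0} = V1 + V2"
    and radical_direct: "V1 \<inter> V2 = {0}"
    and V_sum: "Vd + (V1 + V2) = UNIV"
    and V_direct: "Vd \<inter> (V1 + V2) = {0}"
    and twist_le: "t \<le> \<nu>"
    and dim_V1: "dim V1 = t"
    and dim_V2: "dim V2 = \<nu> - t"
    and finite_roots: "root_system_of_type X B Vd Rd"
    and semilattice_S1: "semilattice_in V1 S1"
    and semilattice_S2: "semilattice_in V2 S2"
    and lattice_B: "\<And>l. X = TypeB l \<Longrightarrow> 3 \<le> l \<Longrightarrow> is_lattice S2"
    and lattice_C: "\<And>l. X = TypeC l \<Longrightarrow> is_lattice S1"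
    and lattice_FG: "X = TypeF4 \<or> X = TypeG2 \<Longrightarrow> is_lattice S1 \<and> is_lattice S2"

definition ears_roots ::
    "nsl_type \<Rightarrow> ('v::real_vector \<Rightarrow> 'v \<Rightarrow> real) \<Rightarrow> 'v set \<Rightarrow> 'v set \<Rightarrow> 'v set \<Rightarrow> 'v set" where
  "ears_roots X B Rd S1 S2 =
     ((S1 + zspan S2) + (S1 + zspan S2)) \<union>
     (short_roots B Rd + (S1 + zspan S2)) \<union>
     (long_roots B Rd + ((\<lambda>x. type_k X *\<^sub>R x) ` zspan S1 + S2))"

definition nonisotropic :: "('v \<Rightarrow> 'v \<Rightarrow> real) \<Rightarrow> 'v set \<Rightarrow> 'v set" where
  "nonisotropic B R = {\<alpha> \<in> R. B \<alpha> \<alpha> \<noteq> 0}"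


section \<open>The extended affine Weyl group and the group presented by conjugation\<close>

text \<open>
  The dual of the radical is realised as the space of linear functionals on \<open>\<V>\<close> vanishing on
  the complement \<open>Vd\<close> of the radical (restriction to the radical identifies the two; linear
  maps on a finite-dimensional space are bounded). Under this identification
  \<open>f (\<beta> + \<delta>) = f \<delta>\<close> for \<open>\<beta>\<close> in \<open>Vd\<close> and \<open>\<delta>\<close> in the radical.
\<close>

definition ext_space :: "'v::euclidean_space set \<Rightarrow> ('v \<times> ('v \<Rightarrow>\<^sub>L real)) set" where
  "ext_space Vd = UNIV \<times> {f. \<forall>v\<in>Vd. blinfun_apply f v = 0}"

definition ext_form ::
    "('v::euclidean_space \<Rightarrow> 'v \<Rightarrow> real) \<Rightarrow> 'v \<times> ('v \<Rightarrow>\<^sub>L real) \<Rightarrow> 'v \<times> ('v \<Rightarrow>\<^sub>L real) \<Rightarrow> real" where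
  "ext_form B = (\<lambda>(v1, f1) (v2, f2). B v1 v2 + blinfun_apply f1 v2 + blinfun_apply f2 v1)"

definition GL_group :: "'a::real_vector set \<Rightarrow> ('a \<Rightarrow> 'a) monoid" where
  "GL_group T = (BijGroup T)\<lparr>carrier :=
     {f \<in> Bij T. (\<forall>x\<in>T. \<forall>y\<in>T. f (x + y) = f x + f y) \<and> (\<forall>c. \<forall>x\<in>T. f (c *\<^sub>R x) = c *\<^sub>R f x)}\<rparr>"

definition weyl_reflection ::
    "('v::euclidean_space \<Rightarrow> 'v \<Rightarrow> real) \<Rightarrow> 'v set \<Rightarrow> 'v \<Rightarrow>
      ('v \<times> ('v \<Rightarrow>\<^sub>L real) \<Rightarrow> 'v \<times> ('v \<Rightarrow>\<^sub>L real))" where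
  "weyl_reflection B Vd \<alpha> = restrict (reflection (ext_form B) (\<alpha>, 0)) (ext_space Vd)"

definition weyl_group ::
    "('v::euclidean_space \<Rightarrow> 'v \<Rightarrow> real) \<Rightarrow> 'v set \<Rightarrow> 'v set \<Rightarrow>
      ('v \<times> ('v \<Rightarrow>\<^sub>L real) \<Rightarrow> 'v \<times> ('v \<Rightarrow>\<^sub>L real)) monoid" where
  "weyl_group B Vd R =
     subgroup_generated (GL_group (ext_space Vd)) (weyl_reflection B Vd ` nonisotropic B R)"

definition conj_relations ::
    "('v::real_vector \<Rightarrow> 'v \<Rightarrow> real) \<Rightarrow> 'v set \<Rightarrow> (('v \<times> bool) list \<times> ('v \<times> bool) list) set" where
  "conj_relations B R =
     {([(\<alpha>, True), (\<alpha>, True)], []) | \<alpha>. \<alpha> \<in> nonisotropic B R} \<union>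
     {([(\<alpha>, True), (\<beta>, True), (\<alpha>, True)], [(reflection B \<alpha> \<beta>, True)]) | \<alpha> \<beta>.
        \<alpha> \<in> nonisotropic B R \<and> \<beta> \<in> nonisotropic B R}"

definition conj_group ::
    "('v::real_vector \<Rightarrow> 'v \<Rightarrow> real) \<Rightarrow> 'v set \<Rightarrow> ('v \<times> bool) list set monoid" where
  "conj_group B R = presented_group (nonisotropic B R) (conj_relations B R)"

definition conj_gen :: "('v::real_vector \<Rightarrow> 'v \<Rightarrow> real) \<Rightarrow> 'v set \<Rightarrow> 'v \<Rightarrow> ('v \<times> bool) list set" where
  "conj_gen B R \<alpha> = pres_gen (nonisotropic B R) (conj_relations B R) \<alpha>"

lemma reflection_alt:
  assumes "bilinear B"
  shows "reflection B a u = u - (2 * B u a / B a a) *\<^sub>R a"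
  using assms by (simp add: reflection_def bilinear_rmul)

lemma reflection_conj:
  assumes B: "bilinear B" and sym: "\<And>u v. B u v = B v u" and a: "B a a \<noteq> 0"
  shows "reflection B a (reflection B a u) = u"
    and "B (reflection B a u) (reflection B a v) = B u v"
    and "reflection B a (reflection B b (reflection B a u)) = reflection B (reflection B a b) u"
    and "reflection B a (u + v) = reflection B a u + reflection B a v"
    and "reflection B a (c *\<^sub>R u) = c *\<^sub>R reflection B a u"
proof -
  note s = reflection_alt[OF B] bilinear_lsub[OF B] bilinear_rsub[OF B]
    bilinear_lmul[OF B] bilinear_rmul[OF B] bilinear_ladd[OF B] bilinear_radd[OF B]
  have neg: "B (reflection B a u) a = - B u a" for u
    using a by (simp add: s)
  show invol: "reflection B a (reflection B a u) = u" for u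
    using neg[of u] by (simp add: reflection_alt[OF B])
  show iso: "B (reflection B a u) (reflection B a v) = B u v" for u v
  proof -
    have "B (reflection B a u) (reflection B a v) =
        B (reflection B a u) v - (2 * B v a / B a a) * B (reflection B a u) a"
      by (simp only: reflection_alt[OF B, of a v] bilinear_rsub[OF B] bilinear_rmul[OF B] real_scaleR_def)
    also have "\<dots> = B u v"
      using sym[of a v] by (simp only: neg) (simp add: s)
    finally show ?thesis .
  qed
  show add: "reflection B a (u + v) = reflection B a u + reflection B a v" for u v
    by (simp add: reflection_alt[OF B] bilinear_ladd[OF B] distrib_left add_divide_distrib scaleR_add_left)
  show scale: "reflection B a (c *\<^sub>R u) = c *\<^sub>R reflection B a u" for c u
    by (simp add: reflection_alt[OF B] bilinear_lmul[OF B] scaleR_diff_right mult.left_commute)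
  have diff: "reflection B a (u - v) = reflection B a u - reflection B a v" for u v
    using add[of "u - v" v] by simp
  have "B (reflection B a u) b = B u (reflection B a b)"
    using iso[of u "reflection B a b"] by (simp add: invol)
  then show "reflection B a (reflection B b (reflection B a u)) = reflection B (reflection B a b) u"
    by (simp add: reflection_alt[OF B, of b] reflection_alt[OF B, of "reflection B a b"]
        diff scale invol iso)
qed

lemma ext_form_bilinear:
  assumes "bilinear B" shows "bilinear (ext_form B)"
  unfolding bilinear_def
  by (auto intro!: linearI simp: ext_form_def split_beta bilinear_ladd[OF assms] bilinear_radd[OF assms]
       bilinear_lmul[OF assms] bilinear_rmul[OF assms] blinfun.bilinear_simps algebra_simps)

lemma group_GL_group: "subspace T \<Longrightarrow> group (GL_group T)"
proof -
  assume T: "subspace T"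
  let ?L = "{f \<in> Bij T. (\<forall>x\<in>T. \<forall>y\<in>T. f (x + y) = f x + f y) \<and> (\<forall>c. \<forall>x\<in>T. f (c *\<^sub>R x) = c *\<^sub>R f x)}"
  interpret BG: group "BijGroup T" by (rule group_BijGroup)
  have "subgroup ?L (BijGroup T)"
  proof (rule BG.subgroupI)
    show "?L \<subseteq> carrier (BijGroup T)" by (auto simp: BijGroup_def)
    have "(\<lambda>x\<in>T. x) \<in> ?L"
      using id_Bij[of T] by (auto simp: subspace_add[OF T] subspace_scale[OF T])
    then show "?L \<noteq> {}" by blast
  next
    fix f assume f: "f \<in> ?L"
    then have fB: "f \<in> Bij T" and fT: "bij_betw f T T" by (auto simp: Bij_def)
    have add: "f (x + y) = f x + f y" and sc: "f (c *\<^sub>R x) = c *\<^sub>R f x" if "x \<in> T" "y \<in> T" for x y c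
      using f that by auto
    let ?g = "\<lambda>x\<in>T. inv_into T f x"
    have gT: "?g x \<in> T" and fg: "f (?g x) = x" if "x \<in> T" for x
      using that fT by (auto simp: bij_betw_def inv_into_into f_inv_into_f)
    have gf: "?g (f x) = x" if "x \<in> T" for x
      using that fT by (auto simp: bij_betw_def inv_into_f_f)
    have "?g (x + y) = ?g x + ?g y" if "x \<in> T" "y \<in> T" for x y
      using gf[of "?g x + ?g y"] add[of "?g x" "?g y"] fg that gT subspace_add[OF T] by metis
    moreover have "?g (c *\<^sub>R x) = c *\<^sub>R ?g x" if "x \<in> T" for x c
      using gf[of "c *\<^sub>R ?g x"] sc[of "?g x"] fg that gT subspace_scale[OF T] by metis
    ultimately have "?g \<in> ?L" using restrict_inv_into_Bij[OF fB] by blast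
    then show "inv\<^bsub>BijGroup T\<^esub> f \<in> ?L" using inv_BijGroup[OF fB] by simp
  next
    fix f g assume "f \<in> ?L" "g \<in> ?L"
    moreover from this have "g x \<in> T" if "x \<in> T" for x
      using that by (auto simp: Bij_def bij_betw_def)
    ultimately show "f \<otimes>\<^bsub>BijGroup T\<^esub> g \<in> ?L"
      using compose_Bij[of f T g]
      by (auto simp: BijGroup_def compose_def subspace_add[OF T] subspace_scale[OF T])
  qed
  then show ?thesis
    unfolding GL_group_def by (rule BG.subgroup_imp_group)
qed

lemma subspace_ext_space: "subspace (ext_space Vd)"
  by (auto simp: subspace_def ext_space_def blinfun.bilinear_simps zero_prod_def)

text \<open>The epimorphism from the conjugation group onto the Weyl group exists.\<close>

lemma conj_epi_exists:
  assumes B: "bilinear B" and sym: "\<And>u v. B u v = B v u"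
  shows "\<exists>\<psi> \<in> epi (conj_group B R) (weyl_group B Vd R).
           \<forall>\<alpha>\<in>nonisotropic B R. \<psi> (conj_gen B R \<alpha>) = weyl_reflection B Vd \<alpha>"
proof -
  let ?T = "ext_space Vd" and ?N = "nonisotropic B R" and ?w = "weyl_reflection B Vd"
  let ?G = "GL_group ?T" and ?W = "weyl_group B Vd R"
  interpret GL: group ?G by (rule group_GL_group[OF subspace_ext_space])
  interpret W: group ?W unfolding weyl_group_def by (rule GL.group_subgroup_generated)
  note eb = ext_form_bilinear[OF B]
  have esym: "ext_form B u v = ext_form B v u" for u v
    by (cases u; cases v) (simp add: ext_form_def sym)
  have e0: "ext_form B (u, 0) (v, 0) = B u v" for u v by (simp add: ext_form_def)
  have ne: "ext_form B (a, 0) (a, 0) \<noteq> 0" if "a \<in> ?N" for a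
    using that by (simp add: e0 nonisotropic_def)
  note r = reflection_conj[OF eb esym ne]
  have rT: "reflection (ext_form B) (a, 0) u \<in> ?T" if "u \<in> ?T" for a u
    using that by (cases u) (simp add: reflection_def ext_space_def)
  have wGL: "?w a \<in> carrier ?G" if a: "a \<in> ?N" for a
  proof -
    have "bij_betw (?w a) ?T ?T"
      by (rule bij_betw_byWitness[where f' = "?w a"])
         (auto simp: weyl_reflection_def rT r(1)[OF a])
    then show ?thesis
      by (auto simp: GL_group_def Bij_def weyl_reflection_def r(4,5)[OF a]
          subspace_add[OF subspace_ext_space] subspace_scale[OF subspace_ext_space])
  qed
  have wW: "?w a \<in> carrier ?W" if "a \<in> ?N" for a
    using that wGL unfolding weyl_group_def carrier_subgroup_generated
    by (blast intro: generate.incl)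
  have multW: "f \<otimes>\<^bsub>?W\<^esub> g = compose ?T f g" if "f \<in> carrier ?W" "g \<in> carrier ?W" for f g
  proof -
    have "f \<in> carrier ?G" "g \<in> carrier ?G"
      using that GL.carrier_subgroup_generated_subset unfolding weyl_group_def by blast+
    then show ?thesis
      by (simp add: weyl_group_def subgroup_generated_def GL_group_def BijGroup_def)
  qed
  have oneW: "\<one>\<^bsub>?W\<^esub> = (\<lambda>x\<in>?T. x)"
    by (simp add: weyl_group_def subgroup_generated_def GL_group_def BijGroup_def)
  have sq: "?w a \<otimes>\<^bsub>?W\<^esub> ?w a = \<one>\<^bsub>?W\<^esub>" if a: "a \<in> ?N" for a
    unfolding multW[OF wW[OF a] wW[OF a]] oneW compose_def
    by (rule restrict_ext) (simp add: weyl_reflection_def rT r(1)[OF a])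
  have braid: "?w a \<otimes>\<^bsub>?W\<^esub> (?w b \<otimes>\<^bsub>?W\<^esub> ?w a) = ?w (reflection B a b)" if ab: "a \<in> ?N" "b \<in> ?N" for a b
  proof -
    have "reflection (ext_form B) (a, 0) (b, 0) = (reflection B a b, 0)"
      by (simp add: reflection_def e0)
    then have "reflection (ext_form B) (a, 0) (reflection (ext_form B) (b, 0) (reflection (ext_form B) (a, 0) u))
        = reflection (ext_form B) (reflection B a b, 0) u" for u
      using r(3)[OF ab(1), of "(b, 0)" u] by simp
    note this [simp]
    have ba: "?w b \<otimes>\<^bsub>?W\<^esub> ?w a \<in> carrier ?W" using wW ab by blast
    have "compose ?T (?w a) (compose ?T (?w b) (?w a)) = ?w (reflection B a b)"
      unfolding compose_def weyl_reflection_def by (rule restrict_ext) (simp add: rT)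
    then show ?thesis
      using multW[OF wW[OF ab(1)] ba] multW[OF wW[OF ab(2)] wW[OF ab(1)]] by simp
  qed
  have "\<exists>h \<in> hom (presented_group ?N (conj_relations B R)) ?W.
      \<forall>x\<in>?N. h (pres_gen ?N (conj_relations B R) x) = ?w x"
  proof (rule W.presented_group_universal)
    show "?w \<in> ?N \<rightarrow> carrier ?W" using wW by blast
  next
    fix u v assume "(u, v) \<in> conj_relations B R" "u \<in> words ?N" "v \<in> words ?N"
    then show "word_eval ?W ?w u = word_eval ?W ?w v"
      by (auto simp: conj_relations_def wW sq braid)
  qed
  then obtain h where h: "h \<in> hom (conj_group B R) ?W"
      and hg: "\<And>a. a \<in> ?N \<Longrightarrow> h (conj_gen B R a) = ?w a"
    unfolding conj_group_def conj_gen_def by blast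
  interpret C: group "conj_group B R" unfolding conj_group_def by (rule group_presented_group)
  interpret h: group_hom "conj_group B R" ?W h
    by unfold_locales (rule h)
  have sub: "subgroup (h ` carrier (conj_group B R)) ?W" by (rule h.img_is_subgroup)
  have gsub: "?w ` ?N \<subseteq> h ` carrier (conj_group B R)"
  proof
    fix f assume "f \<in> ?w ` ?N"
    then obtain a where a: "a \<in> ?N" "f = ?w a" by blast
    have "conj_gen B R a \<in> carrier (conj_group B R)"
      unfolding conj_gen_def conj_group_def by (rule pres_gen_carrier[OF a(1)])
    then have "h (conj_gen B R a) \<in> h ` carrier (conj_group B R)" by (rule imageI)
    then show "f \<in> h ` carrier (conj_group B R)" by (simp only: hg[OF a(1)] a(2))
  qed
  have subG: "subgroup (h ` carrier (conj_group B R)) ?G"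
  proof -
    have "subgroup (carrier ?W) ?G"
      unfolding weyl_group_def carrier_subgroup_generated
      by (rule GL.generate_is_subgroup) blast
    moreover have eq: "?W = ?G\<lparr>carrier := carrier ?W\<rparr>"
      by (simp add: weyl_group_def subgroup_generated_def)
    have "subgroup (h ` carrier (conj_group B R)) (?G\<lparr>carrier := carrier ?W\<rparr>)"
      by (rule subst[where P = "subgroup (h ` carrier (conj_group B R))", OF eq sub])
    ultimately show ?thesis by (rule GL.incl_subgroup)
  qed
  have "carrier ?W \<subseteq> h ` carrier (conj_group B R)"
    unfolding weyl_group_def
    by (rule GL.subgroup_generated_minimal[OF subG gsub])
  then have "h \<in> epi (conj_group B R) ?W"
    using h h.img_is_subgroup subgroup.subset unfolding epi_def by blast
  then show ?thesis using hg by blast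
qed


section \<open>Supports\<close>

definition supp :: "nat set \<Rightarrow> (nat \<Rightarrow> 'v::comm_monoid_add) \<Rightarrow> 'v set \<Rightarrow> nat set set" where
  "supp I \<sigma> S = {J. J \<subseteq> I \<and> (\<Sum>r\<in>J. \<sigma> r) \<in> S}"

definition Esupp :: "nat set \<Rightarrow> (nat \<Rightarrow> 'v::comm_monoid_add) \<Rightarrow> 'v set \<Rightarrow> nat set set" where
  "Esupp I \<sigma> S = {J \<in> supp I \<sigma> S. 3 \<le> card J}"

fun J_family ::
    "nsl_type \<Rightarrow> nat \<Rightarrow> nat \<Rightarrow> (nat \<Rightarrow> 'v::comm_monoid_add) \<Rightarrow> 'v set \<Rightarrow> 'v set \<Rightarrow> nat set set" where
  "J_family (TypeB l) \<nu> t \<sigma> S1 S2 =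
     (if l = 2 then Esupp {1..t} \<sigma> S1 \<union> Esupp {t+1..\<nu>} \<sigma> S2 else Esupp {1..t} \<sigma> S1)"
| "J_family (TypeC l) \<nu> t \<sigma> S1 S2 = Esupp {t+1..\<nu>} \<sigma> S2"
| "J_family TypeF4 \<nu> t \<sigma> S1 S2 = {}"
| "J_family TypeG2 \<nu> t \<sigma> S1 S2 = {}"

end

theory Submission
  imports Defs
begin

text \<open>
  Conjugation by an element of the presented group permutes the generators,
  exactly as the corresponding element of the Weyl group permutes the nonisotropic roots. Since the
  generators generate, an element that fixes every generator is central. So the kernel is central,
  and so is every commutator of two lifted translations \<open>F \<gamma> \<delta> = s \<gamma> \<delta> \<otimes> s \<gamma> 0\<close>, because
  translations commute as permutations of the roots.

  A product of lifts for one root \<open>\<gamma>\<close> differs from the lift at the sum by a central defect. The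
  commutator of \<open>F \<alpha> \<epsilon>\<close> and \<open>F \<gamma> \<delta>\<close> is itself such a defect, for the shifts \<open>\<delta>\<close> and
  \<open>n \<gamma> \<alpha> \<epsilon>\<close>, where \<open>n \<gamma> \<alpha>\<close> is the Cartan integer (\<open>cmt_F\<close>). In the plane of two
  basis shifts all defects are powers of a single one (\<open>c_plane\<close>), for short and long roots together
  (\<open>c_plane_A0\<close>). They generate a central subgroup \<open>A0\<close>, with one generator for each pair of basis
  shifts. What is not controlled by commutators and pairs is the value of a lift at a sum of at least
  three basis shifts in a direction where the semilattice need not be a lattice: each such sum, that
  is, each member of the family of supports, contributes one further central element \<open>z\<close>. Reflecting
  in \<open>\<gamma>\<close> inverts lifts and fixes central elements, which forces the square of \<open>z\<close> into \<open>A0\<close>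
  (\<open>z_square\<close>). Let \<open>A\<close> be generated by \<open>A0\<close> and the elements \<open>z\<close>.

  Every element is a product of an element of \<open>A\<close>, powers of lifts at simple roots and basis shifts,
  and a word in the simple reflections (\<open>normal_form\<close>). For an element of the kernel the word acts
  trivially on the finite roots, and the conjugation relations perform the deletion of letters that
  collapses it (\<open>wd_trivial\<close>); then the powers vanish by linear independence (\<open>kernel_A\<close>). So the
  kernel lies in \<open>A\<close>. On the other hand \<open>A0\<close> acts faithfully, since its generators act through
  nonzero multiples of independent bivectors (\<open>A0_faithful\<close>). Hence the kernel embeds into the
  quotient of \<open>A\<close> by \<open>A0\<close>, an elementary abelian 2-group with one generator for each support.
\<close>

section \<open>Central commutators and elementary abelian 2-groups\<close>

context group
begin

lemma inv_mult_cancel [simp]: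
  "x \<in> carrier G \<Longrightarrow> y \<in> carrier G \<Longrightarrow> inv x \<otimes> (x \<otimes> y) = y"
  "x \<in> carrier G \<Longrightarrow> y \<in> carrier G \<Longrightarrow> x \<otimes> (inv x \<otimes> y) = y"
  by (simp_all add: m_assoc[symmetric])

definition cmt :: "'a \<Rightarrow> 'a \<Rightarrow> 'a" where
  "cmt x y = x \<otimes> y \<otimes> inv x \<otimes> inv y"

definition center :: "'a set" where
  "center = {z \<in> carrier G. \<forall>x\<in>carrier G. z \<otimes> x = x \<otimes> z}"

lemma center_carrier: "z \<in> center \<Longrightarrow> z \<in> carrier G"
  by (simp add: center_def)

lemma center_comm: "z \<in> center \<Longrightarrow> x \<in> carrier G \<Longrightarrow> z \<otimes> x = x \<otimes> z"
  by (simp add: center_def)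

lemma center_left_comm:
  "z \<in> center \<Longrightarrow> x \<in> carrier G \<Longrightarrow> y \<in> carrier G \<Longrightarrow> x \<otimes> (z \<otimes> y) = z \<otimes> (x \<otimes> y)"
  using center_comm[of z x] by (simp add: m_assoc[symmetric] center_carrier)

lemma center_conj: "z \<in> center \<Longrightarrow> x \<in> carrier G \<Longrightarrow> x \<otimes> z \<otimes> inv x = z"
  by (simp add: center_carrier m_assoc center_left_comm[of z x "inv x"])

lemma subgroup_center: "subgroup center G"
proof (rule subgroupI)
  have "\<one> \<in> center" by (simp add: center_def)
  then show "center \<noteq> {}" by blast
next
  fix a assume a: "a \<in> center"
  have "inv a \<otimes> x = x \<otimes> inv a" if "x \<in> carrier G" for x
  proof -
    have "inv a \<otimes> x = inv a \<otimes> (x \<otimes> a) \<otimes> inv a"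
      using that a by (simp add: center_carrier m_assoc)
    also have "x \<otimes> a = a \<otimes> x" using center_comm[OF a that] by simp
    finally show ?thesis using that a by (simp add: center_carrier)
  qed
  then show "inv a \<in> center" using a by (simp add: center_def)
next
  fix a b assume ab: "a \<in> center" "b \<in> center"
  then have c: "a \<in> carrier G" "b \<in> carrier G" by (auto simp: center_carrier)
  have "a \<otimes> b \<otimes> x = x \<otimes> (a \<otimes> b)" if x: "x \<in> carrier G" for x
    using c x center_comm[OF ab(2) x] center_left_comm[OF ab(1) x c(2)] by (simp add: m_assoc)
  then show "a \<otimes> b \<in> center" using c by (simp add: center_def)
qed (auto simp: center_def)

lemma cmt_closed [simp]: "x \<in> carrier G \<Longrightarrow> y \<in> carrier G \<Longrightarrow> cmt x y \<in> carrier G"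
  by (simp add: cmt_def)

lemma cmt_swap: "x \<in> carrier G \<Longrightarrow> y \<in> carrier G \<Longrightarrow> cmt y x = inv (cmt x y)"
  by (simp add: cmt_def inv_mult_group m_assoc)

lemma cmt_commute:
  "x \<in> carrier G \<Longrightarrow> y \<in> carrier G \<Longrightarrow> x \<otimes> y = cmt x y \<otimes> (y \<otimes> x)"
  by (simp add: cmt_def m_assoc)

lemma cmt_mult_left:
  assumes "cmt x' y \<in> center" "x \<in> carrier G" "x' \<in> carrier G" "y \<in> carrier G"
  shows "cmt (x \<otimes> x') y = cmt x' y \<otimes> cmt x y"
proof -
  have "cmt (x \<otimes> x') y = x \<otimes> cmt x' y \<otimes> inv x \<otimes> cmt x y"
    using assms(2-4) by (simp add: cmt_def inv_mult_group m_assoc)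
  then show ?thesis using center_conj[OF assms(1,2)] by simp
qed

lemma cmt_inv_left:
  assumes "cmt x y \<in> center" "x \<in> carrier G" "y \<in> carrier G"
  shows "cmt (inv x) y = inv (cmt x y)"
proof -
  have "cmt (inv x) y = inv x \<otimes> inv (cmt x y) \<otimes> inv (inv x)"
    using assms(2-3) by (simp add: cmt_def inv_mult_group m_assoc)
  moreover have "inv (cmt x y) \<in> center"
    using assms(1) subgroup_center by (simp add: subgroup.m_inv_closed)
  ultimately show ?thesis using center_conj[of "inv (cmt x y)" "inv x"] assms(2) by simp
qed

lemma cmt_int_pow_left:
  assumes "cmt x y \<in> center" "x \<in> carrier G" "y \<in> carrier G"
  shows "cmt (x [^] (n::int)) y = cmt x y [^] n"
proof -
  have nat: "cmt (x [^] (m::nat)) y = cmt x y [^] m" for m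
  proof (induction m)
    case 0 then show ?case using assms by (simp add: cmt_def)
  next
    case (Suc m)
    have "cmt (x [^] Suc m) y = cmt x y \<otimes> cmt (x [^] m) y"
      using assms by (simp add: cmt_mult_left)
    then show ?case using Suc assms center_comm[OF assms(1), of "cmt x y [^] m"] by simp
  qed
  show ?thesis
  proof (cases "n \<ge> 0")
    case True
    then show ?thesis using nat[of "nat n"] by (metis int_nat_eq int_pow_int)
  next
    case False
    have cc: "cmt x y [^] (nat (-n)) \<in> center"
      using subgroup_int_pow_closed[OF subgroup_center assms(1), of "int (nat (-n))"] by (simp only: int_pow_int)
    have n: "n = - int (nat (-n))" using False by simp
    have "cmt (x [^] n) y = cmt (inv (x [^] nat (-n))) y"
      using assms by (subst n) (simp add: int_pow_neg int_pow_int)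
    also have "\<dots> = inv (cmt x y [^] nat (-n))"
      using cmt_inv_left[of "x [^] nat (-n)" y] cc assms nat by simp
    also have "\<dots> = cmt x y [^] n"
      using assms by (subst (2) n) (simp add: int_pow_neg int_pow_int)
    finally show ?thesis .
  qed
qed

lemma cmt_inv_right:
  assumes "cmt x y \<in> center" "x \<in> carrier G" "y \<in> carrier G"
  shows "cmt x (inv y) = inv (cmt x y)"
proof -
  have "cmt y x \<in> center"
    using assms subgroup_center by (simp add: cmt_swap[of x y] subgroup.m_inv_closed)
  then show ?thesis
    using cmt_inv_left[of y x] cmt_swap[of x y] cmt_swap[of "inv y" x] assms by simp
qed

lemma cmt_int_pow_right:
  assumes "cmt x y \<in> center" "x \<in> carrier G" "y \<in> carrier G"
  shows "cmt x (y [^] (n::int)) = cmt x y [^] n"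
proof -
  have "cmt y x \<in> center"
    using assms subgroup_center by (simp add: cmt_swap[of x y] subgroup.m_inv_closed)
  then have "cmt (y [^] n) x = cmt y x [^] n" using assms cmt_int_pow_left by blast
  then show ?thesis
    using cmt_swap[of "y [^] n" x] cmt_swap[of x y] assms
    by (simp add: int_pow_inv)
qed

text \<open>
  Because the commutator map is multiplicative as long as its values are central, commutators
  of generated elements are controlled by those of generators.
\<close>

lemma cmt_generate:
  assumes A: "subgroup A G" "A \<subseteq> center" and X: "X \<subseteq> carrier G" and Y: "Y \<subseteq> carrier G"
    and c: "\<And>x y. x \<in> X \<Longrightarrow> y \<in> Y \<Longrightarrow> cmt x y \<in> A"
    and x: "x \<in> generate G X" and y: "y \<in> generate G Y"
  shows "cmt x y \<in> A"
proof -
  have left: "cmt x y \<in> A" if X': "X' \<subseteq> carrier G" and yc: "y \<in> carrier G"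
    and c': "\<And>x. x \<in> X' \<Longrightarrow> cmt x y \<in> A" and x: "x \<in> generate G X'" for X' x y
    using x
  proof (induction)
    case one
    then show ?case using yc A(1) by (simp add: cmt_def subgroup.one_closed)
  next
    case (incl h) then show ?case by (rule c')
  next
    case (inv h)
    then show ?case
      using c'[OF inv] A X' yc cmt_inv_left[of h y] by (simp add: subgroup.m_inv_closed subset_iff)
  next
    case (eng h1 h2)
    then show ?case
      using A yc cmt_mult_left[of h2 y h1] generate_in_carrier[OF X']
      by (simp add: subgroup.m_closed subset_iff)
  qed
  have inv: "cmt b a \<in> A" if "cmt a b \<in> A" "a \<in> carrier G" "b \<in> carrier G" for a b
    using that A(1) by (simp add: cmt_swap[of a b] subgroup.m_inv_closed)
  have xc: "x \<in> carrier G" "y \<in> carrier G" using generate_in_carrier X Y x y by auto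
  have "cmt y' x \<in> A" if "y' \<in> Y" for y'
    using left[OF X _ c x, of y'] that Y inv xc by auto
  from left[OF Y xc(1) this y] show ?thesis using inv xc by blast
qed

lemma generate_conj:
  assumes H: "subgroup H G" and y: "y \<in> carrier G" and X: "X \<subseteq> carrier G"
    and h: "\<And>h. h \<in> X \<Longrightarrow> y \<otimes> (h \<otimes> inv y) \<in> H" and x: "x \<in> generate G X"
  shows "y \<otimes> (x \<otimes> inv y) \<in> H"
  using x
proof induction
  case one
  then show ?case using y subgroup.one_closed[OF H] by simp
next
  case (incl a) then show ?case by (rule h)
next
  case (inv a)
  then have "a \<in> carrier G" using X by blast
  then have "y \<otimes> (inv a \<otimes> inv y) = inv (y \<otimes> (a \<otimes> inv y))"
    using y by (simp add: inv_mult_group m_assoc)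
  then show ?case using subgroup.m_inv_closed[OF H h[OF inv]] by simp
next
  case (eng a a')
  then have "a \<in> carrier G" "a' \<in> carrier G" using generate_in_carrier[OF X] by blast+
  then have "y \<otimes> (a \<otimes> a' \<otimes> inv y) = (y \<otimes> (a \<otimes> inv y)) \<otimes> (y \<otimes> (a' \<otimes> inv y))"
    using y by (simp add: m_assoc)
  then show ?case using subgroup.m_closed[OF H eng.IH] by simp
qed

text \<open>
  The factors need not commute, so the product runs over a list in a fixed order.
\<close>

primrec lprod :: "('i \<Rightarrow> 'a) \<Rightarrow> 'i list \<Rightarrow> ('i \<Rightarrow> int) \<Rightarrow> 'a" where
  "lprod f [] n = \<one>"
| "lprod f (p # ps) n = f p [^] n p \<otimes> lprod f ps n"

lemma lprod_closed [simp]: "f ` set ps \<subseteq> carrier G \<Longrightarrow> lprod f ps n \<in> carrier G"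
  by (induction ps) auto

lemma lprod_cong: "(\<And>p. p \<in> set ps \<Longrightarrow> n p = m p) \<Longrightarrow> lprod f ps n = lprod f ps m"
  by (induction ps) auto

lemma lprod_zero: "lprod f ps (\<lambda>_. 0) = \<one>"
  by (induction ps) (auto)

lemma lprod_in_subgroup: "subgroup H G \<Longrightarrow> f ` set ps \<subseteq> H \<Longrightarrow> lprod f ps n \<in> H"
  by (induction ps) (auto simp: subgroup.one_closed subgroup.m_closed subgroup_int_pow_closed)

lemma lprod_insert_pow:
  assumes A: "subgroup A G" "A \<subseteq> center" and f: "f ` set ps \<subseteq> carrier G"
    and c: "\<And>p q. p \<in> set ps \<Longrightarrow> q \<in> set ps \<Longrightarrow> cmt (f p) (f q) \<in> A"
    and d: "distinct ps" "q \<in> set ps"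
  shows "\<exists>a\<in>A. f q [^] (e::int) \<otimes> lprod f ps n = a \<otimes> lprod f ps (n(q := e + n q))"
  using f c d
proof (induction ps)
  case Nil then show ?case by simp
next
  case (Cons p ps)
  have fp: "f p \<in> carrier G" and fps: "f ` set ps \<subseteq> carrier G" and fq: "f q \<in> carrier G"
    using Cons.prems by auto
  show ?case
  proof (cases "q = p")
    case True
    have "lprod f ps n = lprod f ps (n(p := e + n p))"
      using Cons.prems by (intro lprod_cong) auto
    then have "f q [^] e \<otimes> lprod f (p # ps) n = lprod f (p # ps) (n(q := e + n q))"
      using True fp fps by (simp add: int_pow_mult m_assoc)
    then show ?thesis
      using subgroup.one_closed[OF A(1)] Cons.prems(1) lprod_closed[of f "p # ps"] by (metis l_one)
  next
    case False
    have "\<exists>a\<in>A. f q [^] e \<otimes> lprod f ps n = a \<otimes> lprod f ps (n(q := e + n q))"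
      by (rule Cons.IH) (use Cons.prems False in auto)
    then obtain a where a: "a \<in> A" "f q [^] e \<otimes> lprod f ps n = a \<otimes> lprod f ps (n(q := e + n q))"
      by blast
    define k where "k = cmt (f q [^] e) (f p [^] n p)"
    have ck: "cmt (f q) (f p) \<in> A" using Cons.prems by auto
    have e1: "cmt (f q) (f p [^] n p) = cmt (f q) (f p) [^] n p"
      by (rule cmt_int_pow_right) (use ck A fp fq in auto)
    have e2: "cmt (f q) (f p [^] n p) \<in> A"
      unfolding e1 by (rule subgroup_int_pow_closed[OF A(1) ck])
    have "k = cmt (f q) (f p [^] n p) [^] e"
      unfolding k_def by (rule cmt_int_pow_left) (use e2 A fp fq in auto)
    then have k: "k \<in> A" using e2 A(1) by (simp add: subgroup_int_pow_closed)
    have kc: "k \<in> carrier G" "a \<in> carrier G" using fp fq a A by (auto simp: k_def center_def)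
    have "f q [^] e \<otimes> lprod f (p # ps) n = (f q [^] e \<otimes> f p [^] n p) \<otimes> lprod f ps n"
      using fp fq fps by (simp add: m_assoc)
    also have "\<dots> = k \<otimes> (f p [^] n p \<otimes> (f q [^] e \<otimes> lprod f ps n))"
      using fp fq fps cmt_commute[of "f q [^] e" "f p [^] n p"] kc by (simp add: k_def m_assoc)
    also have "\<dots> = k \<otimes> (f p [^] n p \<otimes> (a \<otimes> lprod f ps (n(q := e + n q))))"
      by (simp only: a)
    also have "\<dots> = k \<otimes> (a \<otimes> (f p [^] n p \<otimes> lprod f ps (n(q := e + n q))))"
      using center_left_comm[of a] a(1) A(2) fp fps by (simp add: subset_iff)
    also have "\<dots> = (k \<otimes> a) \<otimes> lprod f (p # ps) (n(q := e + n q))"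
      using False kc fp fps by (simp add: m_assoc)
    finally show ?thesis using subgroup.m_closed[OF A(1) k a(1)] by blast
  qed
qed

text \<open>Collection: modulo a central subgroup containing all commutators the order is immaterial.\<close>

lemma generate_collect:
  assumes A: "subgroup A G" "A \<subseteq> center" and f: "f ` set ps \<subseteq> carrier G"
    and c: "\<And>p q. p \<in> set ps \<Longrightarrow> q \<in> set ps \<Longrightarrow> cmt (f p) (f q) \<in> A"
    and d: "distinct ps" and x: "x \<in> generate G (A \<union> f ` set ps)"
  shows "\<exists>a\<in>A. \<exists>n. x = a \<otimes> lprod f ps n"
proof -
  define M where "M = {a \<otimes> lprod f ps n | a n. a \<in> A}"
  have Ac: "A \<subseteq> carrier G" using A(1) by (rule subgroup.subset)
  have mA: "a \<otimes> y \<in> M" if am: "a \<in> A" "y \<in> M" for a y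
  proof -
    obtain a' n where y: "a' \<in> A" "y = a' \<otimes> lprod f ps n"
      using am(2) unfolding M_def by blast
    have "a \<in> carrier G" "a' \<in> carrier G" using am(1) y(1) Ac by auto
    then have "a \<otimes> y = (a \<otimes> a') \<otimes> lprod f ps n" using f by (simp add: y(2) m_assoc)
    then show ?thesis using subgroup.m_closed[OF A(1) am(1) y(1)] unfolding M_def by blast
  qed
  have mf: "f q [^] (e::int) \<otimes> y \<in> M" if q: "q \<in> set ps" and y: "y \<in> M" for q y e
  proof -
    obtain a n where a: "a \<in> A" "y = a \<otimes> lprod f ps n" using y unfolding M_def by blast
    obtain a' where a': "a' \<in> A" "f q [^] e \<otimes> lprod f ps n = a' \<otimes> lprod f ps (n(q := e + n q))"
      using lprod_insert_pow[OF A f c d q] by blast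
    have "f q [^] e \<otimes> y = a \<otimes> (f q [^] e \<otimes> lprod f ps n)"
      unfolding a(2) by (rule center_left_comm) (use a(1) A(2) f q in auto)
    also have "\<dots> \<in> M"
      by (rule mA[OF a(1)]) (unfold a'(2) M_def, use a'(1) in blast)
    finally show ?thesis .
  qed
  have "\<forall>y\<in>M. x \<otimes> y \<in> M"
    using x
  proof induction
    case one
    then show ?case using mA[OF subgroup.one_closed[OF A(1)]] by blast
  next
    case (incl h)
    then show ?case
    proof
      assume "h \<in> f ` set ps"
      then obtain q where "q \<in> set ps" "h = f q" by blast
      then show ?thesis using mf[of q _ 1] f by auto
    qed (use mA in blast)
  next
    case (inv h)
    then show ?case
    proof
      assume "h \<in> f ` set ps"
      then obtain q where "q \<in> set ps" "h = f q" by blast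
      then show ?thesis using mf[of q _ "-1"] f by (auto simp: int_pow_neg)
    qed (use mA subgroup.m_inv_closed[OF A(1)] in blast)
  next
    case (eng h1 h2)
    have h: "h1 \<in> carrier G" "h2 \<in> carrier G"
      using generate_in_carrier[of "A \<union> f ` set ps"] eng.hyps Ac f by auto
    have "M \<subseteq> carrier G" using Ac f by (auto simp: M_def)
    then show ?case using eng.IH h m_assoc by (metis subsetD)
  qed
  moreover have "\<one> \<in> M"
    unfolding M_def using subgroup.one_closed[OF A(1)] lprod_zero[of f ps] l_one[OF one_closed]
    by (metis (mono_tags, lifting) mem_Collect_eq)
  moreover have "x \<in> carrier G"
    using generate_in_carrier[of "A \<union> f ` set ps"] x Ac f by auto
  ultimately have "x \<in> M" using r_one[of x] by metis
  then show ?thesis unfolding M_def by blast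
qed

text \<open>Even powers of the factors are absorbed by \<open>A\<close>, which leaves one bit for each factor.\<close>

lemma lprod_mod_2:
  assumes A: "subgroup A G" "A \<subseteq> center" and z: "z ` set ps \<subseteq> center"
    and sq: "\<And>p. p \<in> set ps \<Longrightarrow> z p \<otimes> z p \<in> A"
  shows "\<exists>a\<in>A. lprod z ps n = a \<otimes> lprod z ps (\<lambda>p. n p mod 2)"
  using z sq
proof (induction ps)
  case Nil
  then show ?case using subgroup.one_closed[OF A(1)] by force
next
  case (Cons p ps)
  then obtain a where a: "a \<in> A" "lprod z ps n = a \<otimes> lprod z ps (\<lambda>p. n p mod 2)" by auto
  have zc: "z p \<in> carrier G" "z ` set ps \<subseteq> carrier G" "a \<in> carrier G"
    using Cons.prems a A(2) center_carrier by auto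
  define c where "c = (z p \<otimes> z p) [^] (n p div 2)"
  have c: "c \<in> A" unfolding c_def using Cons.prems A(1) by (simp add: subgroup_int_pow_closed)
  then have cc: "c \<in> carrier G" using A(2) center_carrier by auto
  have sq2: "z p \<otimes> z p = z p [^] (2::int)"
    using zc int_pow_mult[of "z p" 1 1] by simp
  have c_eq: "c = z p [^] (2 * (n p div 2))"
    unfolding c_def sq2 by (rule int_pow_pow[OF zc(1)])
  have "z p [^] n p = z p [^] (2 * (n p div 2) + n p mod 2)" by simp
  also have "\<dots> = c \<otimes> z p [^] (n p mod 2)"
    unfolding c_eq by (rule int_pow_mult[OF zc(1)])
  finally have "z p [^] n p = c \<otimes> z p [^] (n p mod 2)" .
  then have "lprod z (p # ps) n = c \<otimes> (z p [^] (n p mod 2) \<otimes> (a \<otimes> lprod z ps (\<lambda>p. n p mod 2)))"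
    using zc cc a by (simp add: m_assoc)
  also have "\<dots> = (c \<otimes> a) \<otimes> lprod z (p # ps) (\<lambda>p. n p mod 2)"
    using zc cc a A(2) center_left_comm[of a] by (auto simp: m_assoc)
  finally show ?case using subgroup.m_closed[OF A(1) c a(1)] by blast
qed

text \<open>
  A subgroup meeting \<open>A\<close> trivially embeds into the quotient by \<open>A\<close>, and modulo \<open>A\<close> an
  element is a product of the commuting involutions \<open>z p\<close> over a subset of \<open>ps\<close>.
\<close>

lemma elementary_bound:
  assumes A: "subgroup A G" "A \<subseteq> center" and z: "z ` set ps \<subseteq> center"
    and sq: "\<And>p. p \<in> set ps \<Longrightarrow> z p \<otimes> z p \<in> A" and d: "distinct ps"
    and K: "subgroup K G" "K \<subseteq> generate G (A \<union> z ` set ps)" "K \<inter> A = {\<one>}"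
  shows "finite K" "card K \<le> 2 ^ length ps" "\<And>x. x \<in> K \<Longrightarrow> x \<otimes> x = \<one>"
proof -
  have zc: "z ` set ps \<subseteq> carrier G" using z center_carrier by auto
  have com: "cmt x y \<in> A" if "x \<in> center" "y \<in> center" for x y
  proof -
    have "cmt x y = \<one>" using that center_comm[of x y] by (simp add: cmt_def center_carrier m_assoc)
    then show ?thesis using subgroup.one_closed[OF A(1)] by simp
  qed
  define L where "L T = lprod z ps (\<lambda>p. if p \<in> T then 1 else 0)" for T
  have Lz: "L T \<in> center" for T
    unfolding L_def by (rule lprod_in_subgroup[OF subgroup_center z])
  have norm: "\<exists>T. T \<subseteq> set ps \<and> (\<exists>a\<in>A. x = a \<otimes> L T)" if x: "x \<in> K" for x
  proof -
    obtain a n where a: "a \<in> A" "x = a \<otimes> lprod z ps n"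
      using generate_collect[OF A zc com d] x K(2) z by blast
    obtain a' where a': "a' \<in> A" "lprod z ps n = a' \<otimes> lprod z ps (\<lambda>p. n p mod 2)"
      using lprod_mod_2[OF A z sq] by blast
    have "lprod z ps (\<lambda>p. n p mod 2) = L {p \<in> set ps. odd (n p)}"
      unfolding L_def by (rule lprod_cong) (simp add: mod_2_eq_odd)
    moreover have "a \<in> carrier G" "a' \<in> carrier G" using a(1) a'(1) A(2) center_carrier by auto
    ultimately have "x = (a \<otimes> a') \<otimes> L {p \<in> set ps. odd (n p)}"
      unfolding a(2) a'(2) using Lz center_carrier by (simp add: m_assoc)
    moreover have "{p \<in> set ps. odd (n p)} \<subseteq> set ps" by blast
    ultimately show ?thesis using subgroup.m_closed[OF A(1) a(1) a'(1)] by blast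
  qed
  define S where "S x = (SOME T. T \<subseteq> set ps \<and> (\<exists>a\<in>A. x = a \<otimes> L T))" for x
  have S: "S x \<subseteq> set ps \<and> (\<exists>a\<in>A. x = a \<otimes> L (S x))" if "x \<in> K" for x
    unfolding S_def using norm[OF that] by (rule someI_ex)
  have inj: "inj_on S K"
  proof (rule inj_onI)
    fix x y assume xy: "x \<in> K" "y \<in> K" "S x = S y"
    obtain a where a: "a \<in> A" "x = a \<otimes> L (S x)" using S[OF xy(1)] by blast
    obtain a' where a': "a' \<in> A" "y = a' \<otimes> L (S x)" using S[OF xy(2)] xy(3) by auto
    define l where "l = L (S x)"
    have c: "a \<in> carrier G" "a' \<in> carrier G" "l \<in> carrier G"
      using a(1) a'(1) A(2) Lz center_carrier by (auto simp: l_def)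
    have e: "x = a \<otimes> l" "y = a' \<otimes> l" using a(2) a'(2) by (simp_all only: l_def)
    have "x \<otimes> inv y = a \<otimes> inv a'"
      unfolding e using c by (simp add: inv_mult_group m_assoc)
    moreover have "x \<otimes> inv y \<in> K"
      using xy K(1) by (simp add: subgroup.m_closed subgroup.m_inv_closed)
    moreover have "a \<otimes> inv a' \<in> A"
      using a(1) a'(1) A(1) by (simp add: subgroup.m_closed subgroup.m_inv_closed)
    ultimately have "a \<otimes> inv a' = \<one>" using K(3) by auto
    then have "a = a'" using c inv_equality[of a "inv a'"] by simp
    then show "x = y" by (simp add: e)
  qed
  have sub: "S ` K \<subseteq> Pow (set ps)" using S by blast
  show "finite K" using inj_on_finite[OF inj sub] by simp
  have "card K \<le> card (Pow (set ps))" by (rule card_inj_on_le[OF inj sub]) simp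
  then show "card K \<le> 2 ^ length ps" using d by (simp add: card_Pow distinct_card)
  have LL: "L T \<otimes> L T \<in> A" for T
    unfolding L_def using z sq
  proof (induction ps)
    case Nil then show ?case using subgroup.one_closed[OF A(1)] by simp
  next
    case (Cons p ps)
    define m l where "m = z p [^] (if p \<in> T then 1 else 0 :: int)"
      and "l = lprod z ps (\<lambda>p. if p \<in> T then 1 else 0)"
    have zp: "z p \<in> center" "z p \<otimes> z p \<in> A" using Cons.prems by auto
    have "m \<in> center" unfolding m_def by (rule subgroup_int_pow_closed[OF subgroup_center zp(1)])
    moreover have "l \<in> center"
      unfolding l_def by (rule lprod_in_subgroup[OF subgroup_center]) (use Cons.prems in auto)
    ultimately have "m \<otimes> l \<otimes> (m \<otimes> l) = (m \<otimes> m) \<otimes> (l \<otimes> l)"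
      using center_left_comm[of m l l] center_carrier by (simp add: m_assoc)
    moreover have "m \<otimes> m \<in> A"
      using zp center_carrier subgroup.one_closed[OF A(1)] by (auto simp: m_def)
    moreover have "l \<otimes> l \<in> A" unfolding l_def using Cons by auto
    ultimately show ?case
      using subgroup.m_closed[OF A(1)] unfolding lprod.simps m_def[symmetric] l_def[symmetric] by simp
  qed
  fix x assume x: "x \<in> K"
  obtain a where a: "a \<in> A" "x = a \<otimes> L (S x)" using S[OF x] by blast
  define l where "l = L (S x)"
  have e: "x = a \<otimes> l" using a(2) by (simp only: l_def)
  have c: "a \<in> center" "a \<in> carrier G" "l \<in> carrier G"
    using a(1) A(2) Lz center_carrier by (auto simp: l_def)
  have "x \<otimes> x = (a \<otimes> a) \<otimes> (l \<otimes> l)"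
    unfolding e using c center_left_comm[of a l l] by (simp add: m_assoc)
  moreover have "l \<otimes> l \<in> A" unfolding l_def by (rule LL)
  ultimately have "x \<otimes> x \<in> A" using a(1) A(1) by (simp add: subgroup.m_closed)
  then have "x \<otimes> x \<in> K \<inter> A" using x K(1) by (simp add: subgroup.m_closed)
  then show "x \<otimes> x = \<one>" using K(3) by blast
qed

abbreviation Z2_power :: "nat \<Rightarrow> (nat \<Rightarrow> int) monoid" where
  "Z2_power n \<equiv> sum_group {..<n} (\<lambda>_. integer_mod_group 2)"

lemma carrier_Z2_power: "carrier (Z2_power n) = {..<n} \<rightarrow>\<^sub>E {0, 1}"
proof -
  have "{0..<2::int} = {0, 1}" by auto
  then show ?thesis by (auto simp: carrier_sum_group carrier_integer_mod_group PiE_iff extensional_def)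
qed

text \<open>
  An involution \<open>x\<close> of \<open>K\<close> outside the image of \<open>f\<close> can serve as one more coordinate vector.
\<close>

lemma elementary_extend:
  assumes K: "subgroup K G" "\<And>x. x \<in> K \<Longrightarrow> x \<otimes> x = \<one>"
    and f: "f \<in> carrier (Z2_power n) \<rightarrow> K" "inj_on f (carrier (Z2_power n))"
      "\<And>u v. u \<in> carrier (Z2_power n) \<Longrightarrow> v \<in> carrier (Z2_power n) \<Longrightarrow>
        f (u \<otimes>\<^bsub>Z2_power n\<^esub> v) = f u \<otimes> f v"
    and x: "x \<in> K" "x \<notin> f ` carrier (Z2_power n)"
  shows "\<exists>g. g \<in> carrier (Z2_power (Suc n)) \<rightarrow> K \<and> inj_on g (carrier (Z2_power (Suc n))) \<and>
    (\<forall>u\<in>carrier (Z2_power (Suc n)). \<forall>v\<in>carrier (Z2_power (Suc n)).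
        g (u \<otimes>\<^bsub>Z2_power (Suc n)\<^esub> v) = g u \<otimes> g v)"
proof -
  have Kc: "y \<in> carrier G" if "y \<in> K" for y using subgroup.mem_carrier[OF K(1) that] .
  have inv: "inv y = y" if "y \<in> K" for y using that K(2) Kc inv_equality by blast
  have comm: "y \<otimes> z = z \<otimes> y" if "y \<in> K" "z \<in> K" for y z
    using inv[OF subgroup.m_closed[OF K(1) that]] inv[OF that(1)] inv[OF that(2)] that Kc
    by (simp add: inv_mult_group)
  have lcomm: "y \<otimes> (z \<otimes> w) = z \<otimes> (y \<otimes> w)" if "y \<in> K" "z \<in> K" "w \<in> K" for y z w
    using that comm[of y z] Kc by (simp add: m_assoc[symmetric])
  let ?r = "\<lambda>u. restrict u {..<n}"
  define g where "g u = f (?r u) \<otimes> (if u n = (1::int) then x else \<one>)" for u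
  have r: "?r u \<in> carrier (Z2_power n)" if "u \<in> carrier (Z2_power (Suc n))" for u
    using that by (auto simp: carrier_Z2_power PiE_iff)
  have un: "u n = 0 \<or> u n = 1" if "u \<in> carrier (Z2_power (Suc n))" for u
    using that by (auto simp: carrier_Z2_power PiE_iff)
  have fK: "f (?r u) \<in> K" if "u \<in> carrier (Z2_power (Suc n))" for u
    using f(1) r[OF that] by blast
  have hom: "g (u \<otimes>\<^bsub>Z2_power (Suc n)\<^esub> v) = g u \<otimes> g v"
    if u: "u \<in> carrier (Z2_power (Suc n))" and v: "v \<in> carrier (Z2_power (Suc n))" for u v
  proof -
    have "?r (u \<otimes>\<^bsub>Z2_power (Suc n)\<^esub> v) = ?r u \<otimes>\<^bsub>Z2_power n\<^esub> ?r v"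
      by (auto simp: fun_eq_iff)
    then have e: "f (?r (u \<otimes>\<^bsub>Z2_power (Suc n)\<^esub> v)) = f (?r u) \<otimes> f (?r v)"
      using f(3) r u v by metis
    have n: "(u \<otimes>\<^bsub>Z2_power (Suc n)\<^esub> v) n = (u n + v n) mod 2" by simp
    show ?thesis
      unfolding g_def e n
      using un[OF u] un[OF v] fK[OF u] fK[OF v] x(1) Kc K(2)[OF x(1)]
        lcomm[of x "f (?r v)" x] comm[of x "f (?r v)"]
      by (auto simp: m_assoc)
  qed
  have "g \<in> carrier (Z2_power (Suc n)) \<rightarrow> K"
    using fK x(1) K(1) by (auto simp: g_def subgroup.m_closed subgroup.one_closed)
  moreover have "inj_on g (carrier (Z2_power (Suc n)))"
  proof (rule inj_onI)
    fix u v assume u: "u \<in> carrier (Z2_power (Suc n))" and v: "v \<in> carrier (Z2_power (Suc n))"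
      and eq: "g u = g v"
    have no: "f (?r a) \<otimes> x \<noteq> f (?r b)"
      if "a \<in> carrier (Z2_power (Suc n))" "b \<in> carrier (Z2_power (Suc n))" for a b
    proof
      assume e: "f (?r a) \<otimes> x = f (?r b)"
      have "x = f (?r a) \<otimes> (f (?r a) \<otimes> x)"
        using fK[OF that(1)] x(1) Kc K(2) by (simp add: m_assoc[symmetric])
      also have "\<dots> = f (?r a \<otimes>\<^bsub>Z2_power n\<^esub> ?r b)" unfolding e using f(3) r that by metis
      finally show False
        using x(2) r[OF that(1)] r[OF that(2)]
        by (metis group.is_monoid group_integer_mod_group imageI monoid.m_closed sum_group)
    qed
    have same: "u n = v n"
      using un[OF u] un[OF v] no[OF u v] no[OF v u] eq fK[OF u] fK[OF v] Kc by (auto simp: g_def)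
    then have "f (?r u) = f (?r v)"
      using eq fK[OF u] fK[OF v] Kc x(1) by (auto simp: g_def split: if_splits)
    then have "?r u = ?r v" using f(2) r[OF u] r[OF v] by (meson inj_onD)
    show "u = v"
    proof (rule PiE_ext[of _ "{..<Suc n}" "\<lambda>_. {0, 1}" _ ])
      show "u \<in> {..<Suc n} \<rightarrow>\<^sub>E {0, 1}" using u carrier_Z2_power by blast
      show "v \<in> {..<Suc n} \<rightarrow>\<^sub>E {0, 1}" using v carrier_Z2_power by blast
      fix i assume "i \<in> {..<Suc n}"
      then show "u i = v i" using fun_cong[OF \<open>?r u = ?r v\<close>, of i] same
        by (cases "i = n") auto
    qed
  qed
  ultimately show ?thesis using hom by blast
qed

text \<open>A largest embedded power of the group of order two is everything: otherwise it extends.\<close>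

lemma elementary_iso:
  assumes K: "subgroup K G" "finite K" "card K \<le> 2 ^ m" "\<And>x. x \<in> K \<Longrightarrow> x \<otimes> x = \<one>"
  shows "\<exists>n\<le>m. G\<lparr>carrier := K\<rparr> \<cong> Z2_power n"
proof -
  define P where "P n f \<longleftrightarrow> f \<in> carrier (Z2_power n) \<rightarrow> K \<and> inj_on f (carrier (Z2_power n)) \<and>
    (\<forall>u\<in>carrier (Z2_power n). \<forall>v\<in>carrier (Z2_power n).
        f (u \<otimes>\<^bsub>Z2_power n\<^esub> v) = f u \<otimes> f v)" for n f
  have card: "card (carrier (Z2_power n)) = 2 ^ n" for n
    by (simp add: carrier_Z2_power card_PiE) (simp add: numeral_2_eq_2)
  have le: "2 ^ n \<le> card K" if "P n f" for n f
    using that card_inj_on_le[of f "carrier (Z2_power n)" K] K(2) by (auto simp: P_def card)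
  have bound: "n \<le> m" if "P n f" for n f
    using power_le_imp_le_exp[of "2::nat" n m] order_trans[OF le[OF that] K(3)] by simp
  have "carrier (Z2_power 0) = {\<lambda>_. undefined}"
    unfolding carrier_Z2_power by simp
  then have "P 0 (\<lambda>_. \<one>)"
    using subgroup.one_closed[OF K(1)] unfolding P_def by simp
  then obtain n f where n: "P n f" and max: "\<And>g. \<not> P (Suc n) g"
  proof -
    assume *: "\<And>n f. P n f \<Longrightarrow> (\<And>g. \<not> P (Suc n) g) \<Longrightarrow> thesis"
    define n where "n = (GREATEST n. \<exists>f. P n f)"
    have "\<exists>f. P n f"
      unfolding n_def by (rule GreatestI_nat[of _ 0 m]) (use \<open>P 0 (\<lambda>_. \<one>)\<close> bound in blast)+
    moreover have "\<not> P (Suc n) g" for g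
      using Greatest_le_nat[of "\<lambda>n. \<exists>f. P n f" "Suc n" m] bound unfolding n_def[symmetric] by auto
    ultimately show thesis using * by blast
  qed
  have surj: "f ` carrier (Z2_power n) = K"
  proof
    show "f ` carrier (Z2_power n) \<subseteq> K" using n by (auto simp: P_def)
    show "K \<subseteq> f ` carrier (Z2_power n)"
    proof
      fix x assume "x \<in> K"
      show "x \<in> f ` carrier (Z2_power n)"
      proof (rule ccontr)
        assume "x \<notin> f ` carrier (Z2_power n)"
        with n \<open>x \<in> K\<close> have "\<exists>g. P (Suc n) g"
          unfolding P_def by (intro elementary_extend[OF K(1,4)]) simp_all
        then show False using max by blast
      qed
    qed
  qed
  then have "f \<in> iso (Z2_power n) (G\<lparr>carrier := K\<rparr>)"
    using n unfolding P_def iso_def hom_def bij_betw_def by auto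
  then have "Z2_power n \<cong> G\<lparr>carrier := K\<rparr>" by (rule is_isoI)
  then have "G\<lparr>carrier := K\<rparr> \<cong> Z2_power n"
    by (rule group.iso_sym[rotated]) simp
  then show ?thesis using bound[OF n] by blast
qed

end

section \<open>Reflections with shifts\<close>

text \<open>
  The element \<open>s \<gamma> \<delta>\<close> is the generator attached to the affine root \<open>\<gamma> + \<delta>\<close>, with finite part
  \<open>\<gamma>\<close> and isotropic part \<open>\<delta>\<close> in \<open>S \<gamma>\<close>. Keeping the two parts as separate arguments lets the
  conjugation relations be read as a finite reflection of \<open>\<gamma>\<close> together with a shift of \<open>\<delta>\<close>, and
  confines the geometry to the integers \<open>n \<beta> \<alpha>\<close>.
\<close>

locale reflection_group = group G for G (structure) +
  fixes \<Phi> :: "'v::real_vector set" and S :: "'v \<Rightarrow> 'v set" and n :: "'v \<Rightarrow> 'v \<Rightarrow> int"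
    and r :: "'v \<Rightarrow> 'v \<Rightarrow> 'v" and s :: "'v \<Rightarrow> 'v \<Rightarrow> 'a"
  assumes r_in [simp]: "\<alpha> \<in> \<Phi> \<Longrightarrow> \<beta> \<in> \<Phi> \<Longrightarrow> r \<alpha> \<beta> \<in> \<Phi>"
    and r_self: "\<alpha> \<in> \<Phi> \<Longrightarrow> r \<alpha> \<alpha> = - \<alpha>"
    and r_invol [simp]: "\<alpha> \<in> \<Phi> \<Longrightarrow> \<beta> \<in> \<Phi> \<Longrightarrow> r \<alpha> (r \<alpha> \<beta>) = \<beta>"
    and n_self: "\<alpha> \<in> \<Phi> \<Longrightarrow> n \<alpha> \<alpha> = 2"
    and n_refl: "\<alpha> \<in> \<Phi> \<Longrightarrow> \<beta> \<in> \<Phi> \<Longrightarrow> n (r \<alpha> \<beta>) \<alpha> = - n \<beta> \<alpha>"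
    and S_r: "\<alpha> \<in> \<Phi> \<Longrightarrow> \<beta> \<in> \<Phi> \<Longrightarrow> S (r \<alpha> \<beta>) = S \<beta>"
    and S_zero [simp]: "\<alpha> \<in> \<Phi> \<Longrightarrow> 0 \<in> S \<alpha>"
    and S_shift: "\<alpha> \<in> \<Phi> \<Longrightarrow> \<beta> \<in> \<Phi> \<Longrightarrow> \<sigma> \<in> S \<alpha> \<Longrightarrow> \<delta> \<in> S \<beta> \<Longrightarrow>
      \<delta> - of_int (n \<beta> \<alpha>) *\<^sub>R \<sigma> \<in> S \<beta>"
    and s_closed [simp]: "\<alpha> \<in> \<Phi> \<Longrightarrow> \<sigma> \<in> S \<alpha> \<Longrightarrow> s \<alpha> \<sigma> \<in> carrier G"
    and s_sq: "\<alpha> \<in> \<Phi> \<Longrightarrow> \<sigma> \<in> S \<alpha> \<Longrightarrow> s \<alpha> \<sigma> \<otimes> s \<alpha> \<sigma> = \<one>"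
    and s_conj: "\<alpha> \<in> \<Phi> \<Longrightarrow> \<beta> \<in> \<Phi> \<Longrightarrow> \<sigma> \<in> S \<alpha> \<Longrightarrow> \<delta> \<in> S \<beta> \<Longrightarrow>
      s \<alpha> \<sigma> \<otimes> (s \<beta> \<delta> \<otimes> s \<alpha> \<sigma>) = s (r \<alpha> \<beta>) (\<delta> - of_int (n \<beta> \<alpha>) *\<^sub>R \<sigma>)"
    and generated: "carrier G = generate G {s \<alpha> \<sigma> | \<alpha> \<sigma>. \<alpha> \<in> \<Phi> \<and> \<sigma> \<in> S \<alpha>}"
begin

lemma neg_in [simp]: "\<alpha> \<in> \<Phi> \<Longrightarrow> - \<alpha> \<in> \<Phi>"
  using r_in[of \<alpha> \<alpha>] by (simp add: r_self)

lemma S_neg [simp]: "\<alpha> \<in> \<Phi> \<Longrightarrow> \<sigma> \<in> S \<alpha> \<Longrightarrow> - \<sigma> \<in> S \<alpha>"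
  using S_shift[of \<alpha> \<alpha> \<sigma> \<sigma>] by (simp add: n_self scaleR_2)

lemma S_plus:
  "\<alpha> \<in> \<Phi> \<Longrightarrow> \<beta> \<in> \<Phi> \<Longrightarrow> \<sigma> \<in> S \<alpha> \<Longrightarrow> \<delta> \<in> S \<beta> \<Longrightarrow> \<delta> + of_int (n \<beta> \<alpha>) *\<^sub>R \<sigma> \<in> S \<beta>"
  using S_shift[of \<alpha> \<beta> "- \<sigma>" \<delta>] by simp

lemma S_plus_n:
  "\<alpha> \<in> \<Phi> \<Longrightarrow> \<beta> \<in> \<Phi> \<Longrightarrow> \<sigma> \<in> S \<alpha> \<Longrightarrow> of_int (n \<beta> \<alpha>) *\<^sub>R \<sigma> \<in> S \<beta>"
  using S_plus[of \<alpha> \<beta> \<sigma> 0] by simp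

lemma S_plus_2:
  assumes "\<gamma> \<in> \<Phi>" "\<sigma> \<in> S \<gamma>" "\<delta> \<in> S \<gamma>"
  shows "\<delta> + 2 *\<^sub>R \<sigma> \<in> S \<gamma>" "\<delta> - 2 *\<^sub>R \<sigma> \<in> S \<gamma>"
  using assms S_plus[of \<gamma> \<gamma> \<sigma> \<delta>] S_shift[of \<gamma> \<gamma> \<sigma> \<delta>] by (simp_all add: n_self)

lemma S_plus_even:
  assumes "\<gamma> \<in> \<Phi>" "\<sigma> \<in> S \<gamma>" "\<delta> \<in> S \<gamma>"
  shows "\<delta> + of_int (2 * j) *\<^sub>R \<sigma> \<in> S \<gamma>"
proof (induction j rule: int_induct[of _ 0])
  case base then show ?case using assms by simp
next
  case (step1 i)
  have e: "\<delta> + of_int (2 * (i + 1)) *\<^sub>R \<sigma> = (\<delta> + of_int (2 * i) *\<^sub>R \<sigma>) + 2 *\<^sub>R \<sigma>"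
    by (simp add: algebra_simps)
  show ?case unfolding e by (rule S_plus_2(1)[OF assms(1,2) step1(2)])
next
  case (step2 i)
  have e: "\<delta> + of_int (2 * (i - 1)) *\<^sub>R \<sigma> = (\<delta> + of_int (2 * i) *\<^sub>R \<sigma>) - 2 *\<^sub>R \<sigma>"
    by (simp add: algebra_simps)
  show ?case unfolding e by (rule S_plus_2(2)[OF assms(1,2) step2(2)])
qed

lemma S_int [simp]:
  assumes "\<gamma> \<in> \<Phi>" "\<sigma> \<in> S \<gamma>"
  shows "of_int m *\<^sub>R \<sigma> \<in> S \<gamma>"
proof -
  have m: "of_int m *\<^sub>R \<sigma> = of_int (m mod 2) *\<^sub>R \<sigma> + of_int (2 * (m div 2)) *\<^sub>R \<sigma>"
    unfolding scaleR_left_distrib[symmetric] of_int_add[symmetric] by simp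
  have "of_int (m mod 2) *\<^sub>R \<sigma> \<in> S \<gamma>"
    using assms by (cases "even m") (simp_all add: mod_2_eq_odd)
  then show ?thesis unfolding m using S_plus_even assms by blast
qed

lemma s_inv [simp]: "\<alpha> \<in> \<Phi> \<Longrightarrow> \<sigma> \<in> S \<alpha> \<Longrightarrow> inv (s \<alpha> \<sigma>) = s \<alpha> \<sigma>"
  using s_sq inv_equality by simp

lemma s_cancel [simp]:
  "\<alpha> \<in> \<Phi> \<Longrightarrow> \<sigma> \<in> S \<alpha> \<Longrightarrow> x \<in> carrier G \<Longrightarrow> s \<alpha> \<sigma> \<otimes> (s \<alpha> \<sigma> \<otimes> x) = x"
  by (simp add: m_assoc[symmetric] s_sq)

lemma s_neg:
  assumes "\<gamma> \<in> \<Phi>" "\<sigma> \<in> S \<gamma>"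
  shows "s (- \<gamma>) \<sigma> = s \<gamma> (- \<sigma>)"
  using s_conj[of \<gamma> \<gamma> "- \<sigma>" "- \<sigma>"] assms by (simp add: r_self n_self scaleR_2 s_sq)

lemma s_conj_same:
  assumes "\<gamma> \<in> \<Phi>" "\<sigma> \<in> S \<gamma>" "\<delta> \<in> S \<gamma>"
  shows "s \<gamma> \<sigma> \<otimes> (s \<gamma> \<delta> \<otimes> s \<gamma> \<sigma>) = s \<gamma> (2 *\<^sub>R \<sigma> - \<delta>)"
  using s_conj[of \<gamma> \<gamma> \<sigma> \<delta>] s_neg[of \<gamma> "\<delta> - 2 *\<^sub>R \<sigma>"] S_plus_2(2)[of \<gamma> \<sigma> \<delta>] assms
  by (simp add: r_self n_self)

text \<open>A lift of the translation by \<open>\<delta>\<close> along the coroot of \<open>\<gamma>\<close>.\<close>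

definition F :: "'v \<Rightarrow> 'v \<Rightarrow> 'a" where
  "F \<gamma> \<sigma> = s \<gamma> \<sigma> \<otimes> s \<gamma> 0"

lemma F_closed [simp]: "\<gamma> \<in> \<Phi> \<Longrightarrow> \<sigma> \<in> S \<gamma> \<Longrightarrow> F \<gamma> \<sigma> \<in> carrier G"
  by (simp add: F_def)

lemma F_zero [simp]: "\<gamma> \<in> \<Phi> \<Longrightarrow> F \<gamma> 0 = \<one>"
  by (simp add: F_def s_sq)

lemma s_eq_F: "\<gamma> \<in> \<Phi> \<Longrightarrow> \<sigma> \<in> S \<gamma> \<Longrightarrow> s \<gamma> \<sigma> = F \<gamma> \<sigma> \<otimes> s \<gamma> 0"
  by (simp add: F_def m_assoc s_sq)

lemma F_inv: "\<gamma> \<in> \<Phi> \<Longrightarrow> \<sigma> \<in> S \<gamma> \<Longrightarrow> inv (F \<gamma> \<sigma>) = s \<gamma> 0 \<otimes> s \<gamma> \<sigma>"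
  by (simp add: F_def inv_mult_group)

lemma F_neg:
  assumes "\<gamma> \<in> \<Phi>" "\<sigma> \<in> S \<gamma>"
  shows "F \<gamma> (- \<sigma>) = inv (F \<gamma> \<sigma>)"
proof -
  have e: "s \<gamma> (- \<sigma>) = s \<gamma> 0 \<otimes> (s \<gamma> \<sigma> \<otimes> s \<gamma> 0)" using s_conj_same[of \<gamma> 0 \<sigma>] assms by simp
  have "F \<gamma> (- \<sigma>) = s \<gamma> 0 \<otimes> s \<gamma> \<sigma>" unfolding F_def e using assms by (simp add: m_assoc s_sq)
  then show ?thesis using assms by (simp add: F_inv)
qed

text \<open>
  Conjugating one generator by another over the same root shifts by an even multiple; hence \<open>F \<gamma>\<close>
  is a homomorphism on every cyclic group of shifts, although not on sums of different shifts.
\<close>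

lemma F_plus_2:
  assumes "\<gamma> \<in> \<Phi>" "\<sigma> \<in> S \<gamma>" "\<delta> \<in> S \<gamma>"
  shows "F \<gamma> (\<delta> + 2 *\<^sub>R \<sigma>) = F \<gamma> \<sigma> \<otimes> (F \<gamma> \<delta> \<otimes> F \<gamma> \<sigma>)"
proof -
  have "F \<gamma> \<sigma> \<otimes> (F \<gamma> \<delta> \<otimes> F \<gamma> \<sigma>)
      = s \<gamma> \<sigma> \<otimes> ((s \<gamma> 0 \<otimes> (s \<gamma> \<delta> \<otimes> s \<gamma> 0)) \<otimes> s \<gamma> \<sigma>) \<otimes> s \<gamma> 0"
    using assms by (simp add: F_def m_assoc)
  also have "\<dots> = F \<gamma> (2 *\<^sub>R \<sigma> + \<delta>)"
    using assms s_conj_same[of \<gamma> 0 \<delta>] s_conj_same[of \<gamma> \<sigma> "- \<delta>"] by (simp add: F_def)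
  finally show ?thesis by (simp add: add.commute)
qed

lemma F_minus_2:
  assumes "\<gamma> \<in> \<Phi>" "\<sigma> \<in> S \<gamma>" "\<delta> \<in> S \<gamma>"
  shows "F \<gamma> (\<delta> - 2 *\<^sub>R \<sigma>) = inv (F \<gamma> \<sigma>) \<otimes> (F \<gamma> \<delta> \<otimes> inv (F \<gamma> \<sigma>))"
  using F_plus_2[of \<gamma> "- \<sigma>" \<delta>] assms by (simp add: F_neg)

lemma F_int:
  assumes "\<gamma> \<in> \<Phi>" "\<sigma> \<in> S \<gamma>"
  shows "F \<gamma> (of_int m *\<^sub>R \<sigma>) = F \<gamma> \<sigma> [^] m"
proof -
  have S_nat: "of_nat k *\<^sub>R \<sigma> \<in> S \<gamma>" for k using S_int[OF assms, of "int k"] by simp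
  have nat: "F \<gamma> (of_nat k *\<^sub>R \<sigma>) = F \<gamma> \<sigma> [^] k" for k :: nat
  proof (induction k rule: induct_nat_012)
    case (ge2 k)
    have "F \<gamma> (of_nat (Suc (Suc k)) *\<^sub>R \<sigma>) = F \<gamma> (of_nat k *\<^sub>R \<sigma> + 2 *\<^sub>R \<sigma>)"
      by (simp add: algebra_simps)
    also have "\<dots> = F \<gamma> \<sigma> \<otimes> (F \<gamma> \<sigma> [^] k \<otimes> F \<gamma> \<sigma>)"
      using F_plus_2[OF assms S_nat] ge2 by simp
    also have "\<dots> = (F \<gamma> \<sigma> \<otimes> F \<gamma> \<sigma> [^] k) \<otimes> F \<gamma> \<sigma>" using assms by (simp add: m_assoc)
    also have "\<dots> = F \<gamma> \<sigma> [^] Suc (Suc k)"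
      using assms by (simp only: nat_pow_Suc2[symmetric] F_closed) (simp only: nat_pow_Suc)
    finally show ?case .
  qed (use assms in auto)
  show ?thesis
  proof (cases m rule: int_cases2)
    case (nonneg k)
    show ?thesis using nat[of k] unfolding nonneg int_pow_int by simp
  next
    case (nonpos k)
    have "F \<gamma> (- (of_nat k *\<^sub>R \<sigma>)) = inv (F \<gamma> \<sigma> [^] k)"
      unfolding F_neg[OF assms(1) S_nat] nat ..
    then show ?thesis
      unfolding nonpos using int_pow_neg[OF F_closed[OF assms], of "int k"] by (simp add: int_pow_int)
  qed
qed

text \<open>
  An element shifts by \<open>\<tau>\<close> if conjugation by it translates every generator along its own root.
\<close>

definition shifts :: "'a \<Rightarrow> ('v \<Rightarrow> 'v) \<Rightarrow> bool" where
  "shifts x \<tau> \<longleftrightarrow> x \<in> carrier G \<and>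
     (\<forall>\<gamma>\<in>\<Phi>. \<forall>\<sigma>\<in>S \<gamma>. \<sigma> + \<tau> \<gamma> \<in> S \<gamma> \<and> x \<otimes> (s \<gamma> \<sigma> \<otimes> inv x) = s \<gamma> (\<sigma> + \<tau> \<gamma>))"

lemma shifts_mult:
  assumes x: "shifts x \<tau>" and y: "shifts y \<tau>'"
  shows "shifts (x \<otimes> y) (\<lambda>\<gamma>. \<tau>' \<gamma> + \<tau> \<gamma>)"
  unfolding shifts_def
proof (intro conjI ballI)
  have c: "x \<in> carrier G" "y \<in> carrier G" using x y by (auto simp: shifts_def)
  then show "x \<otimes> y \<in> carrier G" by simp
  fix \<gamma> \<sigma> assume g: "\<gamma> \<in> \<Phi>" "\<sigma> \<in> S \<gamma>"
  then have y': "\<sigma> + \<tau>' \<gamma> \<in> S \<gamma>" "y \<otimes> (s \<gamma> \<sigma> \<otimes> inv y) = s \<gamma> (\<sigma> + \<tau>' \<gamma>)"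
    using y by (auto simp: shifts_def)
  then have x': "(\<sigma> + \<tau>' \<gamma>) + \<tau> \<gamma> \<in> S \<gamma>"
      "x \<otimes> (s \<gamma> (\<sigma> + \<tau>' \<gamma>) \<otimes> inv x) = s \<gamma> ((\<sigma> + \<tau>' \<gamma>) + \<tau> \<gamma>)"
    using x g(1) unfolding shifts_def by blast+
  then show "\<sigma> + (\<tau>' \<gamma> + \<tau> \<gamma>) \<in> S \<gamma>" by (simp add: add.assoc)
  have "x \<otimes> y \<otimes> (s \<gamma> \<sigma> \<otimes> inv (x \<otimes> y)) = x \<otimes> ((y \<otimes> (s \<gamma> \<sigma> \<otimes> inv y)) \<otimes> inv x)"
    using c g by (simp add: m_assoc inv_mult_group)
  also have "\<dots> = s \<gamma> (\<sigma> + (\<tau>' \<gamma> + \<tau> \<gamma>))" unfolding y'(2) x'(2) by (simp add: add.assoc)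
  finally show "x \<otimes> y \<otimes> (s \<gamma> \<sigma> \<otimes> inv (x \<otimes> y)) = s \<gamma> (\<sigma> + (\<tau>' \<gamma> + \<tau> \<gamma>))" .
qed

lemma shifts_inv:
  assumes x: "shifts x \<tau>"
  shows "shifts (inv x) (\<lambda>\<gamma>. - \<tau> \<gamma>)"
  unfolding shifts_def
proof (intro conjI ballI)
  have xc: "x \<in> carrier G" using x by (simp add: shifts_def)
  then show "inv x \<in> carrier G" by simp
  fix \<gamma> \<sigma> assume g: "\<gamma> \<in> \<Phi>" "\<sigma> \<in> S \<gamma>"
  have "- \<sigma> + \<tau> \<gamma> \<in> S \<gamma>" using x g(1) S_neg[OF g] unfolding shifts_def by blast
  then show m: "\<sigma> + - \<tau> \<gamma> \<in> S \<gamma>" using S_neg[OF g(1), of "- \<sigma> + \<tau> \<gamma>"] by simp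
  then have "x \<otimes> (s \<gamma> (\<sigma> + - \<tau> \<gamma>) \<otimes> inv x) = s \<gamma> \<sigma>" using x g(1) by (simp add: shifts_def)
  then have "inv x \<otimes> (s \<gamma> \<sigma> \<otimes> x) = inv x \<otimes> ((x \<otimes> (s \<gamma> (\<sigma> + - \<tau> \<gamma>) \<otimes> inv x)) \<otimes> x)"
    by simp
  also have "\<dots> = s \<gamma> (\<sigma> + - \<tau> \<gamma>)"
    using xc s_closed[OF g(1) m] by (simp add: m_assoc del: s_closed)
  finally show "inv x \<otimes> (s \<gamma> \<sigma> \<otimes> inv (inv x)) = s \<gamma> (\<sigma> + - \<tau> \<gamma>)" using xc by simp
qed

lemma shifts_F:
  assumes a: "\<alpha> \<in> \<Phi>" "\<epsilon> \<in> S \<alpha>"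
  shows "shifts (F \<alpha> \<epsilon>) (\<lambda>\<gamma>. of_int (n \<gamma> \<alpha>) *\<^sub>R \<epsilon>)"
  unfolding shifts_def
proof (intro conjI ballI)
  show "F \<alpha> \<epsilon> \<in> carrier G" using a by simp
  fix \<gamma> \<sigma> assume g: "\<gamma> \<in> \<Phi>" "\<sigma> \<in> S \<gamma>"
  then show "\<sigma> + of_int (n \<gamma> \<alpha>) *\<^sub>R \<epsilon> \<in> S \<gamma>" using S_plus a by blast
  have "F \<alpha> \<epsilon> \<otimes> (s \<gamma> \<sigma> \<otimes> inv (F \<alpha> \<epsilon>))
      = s \<alpha> \<epsilon> \<otimes> ((s \<alpha> 0 \<otimes> (s \<gamma> \<sigma> \<otimes> s \<alpha> 0)) \<otimes> s \<alpha> \<epsilon>)"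
    using a g by (simp add: F_def inv_mult_group m_assoc)
  also have "s \<alpha> 0 \<otimes> (s \<gamma> \<sigma> \<otimes> s \<alpha> 0) = s (r \<alpha> \<gamma>) \<sigma>"
    using s_conj[of \<alpha> \<gamma> 0 \<sigma>] a g by simp
  also have "s \<alpha> \<epsilon> \<otimes> (s (r \<alpha> \<gamma>) \<sigma> \<otimes> s \<alpha> \<epsilon>) = s \<gamma> (\<sigma> + of_int (n \<gamma> \<alpha>) *\<^sub>R \<epsilon>)"
    using s_conj[of \<alpha> "r \<alpha> \<gamma>" \<epsilon> \<sigma>] a g by (simp add: n_refl S_r)
  finally show "F \<alpha> \<epsilon> \<otimes> (s \<gamma> \<sigma> \<otimes> inv (F \<alpha> \<epsilon>)) = s \<gamma> (\<sigma> + of_int (n \<gamma> \<alpha>) *\<^sub>R \<epsilon>)" .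
qed

lemma shifts_inv_F:
  assumes "\<alpha> \<in> \<Phi>" "\<epsilon> \<in> S \<alpha>"
  shows "shifts (inv (F \<alpha> \<epsilon>)) (\<lambda>\<gamma>. - (of_int (n \<gamma> \<alpha>) *\<^sub>R \<epsilon>))"
  using shifts_F[of \<alpha> "- \<epsilon>"] assms by (simp add: F_neg)

text \<open>
  The generators are permuted by conjugation and generate the group, so an element that fixes
  each of them is central. This is what makes the kernel accessible.
\<close>

lemma center_if_commutes:
  assumes x: "x \<in> carrier G"
    and c: "\<And>\<gamma> \<sigma>. \<gamma> \<in> \<Phi> \<Longrightarrow> \<sigma> \<in> S \<gamma> \<Longrightarrow> x \<otimes> s \<gamma> \<sigma> = s \<gamma> \<sigma> \<otimes> x"
  shows "x \<in> center"
proof -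
  let ?X = "{s \<alpha> \<sigma> | \<alpha> \<sigma>. \<alpha> \<in> \<Phi> \<and> \<sigma> \<in> S \<alpha>}"
  have X: "?X \<subseteq> carrier G" by auto
  have "x \<otimes> y = y \<otimes> x" if "y \<in> generate G ?X" for y
    using that
  proof induction
    case (incl h) then show ?case using c by blast
  next
    case (inv h) then show ?case using c by force
  next
    case (eng h1 h2)
    then have h: "h1 \<in> carrier G" "h2 \<in> carrier G" using generate_in_carrier[OF X] by blast+
    have "x \<otimes> (h1 \<otimes> h2) = (x \<otimes> h1) \<otimes> h2" using h x by (simp add: m_assoc)
    also have "\<dots> = h1 \<otimes> (x \<otimes> h2)" unfolding eng.IH(1) using h x by (simp add: m_assoc)
    also have "\<dots> = h1 \<otimes> h2 \<otimes> x" unfolding eng.IH(2) using h x by (simp add: m_assoc)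
    finally show ?case .
  qed (use x in simp)
  then show ?thesis using x unfolding center_def generated by blast
qed

lemma shifts_center:
  assumes x: "shifts x \<tau>" and z: "\<And>\<gamma>. \<gamma> \<in> \<Phi> \<Longrightarrow> \<tau> \<gamma> = 0"
  shows "x \<in> center"
proof (rule center_if_commutes)
  show xc: "x \<in> carrier G" using x by (simp add: shifts_def)
  fix \<gamma> \<sigma> assume g: "\<gamma> \<in> \<Phi>" "\<sigma> \<in> S \<gamma>"
  have "x \<otimes> s \<gamma> \<sigma> = (x \<otimes> (s \<gamma> \<sigma> \<otimes> inv x)) \<otimes> x" using g xc by (simp add: m_assoc)
  also have "x \<otimes> (s \<gamma> \<sigma> \<otimes> inv x) = s \<gamma> \<sigma>" using x z g by (simp add: shifts_def)
  finally show "x \<otimes> s \<gamma> \<sigma> = s \<gamma> \<sigma> \<otimes> x" .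
qed

lemma F_conj:
  assumes a: "\<alpha> \<in> \<Phi>" "\<epsilon> \<in> S \<alpha>" and g: "\<gamma> \<in> \<Phi>" "\<delta> \<in> S \<gamma>"
  defines "\<eta> \<equiv> of_int (n \<gamma> \<alpha>) *\<^sub>R \<epsilon>"
  shows "F \<alpha> \<epsilon> \<otimes> (F \<gamma> \<delta> \<otimes> inv (F \<alpha> \<epsilon>)) = F \<gamma> (\<delta> + \<eta>) \<otimes> inv (F \<gamma> \<eta>)"
proof -
  have sh: "x \<otimes> (s \<gamma> \<sigma> \<otimes> inv x) = s \<gamma> (\<sigma> + \<eta>)" if "\<sigma> \<in> S \<gamma>" "x = F \<alpha> \<epsilon>" for \<sigma> x
    using shifts_F[OF a] g that by (simp add: shifts_def \<eta>_def)
  have \<eta>: "\<eta> \<in> S \<gamma>" "\<delta> + \<eta> \<in> S \<gamma>" using S_plus[OF a(1) g(1) a(2)] g S_plus_n[OF a(1) g(1) a(2)] by (simp_all add: \<eta>_def)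
  define x where "x = F \<alpha> \<epsilon>"
  have x: "x \<in> carrier G" using a by (simp add: x_def)
  have "x \<otimes> (F \<gamma> \<delta> \<otimes> inv x) = (x \<otimes> (s \<gamma> \<delta> \<otimes> inv x)) \<otimes> (x \<otimes> (s \<gamma> 0 \<otimes> inv x))"
    using x g by (simp add: F_def m_assoc)
  also have "\<dots> = s \<gamma> (\<delta> + \<eta>) \<otimes> s \<gamma> \<eta>" using sh[OF g(2) x_def] sh[OF _ x_def, of 0] g by simp
  also have "\<dots> = F \<gamma> (\<delta> + \<eta>) \<otimes> inv (F \<gamma> \<eta>)" using \<eta> g by (simp add: F_inv) (simp add: F_def m_assoc)
  finally show ?thesis by (simp add: x_def)
qed

text \<open>
  The defect \<open>c\<close> of additivity of \<open>F \<gamma>\<close> is central, and every commutator of two \<open>F\<close>s is such a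
  defect. So the whole commutator structure is visible in the rank-one pieces.
\<close>

definition c :: "'v \<Rightarrow> 'v \<Rightarrow> 'v \<Rightarrow> 'a" where
  "c \<gamma> \<delta> \<sigma> = F \<gamma> (\<delta> + \<sigma>) \<otimes> (inv (F \<gamma> \<sigma>) \<otimes> inv (F \<gamma> \<delta>))"

lemma c_center:
  assumes "\<gamma> \<in> \<Phi>" "\<delta> \<in> S \<gamma>" "\<sigma> \<in> S \<gamma>" "\<delta> + \<sigma> \<in> S \<gamma>"
  shows "c \<gamma> \<delta> \<sigma> \<in> center"
  unfolding c_def
  by (rule shifts_center[OF shifts_mult[OF shifts_F shifts_mult[OF shifts_inv_F shifts_inv_F]]])
     (use assms in \<open>simp_all add: algebra_simps\<close>)

lemma F_add:
  assumes "\<gamma> \<in> \<Phi>" "\<delta> \<in> S \<gamma>" "\<sigma> \<in> S \<gamma>" "\<delta> + \<sigma> \<in> S \<gamma>"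
  shows "F \<gamma> (\<delta> + \<sigma>) = c \<gamma> \<delta> \<sigma> \<otimes> (F \<gamma> \<delta> \<otimes> F \<gamma> \<sigma>)"
  using assms by (simp add: c_def m_assoc)

lemma c_unique:
  assumes "\<gamma> \<in> \<Phi>" "\<delta> \<in> S \<gamma>" "\<sigma> \<in> S \<gamma>" "z \<in> carrier G"
    and "F \<gamma> (\<delta> + \<sigma>) = z \<otimes> (F \<gamma> \<delta> \<otimes> F \<gamma> \<sigma>)"
  shows "c \<gamma> \<delta> \<sigma> = z"
  unfolding c_def assms(5) using assms(1-4) by (simp add: m_assoc)

lemma cmt_F:
  assumes a: "\<alpha> \<in> \<Phi>" "\<epsilon> \<in> S \<alpha>" and g: "\<gamma> \<in> \<Phi>" "\<delta> \<in> S \<gamma>"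
  shows "cmt (F \<alpha> \<epsilon>) (F \<gamma> \<delta>) = c \<gamma> \<delta> (of_int (n \<gamma> \<alpha>) *\<^sub>R \<epsilon>)"
proof -
  have "cmt (F \<alpha> \<epsilon>) (F \<gamma> \<delta>) = (F \<alpha> \<epsilon> \<otimes> (F \<gamma> \<delta> \<otimes> inv (F \<alpha> \<epsilon>))) \<otimes> inv (F \<gamma> \<delta>)"
    using a g by (simp add: cmt_def m_assoc)
  then show ?thesis
    unfolding F_conj[OF a g] c_def using a g S_plus[OF a(1) g(1) a(2)] S_plus_n[OF a(1) g(1) a(2)]
    by (simp add: m_assoc)
qed

lemma cmt_F_center:
  assumes "\<alpha> \<in> \<Phi>" "\<epsilon> \<in> S \<alpha>" "\<gamma> \<in> \<Phi>" "\<delta> \<in> S \<gamma>"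
  shows "cmt (F \<alpha> \<epsilon>) (F \<gamma> \<delta>) \<in> center"
  unfolding cmt_F[OF assms] using assms by (intro c_center S_plus S_plus_n)

lemma F_r:
  assumes "\<gamma> \<in> \<Phi>" "\<alpha> \<in> \<Phi>" "\<sigma> \<in> S \<alpha>"
  shows "F (r \<gamma> \<alpha>) \<sigma> = s \<gamma> 0 \<otimes> (F \<alpha> \<sigma> \<otimes> s \<gamma> 0)"
proof -
  have e: "s (r \<gamma> \<alpha>) \<delta> = s \<gamma> 0 \<otimes> (s \<alpha> \<delta> \<otimes> s \<gamma> 0)" if "\<delta> \<in> S \<alpha>" for \<delta>
    using s_conj[of \<gamma> \<alpha> 0 \<delta>] assms that by simp
  show ?thesis unfolding F_def e[OF assms(3)] e[OF S_zero[OF assms(2)]] using assms by (simp add: m_assoc)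
qed

text \<open>
  The coroot of \<open>\<alpha>\<close> is \<open>n \<gamma> \<alpha>\<close> times the coroot of \<open>\<gamma>\<close> plus the coroot of the reflected root, and
  this relation between coroots holds for the lifts without a correction term.
\<close>

lemma F_decompose:
  assumes "\<gamma> \<in> \<Phi>" "\<alpha> \<in> \<Phi>" "\<sigma> \<in> S \<alpha>"
  shows "F \<alpha> \<sigma> = F \<gamma> (of_int (n \<gamma> \<alpha>) *\<^sub>R \<sigma>) \<otimes> F (r \<gamma> \<alpha>) \<sigma>"
proof -
  let ?\<eta> = "of_int (n \<gamma> \<alpha>) *\<^sub>R \<sigma>"
  define x where "x = F \<alpha> \<sigma>"
  have x: "x \<in> carrier G" using assms by (simp add: x_def)
  have "x \<otimes> (s \<gamma> 0 \<otimes> inv x) = s \<gamma> ?\<eta>"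
    using shifts_F[OF assms(2,3)] assms by (auto simp: shifts_def x_def)
  then have "F \<gamma> ?\<eta> \<otimes> F (r \<gamma> \<alpha>) \<sigma> = (x \<otimes> (s \<gamma> 0 \<otimes> inv x)) \<otimes> s \<gamma> 0 \<otimes> (s \<gamma> 0 \<otimes> (x \<otimes> s \<gamma> 0))"
    using assms by (simp add: F_def[of \<gamma>] F_r x_def)
  then show ?thesis using x assms by (simp add: m_assoc x_def s_sq)
qed

subsection \<open>Rank one\<close>

lemma c_twice:
  assumes "\<gamma> \<in> \<Phi>" "\<delta> \<in> S \<gamma>" "\<sigma> \<in> S \<gamma>"
  shows "c \<gamma> \<delta> (2 *\<^sub>R \<sigma>) = cmt (F \<gamma> \<sigma>) (F \<gamma> \<delta>)"
  using cmt_F[of \<gamma> \<sigma> \<gamma> \<delta>] assms by (simp add: n_self)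

lemma F_reflect:
  "\<gamma> \<in> \<Phi> \<Longrightarrow> \<sigma> \<in> S \<gamma> \<Longrightarrow> s \<gamma> 0 \<otimes> (F \<gamma> \<sigma> \<otimes> s \<gamma> 0) = inv (F \<gamma> \<sigma>)"
  by (simp add: F_inv) (simp add: F_def m_assoc s_sq)

text \<open>The reflection in \<open>\<gamma>\<close> inverts each \<open>F \<gamma>\<close> and fixes the central defect.\<close>

lemma c_neg:
  assumes g: "\<gamma> \<in> \<Phi>" "\<delta> \<in> S \<gamma>" "\<sigma> \<in> S \<gamma>" "\<delta> + \<sigma> \<in> S \<gamma>"
  shows "F \<gamma> (- (\<delta> + \<sigma>)) = c \<gamma> \<delta> \<sigma> \<otimes> (inv (F \<gamma> \<delta>) \<otimes> inv (F \<gamma> \<sigma>))"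
proof -
  define z where "z = c \<gamma> \<delta> \<sigma>"
  have z: "z \<in> center" "z \<in> carrier G" using c_center[OF g] center_carrier by (auto simp: z_def)
  have "F \<gamma> (- (\<delta> + \<sigma>)) = s \<gamma> 0 \<otimes> ((z \<otimes> (F \<gamma> \<delta> \<otimes> F \<gamma> \<sigma>)) \<otimes> s \<gamma> 0)"
    using g F_neg[of \<gamma> "\<delta> + \<sigma>"] F_reflect[of \<gamma> "\<delta> + \<sigma>"] F_add[OF g] by (simp add: z_def)
  also have "\<dots> = z \<otimes> ((s \<gamma> 0 \<otimes> (F \<gamma> \<delta> \<otimes> s \<gamma> 0)) \<otimes> (s \<gamma> 0 \<otimes> (F \<gamma> \<sigma> \<otimes> s \<gamma> 0)))"
    using g z center_left_comm[OF z(1), of "s \<gamma> 0"] by (simp add: m_assoc)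
  finally show ?thesis using g F_reflect by (simp add: z_def)
qed

text \<open>
  The inverse of \<open>F\<close> at a sum can be computed by reflecting or by inverting the product. The two
  results contain the defect to opposite powers and the factors in opposite orders.
\<close>

lemma c_square:
  assumes g: "\<gamma> \<in> \<Phi>" "\<delta> \<in> S \<gamma>" "\<sigma> \<in> S \<gamma>" "\<delta> + \<sigma> \<in> S \<gamma>"
  shows "c \<gamma> \<delta> \<sigma> \<otimes> c \<gamma> \<delta> \<sigma> = cmt (F \<gamma> \<sigma>) (F \<gamma> \<delta>)"
proof -
  define z a b where "z = c \<gamma> \<delta> \<sigma>" and "a = F \<gamma> \<delta>" and "b = F \<gamma> \<sigma>"
  have z: "z \<in> center" "z \<in> carrier G" using c_center[OF g] center_carrier by (auto simp: z_def)
  have ab: "a \<in> carrier G" "b \<in> carrier G" using g by (auto simp: a_def b_def)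
  have "z \<otimes> (inv a \<otimes> inv b) = inv (z \<otimes> (a \<otimes> b))"
    using c_neg[OF g] F_neg[OF g(1,4)] F_add[OF g] by (simp add: z_def a_def b_def)
  then have "(z \<otimes> (inv a \<otimes> inv b)) \<otimes> (z \<otimes> (a \<otimes> b)) = \<one>" using z ab by simp
  moreover have "(z \<otimes> (inv a \<otimes> inv b)) \<otimes> (z \<otimes> (a \<otimes> b)) = (z \<otimes> z) \<otimes> (inv a \<otimes> (inv b \<otimes> (a \<otimes> b)))"
    using z ab center_left_comm[OF z(1), of "inv b" "a \<otimes> b"]
      center_left_comm[OF z(1), of "inv a" "inv b \<otimes> (a \<otimes> b)"] by (simp add: m_assoc)
  ultimately have "(z \<otimes> z) \<otimes> cmt (inv a) (inv b) = \<one>"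
    using ab by (simp add: cmt_def m_assoc)
  moreover have cc: "cmt a b \<in> center" using g cmt_F_center by (simp add: a_def b_def)
  moreover have "cmt (inv a) (inv b) = cmt a b"
  proof -
    have 1: "cmt a (inv b) = inv (cmt a b)" using cmt_inv_right[OF cc ab] .
    then have "cmt a (inv b) \<in> center" using cc subgroup_center subgroup.m_inv_closed by metis
    then show ?thesis using cmt_inv_left[of a "inv b"] ab 1 by simp
  qed
  ultimately have "z \<otimes> z = inv (cmt a b)" using z ab inv_equality by simp
  then show ?thesis using ab cmt_swap[of a b] by (simp add: z_def a_def b_def)
qed

lemma c_swap:
  assumes g: "\<gamma> \<in> \<Phi>" "\<delta> \<in> S \<gamma>" "\<sigma> \<in> S \<gamma>" "\<delta> + \<sigma> \<in> S \<gamma>"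
  shows "c \<gamma> \<sigma> \<delta> = inv (c \<gamma> \<delta> \<sigma>)"
proof -
  define z a b where "z = c \<gamma> \<delta> \<sigma>" and "a = F \<gamma> \<delta>" and "b = F \<gamma> \<sigma>"
  have z: "z \<in> center" "z \<in> carrier G" using c_center[OF g] center_carrier by (auto simp: z_def)
  have ab: "a \<in> carrier G" "b \<in> carrier G" using g by (auto simp: a_def b_def)
  have ba: "b \<otimes> a = (z \<otimes> z) \<otimes> (a \<otimes> b)"
    using cmt_commute[of b a] ab c_square[OF g] by (simp add: z_def a_def b_def)
  have "F \<gamma> (\<sigma> + \<delta>) = z \<otimes> (a \<otimes> b)" using F_add[OF g] by (simp add: add.commute z_def a_def b_def)
  also have "\<dots> = inv z \<otimes> (b \<otimes> a)" unfolding ba using z ab by (simp add: m_assoc)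
  finally show ?thesis
    using c_unique[of \<gamma> \<sigma> \<delta> "inv z"] g z ab by (simp add: z_def a_def b_def)
qed

text \<open>
  Adding \<open>2\<sigma>\<close> to the second argument multiplies on both sides by \<open>F \<gamma> \<sigma>\<close>, so the defect changes by
  the commutator of \<open>F \<gamma> \<sigma>\<close> with \<open>F \<gamma> \<delta>\<close> alone, independently of \<open>m\<close>.
\<close>

lemma c_step:
  assumes g: "\<gamma> \<in> \<Phi>" "\<delta> \<in> S \<gamma>" "\<sigma> \<in> S \<gamma>" "\<delta> + of_int m *\<^sub>R \<sigma> \<in> S \<gamma>"
  shows "c \<gamma> \<delta> (of_int (m + 2) *\<^sub>R \<sigma>) = c \<gamma> \<delta> (of_int m *\<^sub>R \<sigma>) \<otimes> c \<gamma> \<delta> (2 *\<^sub>R \<sigma>)"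
proof -
  define z k a b f where "z = c \<gamma> \<delta> (of_int m *\<^sub>R \<sigma>)" and "k = c \<gamma> \<delta> (2 *\<^sub>R \<sigma>)"
    and "a = F \<gamma> \<delta>" and "b = F \<gamma> \<sigma>" and "f = F \<gamma> (of_int m *\<^sub>R \<sigma>)"
  have z: "z \<in> center" "z \<in> carrier G" "k \<in> center" "k \<in> carrier G"
    using c_center[of \<gamma> \<delta> "of_int m *\<^sub>R \<sigma>"] c_center[of \<gamma> \<delta> "2 *\<^sub>R \<sigma>"] S_plus_2[of \<gamma> \<sigma> \<delta>]
      S_plus_2[of \<gamma> \<sigma> 0] g center_carrier by (auto simp: z_def k_def)
  have ab: "a \<in> carrier G" "b \<in> carrier G" "f \<in> carrier G" using g by (auto simp: a_def b_def f_def)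
  have ba: "b \<otimes> a = k \<otimes> (a \<otimes> b)"
    using cmt_commute[of b a] ab c_twice[OF g(1-3)] by (simp add: k_def a_def b_def)
  have "F \<gamma> (\<delta> + of_int (m + 2) *\<^sub>R \<sigma>) = b \<otimes> ((z \<otimes> (a \<otimes> f)) \<otimes> b)"
    using F_plus_2[OF g(1,3,4)] F_add[OF g(1,2) _ g(4)] g
    by (simp add: algebra_simps b_def z_def a_def f_def)
  also have "\<dots> = z \<otimes> ((b \<otimes> a) \<otimes> (f \<otimes> b))"
    using z ab center_left_comm[OF z(1), of b] by (simp add: m_assoc)
  also have "\<dots> = (z \<otimes> k) \<otimes> (a \<otimes> (b \<otimes> (f \<otimes> b)))"
    unfolding ba using z ab by (simp add: m_assoc)
  also have "b \<otimes> (f \<otimes> b) = F \<gamma> (of_int (m + 2) *\<^sub>R \<sigma>)"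
    using F_plus_2[OF g(1,3), of "of_int m *\<^sub>R \<sigma>"] g by (simp add: algebra_simps b_def f_def)
  finally have "F \<gamma> (\<delta> + of_int (m + 2) *\<^sub>R \<sigma>) = (z \<otimes> k) \<otimes> (a \<otimes> F \<gamma> (of_int (m + 2) *\<^sub>R \<sigma>))" .
  then show ?thesis
    using c_unique[of \<gamma> \<delta> "of_int (m + 2) *\<^sub>R \<sigma>" "z \<otimes> k"] g z S_int[OF g(1,3), of "m + 2"]
    unfolding z_def k_def a_def by simp
qed

lemma c_zero: "\<gamma> \<in> \<Phi> \<Longrightarrow> \<delta> \<in> S \<gamma> \<Longrightarrow> c \<gamma> \<delta> 0 = \<one>"
  by (simp add: c_def)

lemma c_progression:
  assumes g: "\<gamma> \<in> \<Phi>" "\<delta> \<in> S \<gamma>" "\<sigma> \<in> S \<gamma>" "\<delta> + of_int m *\<^sub>R \<sigma> \<in> S \<gamma>"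
  shows "c \<gamma> \<delta> (of_int (m + 2 * j) *\<^sub>R \<sigma>) = c \<gamma> \<delta> (of_int m *\<^sub>R \<sigma>) \<otimes> c \<gamma> \<delta> (2 *\<^sub>R \<sigma>) [^] j"
proof -
  define k where "k = c \<gamma> \<delta> (2 *\<^sub>R \<sigma>)"
  have k: "k \<in> carrier G"
    using c_center[of \<gamma> \<delta> "2 *\<^sub>R \<sigma>"] S_plus_2[of \<gamma> \<sigma> \<delta>] S_plus_2[of \<gamma> \<sigma> 0] g center_carrier
    by (auto simp: k_def)
  have S: "\<delta> + of_int (m + 2 * i) *\<^sub>R \<sigma> \<in> S \<gamma>" for i
    using S_plus_even[OF g(1,3,4), of i] by (simp add: algebra_simps)
  have cc: "c \<gamma> \<delta> (of_int (m + 2 * i) *\<^sub>R \<sigma>) \<in> carrier G" for i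
    by (rule center_carrier[OF c_center[OF g(1,2) S_int[OF g(1,3)] S]])
  have step: "c \<gamma> \<delta> (of_int (m + 2 * (i + 1)) *\<^sub>R \<sigma>) = c \<gamma> \<delta> (of_int (m + 2 * i) *\<^sub>R \<sigma>) \<otimes> k" for i
    using c_step[OF g(1-3) S[of i]] by (simp add: k_def algebra_simps)
  define z where "z = c \<gamma> \<delta> (of_int m *\<^sub>R \<sigma>)"
  have z: "z \<in> carrier G" using cc[of 0] by (simp add: z_def)
  show ?thesis
    unfolding k_def[symmetric] z_def[symmetric]
  proof (induction j rule: int_induct[of _ 0])
    case base then show ?case using z by (simp add: z_def)
  next
    case (step1 i)
    show ?case unfolding step step1(2) using z k by (simp add: m_assoc int_pow_mult)
  next
    case (step2 i)
    have "c \<gamma> \<delta> (of_int (m + 2 * (i - 1)) *\<^sub>R \<sigma>) \<otimes> k = z \<otimes> k [^] i"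
      using step[of "i - 1"] step2(2) by simp
    also have "\<dots> = (z \<otimes> k [^] (i - 1)) \<otimes> k"
      using int_pow_mult[OF k, of "i - 1" 1] z k by (simp add: m_assoc)
    finally have e: "c \<gamma> \<delta> (of_int (m + 2 * (i - 1)) *\<^sub>R \<sigma>) \<otimes> k = (z \<otimes> k [^] (i - 1)) \<otimes> k" .
    show ?case by (rule right_cancel[THEN iffD1, OF _ _ _ e]) (intro cc m_closed z int_pow_closed k)+
  qed
qed

text \<open>
  Hence the defects in the plane of \<open>\<delta>\<close> and \<open>\<epsilon>\<close> are powers of a single one; which one depends on
  whether \<open>\<delta> + \<epsilon>\<close> is an admissible shift.
\<close>

definition plane_gen :: "'v \<Rightarrow> 'v \<Rightarrow> 'v \<Rightarrow> 'a" where
  "plane_gen \<gamma> \<delta> \<epsilon> = (if \<delta> + \<epsilon> \<in> S \<gamma> then c \<gamma> \<delta> \<epsilon> else c \<gamma> \<delta> (2 *\<^sub>R \<epsilon>))"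

lemma plane_gen_center:
  assumes "\<gamma> \<in> \<Phi>" "\<delta> \<in> S \<gamma>" "\<epsilon> \<in> S \<gamma>"
  shows "plane_gen \<gamma> \<delta> \<epsilon> \<in> center"
  using assms c_center[of \<gamma> \<delta> \<epsilon>] c_center[of \<gamma> \<delta> "2 *\<^sub>R \<epsilon>"] S_plus_2[of \<gamma> \<epsilon> \<delta>] S_plus_2[of \<gamma> \<epsilon> 0]
  by (simp add: plane_gen_def)

text \<open>If the sum is admissible, all defects are powers of one whose square is the commutator.\<close>

lemma c_odd:
  assumes g: "\<gamma> \<in> \<Phi>" "\<delta> \<in> S \<gamma>" "\<epsilon> \<in> S \<gamma>" "\<delta> + \<epsilon> \<in> S \<gamma>"
  shows "c \<gamma> \<delta> (of_int m *\<^sub>R \<epsilon>) = c \<gamma> \<delta> \<epsilon> [^] m"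
proof -
  define z where "z = c \<gamma> \<delta> \<epsilon>"
  have z: "z \<in> carrier G" using c_center[OF g] center_carrier by (simp add: z_def)
  have two: "c \<gamma> \<delta> (2 *\<^sub>R \<epsilon>) = z [^] (2::int)"
    using c_square[OF g] c_twice[OF g(1-3)] int_pow_mult[OF z, of 1 1] z by (simp add: z_def)
  obtain j i where m: "m = i + 2 * j" "i = 0 \<or> i = 1"
    using mod_mult_div_eq[of m 2] by (metis mod_2_eq_odd of_bool_def)
  have "c \<gamma> \<delta> (of_int i *\<^sub>R \<epsilon>) = z [^] i" "\<delta> + of_int i *\<^sub>R \<epsilon> \<in> S \<gamma>"
    using m(2) g z by (auto simp: z_def c_zero)
  then show ?thesis
    using c_progression[OF g(1-3), of i j] z int_pow_mult[OF z, of i "2 * j"] int_pow_pow[OF z, of 2 j]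
    by (simp add: m(1) two z_def[symmetric] mult.commute)
qed

lemma c_even:
  assumes g: "\<gamma> \<in> \<Phi>" "\<delta> \<in> S \<gamma>" "\<epsilon> \<in> S \<gamma>"
  shows "c \<gamma> \<delta> (of_int (2 * j) *\<^sub>R \<epsilon>) = c \<gamma> \<delta> (2 *\<^sub>R \<epsilon>) [^] j"
proof -
  have "c \<gamma> \<delta> (2 *\<^sub>R \<epsilon>) \<in> carrier G"
    using c_center[of \<gamma> \<delta> "2 *\<^sub>R \<epsilon>"] S_plus_2[of \<gamma> \<epsilon> \<delta>] S_plus_2[of \<gamma> \<epsilon> 0] g center_carrier by auto
  then show ?thesis using c_progression[OF g, of 0 j] g by (simp add: c_zero)
qed

text \<open>Shifts by even multiples are always admissible, so only the parity of \<open>m\<close> matters.\<close>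

lemma S_odd:
  assumes g: "\<gamma> \<in> \<Phi>" "\<epsilon> \<in> S \<gamma>" "\<delta> + of_int m *\<^sub>R \<epsilon> \<in> S \<gamma>" "odd m"
  shows "\<delta> + \<epsilon> \<in> S \<gamma>"
proof -
  obtain i where i: "m = 2 * i + 1" using g(4) by (rule oddE)
  have e: "\<delta> + \<epsilon> = (\<delta> + of_int m *\<^sub>R \<epsilon>) + of_int (2 * (- i)) *\<^sub>R \<epsilon>"
    unfolding i by (simp add: algebra_simps)
  show ?thesis unfolding e by (rule S_plus_even[OF g(1-3)])
qed

lemma c_plane:
  assumes g: "\<gamma> \<in> \<Phi>" "\<delta> \<in> S \<gamma>" "\<epsilon> \<in> S \<gamma>"
  shows "\<delta> + of_int m *\<^sub>R \<epsilon> \<in> S \<gamma> \<Longrightarrow> \<exists>j::int. c \<gamma> \<delta> (of_int m *\<^sub>R \<epsilon>) = plane_gen \<gamma> \<delta> \<epsilon> [^] j"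
    and "\<epsilon> + of_int m *\<^sub>R \<delta> \<in> S \<gamma> \<Longrightarrow> \<exists>j::int. c \<gamma> \<epsilon> (of_int m *\<^sub>R \<delta>) = plane_gen \<gamma> \<delta> \<epsilon> [^] j"
proof -
  assume h: "\<delta> + of_int m *\<^sub>R \<epsilon> \<in> S \<gamma>"
  show "\<exists>j::int. c \<gamma> \<delta> (of_int m *\<^sub>R \<epsilon>) = plane_gen \<gamma> \<delta> \<epsilon> [^] j"
  proof (cases "\<delta> + \<epsilon> \<in> S \<gamma>")
    case True
    then show ?thesis using c_odd[OF g] by (auto simp: plane_gen_def)
  next
    case False
    then obtain j where "m = 2 * j" using S_odd[OF g(1,3) h] by blast
    then show ?thesis using c_even[OF g, of j] False by (auto simp: plane_gen_def)
  qed
next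
  assume h: "\<epsilon> + of_int m *\<^sub>R \<delta> \<in> S \<gamma>"
  have pc: "plane_gen \<gamma> \<delta> \<epsilon> \<in> carrier G" using plane_gen_center[OF g] center_carrier by blast
  show "\<exists>j::int. c \<gamma> \<epsilon> (of_int m *\<^sub>R \<delta>) = plane_gen \<gamma> \<delta> \<epsilon> [^] j"
  proof (cases "\<delta> + \<epsilon> \<in> S \<gamma>")
    case True
    then have "c \<gamma> \<epsilon> (of_int m *\<^sub>R \<delta>) = inv (plane_gen \<gamma> \<delta> \<epsilon>) [^] m"
      using c_odd[of \<gamma> \<epsilon> \<delta> m] c_swap[OF g True] g by (simp add: add.commute plane_gen_def)
    also have "\<dots> = plane_gen \<gamma> \<delta> \<epsilon> [^] (- m)" using pc by (simp add: int_pow_neg int_pow_inv)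
    finally show ?thesis by blast
  next
    case False
    then have "\<not> odd m" using S_odd[OF g(1,2) h] by (auto simp: add.commute)
    then obtain j where m: "m = 2 * j" by blast
    have "c \<gamma> \<epsilon> (of_int m *\<^sub>R \<delta>) = inv (plane_gen \<gamma> \<delta> \<epsilon>) [^] j"
      using c_even[OF g(1,3,2), of j] c_twice[OF g] c_twice[OF g(1,3,2)]
        cmt_swap[of "F \<gamma> \<epsilon>" "F \<gamma> \<delta>"] False g by (simp add: m plane_gen_def)
    also have "\<dots> = plane_gen \<gamma> \<delta> \<epsilon> [^] (- j)" using pc by (simp add: int_pow_neg int_pow_inv)
    finally show ?thesis by blast
  qed
qed

end

section \<open>Generators adapted to a basis of the shifts\<close>

text \<open>
  Only simple reflections are allowed in the steps: an orbit argument then produces a conjugating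
  word in the simple generators.
\<close>

inductive_set refl_orbit :: "('v \<Rightarrow> 'v \<Rightarrow> 'v) \<Rightarrow> (nat \<Rightarrow> 'v) \<Rightarrow> nat \<Rightarrow> 'v \<Rightarrow> 'v set"
  for r b l \<gamma> where
  start: "\<gamma> \<in> refl_orbit r b l \<gamma>"
| step: "\<beta> \<in> refl_orbit r b l \<gamma> \<Longrightarrow> i \<in> {1..l} \<Longrightarrow> r (b i) \<beta> \<in> refl_orbit r b l \<gamma>"

lemma closed_add_combination:
  fixes u :: "'i \<Rightarrow> 'v::real_vector"
  assumes fin: "finite I" and y: "y \<in> Y"
    and cl: "\<And>y i. y \<in> Y \<Longrightarrow> i \<in> I \<Longrightarrow> y + u i \<in> Y" "\<And>y i. y \<in> Y \<Longrightarrow> i \<in> I \<Longrightarrow> y - u i \<in> Y"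
  shows "y + (\<Sum>i\<in>I. of_int (k i) *\<^sub>R u i) \<in> Y"
proof -
  have one: "y + of_int j *\<^sub>R u i \<in> Y" if "y \<in> Y" "i \<in> I" for y i and j :: int
  proof (induction j rule: int_induct[of _ 0])
    case base then show ?case using that by simp
  next
    case (step1 j)
    have "y + of_int (j + 1) *\<^sub>R u i = (y + of_int j *\<^sub>R u i) + u i" by (simp add: algebra_simps)
    then show ?case using cl(1)[OF step1(2) that(2)] by metis
  next
    case (step2 j)
    have "y + of_int (j - 1) *\<^sub>R u i = (y + of_int j *\<^sub>R u i) - u i" by (simp add: algebra_simps)
    then show ?case using cl(2)[OF step2(2) that(2)] by metis
  qed
  have "y + (\<Sum>i\<in>I'. of_int (k i) *\<^sub>R u i) \<in> Y" if "I' \<subseteq> I" for I'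
    using finite_subset[OF that fin] that
  proof (induction I' rule: finite_induct)
    case empty then show ?case using y by simp
  next
    case (insert i I')
    then have "y + (\<Sum>i\<in>I'. of_int (k i) *\<^sub>R u i) \<in> Y" "i \<in> I" by auto
    from one[OF this, of "k i"] show ?case using insert.hyps by (simp add: add_ac)
  qed
  then show ?thesis by blast
qed

text \<open>
  There are two root lengths, represented by the simple roots \<open>\<gamma>s\<close> and \<open>\<gamma>l\<close>. The shifts of a root
  \<open>\<gamma>\<close> span a lattice with basis \<open>e \<gamma>\<close>, which for long roots is scaled by \<open>k\<close> in the first \<open>t\<close>
  directions. By \<open>good\<close>, a direction outside \<open>D \<gamma>\<close> is one in which \<open>F \<gamma>\<close> fails to be additive
  only by a commutator with some \<open>F \<alpha>\<close>; inside \<open>D \<gamma>\<close> the set \<open>S \<gamma>\<close> may be a proper semilattice.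
\<close>

locale affine_reflection_group = reflection_group G \<Phi> S n r s
  for G (structure) and \<Phi> :: "'v::real_vector set" and S n r s +
  fixes b :: "nat \<Rightarrow> 'v" and l :: nat and \<gamma>s \<gamma>l :: 'v and short :: "'v \<Rightarrow> bool"
    and k :: int and \<nu> t :: nat and \<sigma> :: "nat \<Rightarrow> 'v" and D :: "'v \<Rightarrow> nat set"
  fixes rep e
  defines "rep \<equiv> \<lambda>\<gamma>. if short \<gamma> then \<gamma>s else \<gamma>l"
    and "e \<equiv> \<lambda>\<gamma> j. if \<not> short \<gamma> \<and> j \<le> t then of_int k *\<^sub>R \<sigma> j else \<sigma> j"
  assumes b_in: "i \<in> {1..l} \<Longrightarrow> b i \<in> \<Phi>"
    and reps: "\<gamma>s \<in> b ` {1..l}" "\<gamma>l \<in> b ` {1..l}" "short \<gamma>s" "\<not> short \<gamma>l"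
    and short_r: "\<alpha> \<in> \<Phi> \<Longrightarrow> \<beta> \<in> \<Phi> \<Longrightarrow> short (r \<alpha> \<beta>) = short \<beta>"
    and n_reps: "n \<gamma>s \<gamma>l = - 1" "n \<gamma>l \<gamma>s = - k"
    and orbits: "\<gamma> \<in> \<Phi> \<Longrightarrow> \<gamma> \<in> refl_orbit r b l (rep \<gamma>)"
    and e_in: "\<gamma> \<in> {\<gamma>s, \<gamma>l} \<Longrightarrow> j \<in> {1..\<nu>} \<Longrightarrow> e \<gamma> j \<in> S \<gamma>"
    and e_span: "\<gamma> \<in> {\<gamma>s, \<gamma>l} \<Longrightarrow> v \<in> S \<gamma> \<Longrightarrow> \<exists>m :: nat \<Rightarrow> int. v = (\<Sum>j\<in>{1..\<nu>}. of_int (m j) *\<^sub>R e \<gamma> j)"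
    and sum_short: "i \<in> {1..\<nu>} \<Longrightarrow> j \<in> {1..\<nu>} \<Longrightarrow> t < j \<Longrightarrow> e \<gamma>s i + e \<gamma>s j \<in> S \<gamma>s"
    and sum_long: "i \<in> {1..\<nu>} \<Longrightarrow> j \<in> {1..\<nu>} \<Longrightarrow> i \<le> t \<Longrightarrow> e \<gamma>l i + e \<gamma>l j \<in> S \<gamma>l"
    and D_sub: "D \<gamma> \<subseteq> {1..\<nu>}"
    and good: "\<gamma> \<in> {\<gamma>s, \<gamma>l} \<Longrightarrow> j \<in> {1..\<nu>} - D \<gamma> \<Longrightarrow>
      \<exists>\<alpha>\<in>\<Phi>. \<exists>i\<in>{1..\<nu>}. \<exists>u. e \<gamma> j = of_int (n \<gamma> \<alpha>) *\<^sub>R (of_int u *\<^sub>R e \<alpha> i)"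
begin

abbreviation "I \<equiv> {1..\<nu>}"

lemma reps_in [simp]: "\<gamma>s \<in> \<Phi>" "\<gamma>l \<in> \<Phi>"
  using reps b_in by auto

lemma rep_cases: "rep \<gamma> \<in> {\<gamma>s, \<gamma>l}" "rep \<gamma> \<in> \<Phi>"
  by (auto simp: rep_def)

lemma e_rep: "e (rep \<gamma>) = e \<gamma>"
  using reps by (auto simp: e_def rep_def)

lemma e_r: "\<beta> \<in> \<Phi> \<Longrightarrow> \<gamma> \<in> \<Phi> \<Longrightarrow> e (r \<beta> \<gamma>) = e \<gamma>"
  by (simp add: e_def short_r)

text \<open>
  Every root is reached from one of the two representatives, so properties that simple
  reflections preserve need only be checked on the representatives.
\<close>

lemma orbit_induct [consumes 1, case_names rep step]:
  assumes "\<gamma> \<in> \<Phi>"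
    and "\<And>\<beta>. \<beta> \<in> {\<gamma>s, \<gamma>l} \<Longrightarrow> \<beta> = rep \<beta> \<Longrightarrow> P \<beta>"
    and "\<And>\<beta> i. \<beta> \<in> \<Phi> \<Longrightarrow> i \<in> {1..l} \<Longrightarrow> P \<beta> \<Longrightarrow> P (r (b i) \<beta>)"
  shows "P \<gamma>"
proof -
  have "\<beta> \<in> \<Phi> \<and> P \<beta>" if "\<beta> \<in> refl_orbit r b l (rep \<gamma>)" for \<beta>
    using that
  proof induction
    case start
    have "rep (rep \<gamma>) = rep \<gamma>" using reps by (simp add: rep_def)
    then show ?case using assms(2)[of "rep \<gamma>"] rep_cases[of \<gamma>] by simp
  next
    case (step \<beta> i)
    then show ?case using assms(3) b_in by auto
  qed
  then show ?thesis using orbits[OF assms(1)] by blast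
qed

lemma S_rep: "\<gamma> \<in> \<Phi> \<Longrightarrow> S \<gamma> = S (rep \<gamma>)"
proof (induction rule: orbit_induct)
  case (step \<beta> i)
  then show ?case using S_r[OF b_in, of i \<beta>] short_r[OF b_in, of i \<beta>] by (simp add: rep_def)
qed auto

lemma e_mem [simp]: "\<gamma> \<in> \<Phi> \<Longrightarrow> j \<in> I \<Longrightarrow> e \<gamma> j \<in> S \<gamma>"
  using e_in[OF rep_cases(1), of j \<gamma>] S_rep[of \<gamma>] e_rep[of \<gamma>] by simp

text \<open>Central elements are fixed by conjugation, so the defects depend only on the root length.\<close>

lemma c_r:
  assumes b: "\<beta> \<in> \<Phi>" and g: "\<gamma> \<in> \<Phi>" "\<delta> \<in> S \<gamma>" "\<epsilon> \<in> S \<gamma>" "\<delta> + \<epsilon> \<in> S \<gamma>"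
  shows "c (r \<beta> \<gamma>) \<delta> \<epsilon> = c \<gamma> \<delta> \<epsilon>"
proof (rule c_unique)
  define z where "z = c \<gamma> \<delta> \<epsilon>"
  have z: "z \<in> center" "z \<in> carrier G" using c_center[OF g] center_carrier by (auto simp: z_def)
  have "F (r \<beta> \<gamma>) (\<delta> + \<epsilon>) = s \<beta> 0 \<otimes> ((z \<otimes> (F \<gamma> \<delta> \<otimes> F \<gamma> \<epsilon>)) \<otimes> s \<beta> 0)"
    using F_r[OF b g(1,4)] F_add[OF g] by (simp add: z_def)
  also have "\<dots> = z \<otimes> ((s \<beta> 0 \<otimes> (F \<gamma> \<delta> \<otimes> s \<beta> 0)) \<otimes> (s \<beta> 0 \<otimes> (F \<gamma> \<epsilon> \<otimes> s \<beta> 0)))"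
    using b g z center_left_comm[OF z(1), of "s \<beta> 0"] by (simp add: m_assoc)
  also have "\<dots> = z \<otimes> (F (r \<beta> \<gamma>) \<delta> \<otimes> F (r \<beta> \<gamma>) \<epsilon>)"
    using F_r[OF b g(1)] g by simp
  finally show "F (r \<beta> \<gamma>) (\<delta> + \<epsilon>) = c \<gamma> \<delta> \<epsilon> \<otimes> (F (r \<beta> \<gamma>) \<delta> \<otimes> F (r \<beta> \<gamma>) \<epsilon>)"
    by (simp add: z_def)
  show "c \<gamma> \<delta> \<epsilon> \<in> carrier G" using z by (simp add: z_def)
qed (use b g S_r in auto)

lemma c_rep:
  assumes "\<gamma> \<in> \<Phi>" and "\<delta> \<in> S \<gamma>" "\<epsilon> \<in> S \<gamma>" "\<delta> + \<epsilon> \<in> S \<gamma>"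
  shows "c \<gamma> \<delta> \<epsilon> = c (rep \<gamma>) \<delta> \<epsilon>"
  using assms
proof (induction rule: orbit_induct)
  case (step \<beta> i)
  then show ?case
    using c_r[OF b_in, of i \<beta> \<delta> \<epsilon>] S_r[OF b_in, of i \<beta>] short_r[OF b_in, of i \<beta>]
    by (simp add: rep_def)
qed auto

lemma c_negneg:
  assumes g: "\<gamma> \<in> \<Phi>" "\<delta> \<in> S \<gamma>" "\<epsilon> \<in> S \<gamma>" "\<delta> + \<epsilon> \<in> S \<gamma>"
  shows "c \<gamma> (- \<delta>) (- \<epsilon>) = c \<gamma> \<delta> \<epsilon>"
proof (rule c_unique)
  have "- \<delta> + - \<epsilon> = - (\<delta> + \<epsilon>)" by simp
  then show "F \<gamma> (- \<delta> + - \<epsilon>) = c \<gamma> \<delta> \<epsilon> \<otimes> (F \<gamma> (- \<delta>) \<otimes> F \<gamma> (- \<epsilon>))"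
    using c_neg[OF g] F_neg[OF g(1,2)] F_neg[OF g(1,3)] by simp
  show "c \<gamma> \<delta> \<epsilon> \<in> carrier G" using c_center[OF g] center_carrier by blast
qed (use g in auto)

text \<open>
  One commutator between a short and a long root, read off from either side, links the defects
  of the two lengths.
\<close>

lemma c_cross:
  assumes "\<delta> \<in> S \<gamma>s" "\<epsilon> \<in> S \<gamma>l"
  shows "c \<gamma>l \<epsilon> (of_int k *\<^sub>R \<delta>) = inv (c \<gamma>s \<delta> \<epsilon>)"
proof -
  have S: "of_int k *\<^sub>R \<delta> \<in> S \<gamma>l" "\<epsilon> + of_int k *\<^sub>R \<delta> \<in> S \<gamma>l"
    using S_plus_n[of \<gamma>s \<gamma>l "- \<delta>"] S_shift[of \<gamma>s \<gamma>l \<delta> \<epsilon>] assms by (simp_all add: n_reps)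
  have "c \<gamma>s \<delta> \<epsilon> = cmt (F \<gamma>l (- \<epsilon>)) (F \<gamma>s \<delta>)"
    using cmt_F[of \<gamma>l "- \<epsilon>" \<gamma>s \<delta>] assms by (simp add: n_reps)
  also have "\<dots> = inv (cmt (F \<gamma>s \<delta>) (F \<gamma>l (- \<epsilon>)))"
    by (rule cmt_swap) (use assms in simp_all)
  also have "cmt (F \<gamma>s \<delta>) (F \<gamma>l (- \<epsilon>)) = c \<gamma>l (- \<epsilon>) (- (of_int k *\<^sub>R \<delta>))"
    using cmt_F[of \<gamma>s \<delta> \<gamma>l "- \<epsilon>"] assms by (simp add: n_reps)
  also have "\<dots> = c \<gamma>l \<epsilon> (of_int k *\<^sub>R \<delta>)"
    using c_negneg[of \<gamma>l \<epsilon> "of_int k *\<^sub>R \<delta>"] S assms by simp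
  finally show ?thesis
    using center_carrier[OF c_center[OF reps_in(2) assms(2) S]] by simp
qed

lemma c_self:
  assumes "\<gamma> \<in> \<Phi>" "\<delta> \<in> S \<gamma>"
  shows "c \<gamma> \<delta> (of_int m *\<^sub>R \<delta>) = \<one>"
proof (rule c_unique)
  have "F \<gamma> (\<delta> + of_int m *\<^sub>R \<delta>) = F \<gamma> (of_int (1 + m) *\<^sub>R \<delta>)" by (simp add: algebra_simps)
  then show "F \<gamma> (\<delta> + of_int m *\<^sub>R \<delta>) = \<one> \<otimes> (F \<gamma> \<delta> \<otimes> F \<gamma> (of_int m *\<^sub>R \<delta>))"
    using assms int_pow_mult[of "F \<gamma> \<delta>" 1 m] by (simp only: F_int) simp
qed (use assms in auto)

definition pairs :: "(nat \<times> nat) set" where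
  "pairs = {(i, j). i \<in> I \<and> j \<in> I \<and> i < j}"

definition g :: "nat \<times> nat \<Rightarrow> 'a" where
  "g = (\<lambda>(i, j). if i \<le> t then plane_gen \<gamma>s (e \<gamma>s i) (e \<gamma>s j) else plane_gen \<gamma>l (e \<gamma>l i) (e \<gamma>l j))"

text \<open>
  The part of the central subgroup that is visible in the Weyl group: it contains all commutators
  of the lifts, and also the defects of admissible sums of two basis shifts.
\<close>

definition A0 :: "'a set" where
  "A0 = generate G (g ` pairs)"

lemma g_center: "p \<in> pairs \<Longrightarrow> g p \<in> center"
  by (auto simp: g_def pairs_def intro!: plane_gen_center)

lemma A0_subgroup: "subgroup A0 G"
  unfolding A0_def by (rule generate_is_subgroup) (use g_center center_carrier in auto)

lemma A0_center: "A0 \<subseteq> center"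
  unfolding A0_def by (rule generate_subgroup_incl[OF _ subgroup_center]) (use g_center in auto)

lemma A0_inv: "a \<in> A0 \<Longrightarrow> inv a \<in> A0"
  using A0_subgroup by (rule subgroup.m_inv_closed)

lemma A0_pow: "a \<in> A0 \<Longrightarrow> a [^] (m::int) \<in> A0"
  using A0_subgroup by (rule subgroup_int_pow_closed)

lemma g_A0: "p \<in> pairs \<Longrightarrow> g p \<in> A0"
  unfolding A0_def by (intro generate.incl imageI)

text \<open>
  One cyclic group per pair of basis shifts accommodates the defects of both lengths: for
  \<open>i \<le> t\<close> all long defects are already short ones, and for \<open>t < i\<close> it is the other way around.
\<close>

lemma c_plane_A0:
  assumes gam: "\<gamma> \<in> {\<gamma>s, \<gamma>l}" and ij: "i \<in> I" "j \<in> I" "i \<noteq> j"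
    and S: "e \<gamma> i + of_int m *\<^sub>R e \<gamma> j \<in> S \<gamma>"
  shows "c \<gamma> (e \<gamma> i) (of_int m *\<^sub>R e \<gamma> j) \<in> A0"
proof -
  have es: "e \<gamma>s j = \<sigma> j" for j using reps by (simp add: e_def)
  have el: "e \<gamma>l j = (if j \<le> t then of_int k *\<^sub>R \<sigma> j else \<sigma> j)" for j using reps by (simp add: e_def)
  have sS: "\<sigma> j \<in> S \<gamma>s" if "j \<in> I" for j using e_mem[of \<gamma>s j] that by (simp add: es)
  have own: "c \<gamma>' (e \<gamma>' i) (of_int m *\<^sub>R e \<gamma>' j) \<in> A0"
    if p: "(i, j) \<in> pairs \<and> g (i, j) = plane_gen \<gamma>' (e \<gamma>' i) (e \<gamma>' j) \<or>
       (j, i) \<in> pairs \<and> g (j, i) = plane_gen \<gamma>' (e \<gamma>' j) (e \<gamma>' i)"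
      and gg: "\<gamma>' \<in> \<Phi>" and S: "e \<gamma>' i + of_int m *\<^sub>R e \<gamma>' j \<in> S \<gamma>'" for \<gamma>' i j and m :: int
    using p
  proof
    assume p: "(i, j) \<in> pairs \<and> g (i, j) = plane_gen \<gamma>' (e \<gamma>' i) (e \<gamma>' j)"
    then have m: "e \<gamma>' i \<in> S \<gamma>'" "e \<gamma>' j \<in> S \<gamma>'" using gg by (auto simp: pairs_def)
    show ?thesis using c_plane(1)[OF gg m S] p g_A0[of "(i, j)"] A0_pow by auto
  next
    assume p: "(j, i) \<in> pairs \<and> g (j, i) = plane_gen \<gamma>' (e \<gamma>' j) (e \<gamma>' i)"
    then have m: "e \<gamma>' i \<in> S \<gamma>'" "e \<gamma>' j \<in> S \<gamma>'" using gg by (auto simp: pairs_def)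
    show ?thesis using c_plane(2)[OF gg m(2,1) S] p g_A0[of "(j, i)"] A0_pow by auto
  qed
  \<comment> \<open>If one defect with admissible sum lies in \<open>A0\<close>, then so do all in that plane.\<close>
  have spread: "c \<gamma>' (e \<gamma>' i) (of_int m *\<^sub>R e \<gamma>' j) \<in> A0 \<and> c \<gamma>' (e \<gamma>' j) (of_int m *\<^sub>R e \<gamma>' i) \<in> A0"
    if "\<gamma>' \<in> \<Phi>" "i \<in> I" "j \<in> I" "e \<gamma>' i + e \<gamma>' j \<in> S \<gamma>'" "c \<gamma>' (e \<gamma>' i) (e \<gamma>' j) \<in> A0"
    for \<gamma>' i j and m :: int
    using c_odd[of \<gamma>' "e \<gamma>' i" "e \<gamma>' j" m] c_odd[of \<gamma>' "e \<gamma>' j" "e \<gamma>' i" m]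
      c_swap[of \<gamma>' "e \<gamma>' i" "e \<gamma>' j"] A0_pow A0_inv that by (simp add: add.commute)
  have long: "c \<gamma>l (e \<gamma>l i) (of_int m *\<^sub>R e \<gamma>l j) \<in> A0 \<and> c \<gamma>l (e \<gamma>l j) (of_int m *\<^sub>R e \<gamma>l i) \<in> A0"
    if p: "i \<in> I" "j \<in> I" "i < j" "i \<le> t" for i j and m :: int
  proof (rule spread)
    show S: "e \<gamma>l i + e \<gamma>l j \<in> S \<gamma>l" using sum_long p by blast
    have eli: "e \<gamma>l i = of_int k *\<^sub>R \<sigma> i" using p by (simp add: el)
    show "c \<gamma>l (e \<gamma>l i) (e \<gamma>l j) \<in> A0"
    proof (cases "j \<le> t")
      case True
      have "\<sigma> j + e \<gamma>l i \<in> S \<gamma>s"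
        using S_shift[of \<gamma>l \<gamma>s "e \<gamma>l i" "\<sigma> j"] sS p e_mem[of \<gamma>l i] by (simp add: n_reps)
      then have "c \<gamma>s (\<sigma> j) (of_int k *\<^sub>R \<sigma> i) \<in> A0"
        using own[of j i \<gamma>s k] p by (simp add: es eli pairs_def g_def)
      then have "inv (c \<gamma>s (\<sigma> j) (e \<gamma>l i)) \<in> A0" using A0_inv eli by simp
      moreover have "e \<gamma>l j = of_int k *\<^sub>R \<sigma> j" using True by (simp add: el)
      ultimately show ?thesis using c_cross[of "\<sigma> j" "e \<gamma>l i"] sS[OF p(2)] e_mem[of \<gamma>l i] p by simp
    next
      case False
      then have elj: "e \<gamma>l j = \<sigma> j" by (simp add: el)
      have "e \<gamma>s i + e \<gamma>s j \<in> S \<gamma>s" using sum_short p False by simp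
      then have "c \<gamma>s (\<sigma> i) (\<sigma> j) \<in> A0"
        using own[of i j \<gamma>s 1] p by (simp add: es pairs_def g_def)
      moreover have "c \<gamma>l (\<sigma> j) (of_int k *\<^sub>R \<sigma> i) = inv (c \<gamma>s (\<sigma> i) (\<sigma> j))"
        using c_cross[of "\<sigma> i" "\<sigma> j"] sS[OF p(1)] e_mem[of \<gamma>l j] p by (simp add: elj)
      ultimately have "c \<gamma>l (e \<gamma>l j) (e \<gamma>l i) \<in> A0" using A0_inv by (simp add: eli elj)
      then show ?thesis
        using c_swap[of \<gamma>l "e \<gamma>l j" "e \<gamma>l i"] S p A0_inv e_mem[of \<gamma>l] by (simp add: add.commute)
    qed
  qed (use p in auto)
  have short: "c \<gamma>s (e \<gamma>s i) (of_int m *\<^sub>R e \<gamma>s j) \<in> A0 \<and> c \<gamma>s (e \<gamma>s j) (of_int m *\<^sub>R e \<gamma>s i) \<in> A0"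
    if p: "i \<in> I" "j \<in> I" "i < j" "\<not> i \<le> t" for i j and m :: int
  proof (rule spread)
    show S: "e \<gamma>s i + e \<gamma>s j \<in> S \<gamma>s" using sum_short p by simp
    have "e \<gamma>l j + of_int k *\<^sub>R e \<gamma>l i \<in> S \<gamma>l"
      using S_shift[of \<gamma>s \<gamma>l "\<sigma> i" "e \<gamma>l j"] sS p e_mem[of \<gamma>l j] by (simp add: n_reps el)
    then have "c \<gamma>l (e \<gamma>l j) (of_int k *\<^sub>R e \<gamma>l i) \<in> A0"
      using own[of j i \<gamma>l k] p by (simp add: pairs_def g_def)
    moreover have "e \<gamma>l j = \<sigma> j" "e \<gamma>l i = \<sigma> i" using p by (simp_all add: el)
    moreover have "c \<gamma>l (e \<gamma>l j) (of_int k *\<^sub>R \<sigma> i) = inv (c \<gamma>s (\<sigma> i) (e \<gamma>l j))"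
      using c_cross[of "\<sigma> i" "e \<gamma>l j"] sS[OF p(1)] e_mem[of \<gamma>l j] p by simp
    moreover have "c \<gamma>s (\<sigma> i) (\<sigma> j) \<in> center"
      using c_center[of \<gamma>s "\<sigma> i" "\<sigma> j"] S p sS by (simp add: es)
    ultimately show "c \<gamma>s (e \<gamma>s i) (e \<gamma>s j) \<in> A0"
      using A0_inv[of "inv (c \<gamma>s (\<sigma> i) (\<sigma> j))"] center_carrier by (simp add: es)
  qed (use p in auto)
  show ?thesis
  proof (cases "\<gamma> = \<gamma>s")
    case True
    consider "i < j" "i \<le> t" | "j < i" "j \<le> t" | "i < j" "\<not> i \<le> t" | "j < i" "\<not> j \<le> t"
      using ij by linarith
    then show ?thesis
    proof cases
      case 1 then show ?thesis using own[of i j \<gamma>s m] S ij True by (simp add: pairs_def g_def)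
    next
      case 2 then show ?thesis using own[of i j \<gamma>s m] S ij True by (simp add: pairs_def g_def)
    next
      case 3 then show ?thesis using short[of i j m] ij True by simp
    next
      case 4 then show ?thesis using short[of j i m] ij True by simp
    qed
  next
    case False
    then have gl: "\<gamma> = \<gamma>l" using gam by blast
    consider "i < j" "i \<le> t" | "j < i" "j \<le> t" | "i < j" "\<not> i \<le> t" | "j < i" "\<not> j \<le> t"
      using ij by linarith
    then show ?thesis
    proof cases
      case 1 then show ?thesis using long[of i j m] ij gl by simp
    next
      case 2 then show ?thesis using long[of j i m] ij gl by simp
    next
      case 3 then show ?thesis using own[of i j \<gamma>l m] S ij gl by (simp add: pairs_def g_def)
    next
      case 4 then show ?thesis using own[of i j \<gamma>l m] S ij gl by (simp add: pairs_def g_def)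
    qed
  qed
qed

lemma one_A0: "\<one> \<in> A0"
  using A0_subgroup by (rule subgroup.one_closed)

text \<open>
  A commutator is a defect for either of its two roots. Of these the one is taken for which the
  other root's basis shift is an integral multiple of its own.
\<close>

lemma cmt_F_A0:
  assumes a: "\<alpha> \<in> \<Phi>" "i \<in> I" and gj: "\<gamma> \<in> \<Phi>" "j \<in> I"
  shows "cmt (F \<alpha> (e \<alpha> i)) (F \<gamma> (e \<gamma> j)) \<in> A0"
proof -
  have *: "cmt (F \<alpha> (e \<alpha> i)) (F \<gamma> (e \<gamma> j)) \<in> A0"
    if a: "\<alpha> \<in> \<Phi>" "i \<in> I" and gj: "\<gamma> \<in> \<Phi>" "j \<in> I"
      and m: "e \<alpha> i = of_int m *\<^sub>R e \<gamma> i" for \<alpha> \<gamma> i j and m :: int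
  proof -
    define x where "x = of_int (n \<gamma> \<alpha>) *\<^sub>R e \<alpha> i"
    have xS: "x \<in> S \<gamma>" "e \<gamma> j + x \<in> S \<gamma>"
      unfolding x_def using a gj S_plus_n[of \<alpha> \<gamma>] S_plus[of \<alpha> \<gamma>] by simp_all
    have x: "x = of_int (n \<gamma> \<alpha> * m) *\<^sub>R e (rep \<gamma>) i" unfolding x_def m e_rep by simp
    have eq: "cmt (F \<alpha> (e \<alpha> i)) (F \<gamma> (e \<gamma> j)) = c (rep \<gamma>) (e (rep \<gamma>) j) x"
      using cmt_F[of \<alpha> "e \<alpha> i" \<gamma> "e \<gamma> j"] c_rep[OF gj(1) _ xS] a gj by (simp add: x_def e_rep)
    show ?thesis
    proof (cases "i = j")
      case True
      have "e (rep \<gamma>) j \<in> S (rep \<gamma>)" using rep_cases gj by simp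
      then have "c (rep \<gamma>) (e (rep \<gamma>) j) x = \<one>"
        unfolding x True by (rule c_self[OF rep_cases(2)])
      then show ?thesis using eq one_A0 by simp
    next
      case False
      have "e (rep \<gamma>) j + x \<in> S (rep \<gamma>)" using xS S_rep[OF gj(1)] by (simp add: e_rep)
      then show ?thesis unfolding eq x using c_plane_A0[OF rep_cases(1)] a gj False by blast
    qed
  qed
  consider "\<exists>m::int. e \<alpha> i = of_int m *\<^sub>R e \<gamma> i" | "\<exists>m::int. e \<gamma> j = of_int m *\<^sub>R e \<alpha> j"
  proof (cases "short \<alpha> = short \<gamma>")
    case True
    then have "e \<alpha> i = of_int 1 *\<^sub>R e \<gamma> i" by (simp add: e_def)
    then show ?thesis using that by blast
  next
    case False
    then have "e \<alpha> i = of_int (if i \<le> t then k else 1) *\<^sub>R e \<gamma> i \<or>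
        e \<gamma> j = of_int (if j \<le> t then k else 1) *\<^sub>R e \<alpha> j"
      by (auto simp: e_def)
    then show ?thesis using that by blast
  qed
  then show ?thesis
  proof cases
    case 1 then show ?thesis using *[OF a gj] by blast
  next
    case 2
    then have "cmt (F \<gamma> (e \<gamma> j)) (F \<alpha> (e \<alpha> i)) \<in> A0" using *[OF gj a] by blast
    then show ?thesis using cmt_swap[of "F \<gamma> (e \<gamma> j)" "F \<alpha> (e \<alpha> i)"] A0_inv a gj by simp
  qed
qed

lemma shifts_lprod:
  assumes "\<And>p. p \<in> set ps \<Longrightarrow> \<alpha> p \<in> \<Phi> \<and> x p \<in> S (\<alpha> p)"
  shows "shifts (lprod (\<lambda>p. F (\<alpha> p) (x p)) ps m)
    (\<lambda>\<beta>. \<Sum>p\<leftarrow>ps. of_int (n \<beta> (\<alpha> p)) *\<^sub>R (of_int (m p) *\<^sub>R x p))"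
  using assms
proof (induction ps)
  case Nil
  show ?case by (simp add: shifts_def)
next
  case (Cons p ps)
  have p: "\<alpha> p \<in> \<Phi>" "x p \<in> S (\<alpha> p)" using Cons.prems by auto
  have 1: "shifts (F (\<alpha> p) (x p) [^] m p) (\<lambda>\<beta>. of_int (n \<beta> (\<alpha> p)) *\<^sub>R (of_int (m p) *\<^sub>R x p))"
    unfolding F_int[OF p, symmetric] by (rule shifts_F) (use p in auto)
  have 2: "shifts (lprod (\<lambda>p. F (\<alpha> p) (x p)) ps m)
    (\<lambda>\<beta>. \<Sum>p\<leftarrow>ps. of_int (n \<beta> (\<alpha> p)) *\<^sub>R (of_int (m p) *\<^sub>R x p))"
    by (rule Cons.IH) (use Cons.prems in auto)
  show ?case using shifts_mult[OF 1 2] by (simp add: add.commute)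
qed

text \<open>
  The sets \<open>J\<close> for which \<open>F \<gamma>\<close> is defined at the sum over \<open>J\<close> but is not forced to agree with the
  product of its values modulo \<open>A0\<close>.
\<close>

definition fam :: "'v \<Rightarrow> nat set set" where
  "fam \<gamma> = {J. J \<subseteq> D \<gamma> \<and> (\<Sum>j\<in>J. e \<gamma> j) \<in> S \<gamma> \<and> 3 \<le> card J}"

abbreviation Q :: "'v \<Rightarrow> nat list \<Rightarrow> int \<Rightarrow> 'a" where
  "Q \<gamma> js m \<equiv> lprod (\<lambda>j. F \<gamma> (e \<gamma> j)) js (\<lambda>_. m)"

text \<open>
  The deviation of \<open>F \<gamma>\<close> from additivity on \<open>J\<close>. Its image in the Weyl group may lie in the image of
  \<open>A0\<close> while \<open>z\<close> itself is not in \<open>A0\<close>; this is where a kernel can come from.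
\<close>

definition z :: "'v \<times> nat set \<Rightarrow> 'a" where
  "z = (\<lambda>(\<gamma>, J). F \<gamma> (\<Sum>j\<in>J. e \<gamma> j) \<otimes> inv (Q \<gamma> (sorted_list_of_set J) 1))"

text \<open>The root is kept in the index because \<open>z\<close> depends on it as well as on the set.\<close>

definition zidx :: "('v \<times> nat set) set" where
  "zidx = {\<gamma>s} \<times> fam \<gamma>s \<union> {\<gamma>l} \<times> fam \<gamma>l"

lemma fam_I: "J \<in> fam \<gamma> \<Longrightarrow> J \<subseteq> I \<and> finite J"
  using D_sub[of \<gamma>] finite_subset[of J I] by (auto simp: fam_def)

lemma finite_fam: "finite (fam \<gamma>)"
  by (rule finite_subset[of _ "Pow I"]) (use fam_I in auto)

lemma Q_closed: "\<gamma> \<in> \<Phi> \<Longrightarrow> set js \<subseteq> I \<Longrightarrow> Q \<gamma> js m \<in> carrier G"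
  by (rule lprod_closed) auto

lemma zidx_cases:
  assumes "p \<in> zidx"
  obtains \<gamma> J js where "p = (\<gamma>, J)" "\<gamma> \<in> \<Phi>" "J \<in> fam \<gamma>" "set js = J" "distinct js" "J \<subseteq> I"
    "z p = F \<gamma> (\<Sum>j\<in>J. e \<gamma> j) \<otimes> inv (Q \<gamma> js 1)"
proof -
  obtain \<gamma> J where p: "p = (\<gamma>, J)" "\<gamma> \<in> \<Phi>" "J \<in> fam \<gamma>" using assms by (auto simp: zidx_def)
  then show thesis using that[of \<gamma> J "sorted_list_of_set J"] fam_I[OF p(3)] by (simp add: z_def)
qed

lemma z_center:
  assumes "p \<in> zidx" shows "z p \<in> center"
  using assms
proof (cases rule: zidx_cases)
  case (1 \<gamma> J js)
  have S: "(\<Sum>j\<in>J. e \<gamma> j) \<in> S \<gamma>" using 1(3) by (simp add: fam_def)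
  have "shifts (Q \<gamma> js 1) (\<lambda>\<beta>. \<Sum>j\<leftarrow>js. of_int (n \<beta> \<gamma>) *\<^sub>R (of_int 1 *\<^sub>R e \<gamma> j))"
    by (rule shifts_lprod) (use 1 in auto)
  from shifts_mult[OF shifts_F[OF 1(2) S] shifts_inv[OF this]] show ?thesis
    unfolding 1(7)
    by (rule shifts_center) (use 1 in \<open>simp add: sum_list_distinct_conv_sum_set scaleR_sum_right\<close>)
qed

lemma Q_reflect:
  assumes "\<gamma> \<in> \<Phi>" "set js \<subseteq> I"
  shows "s \<gamma> 0 \<otimes> (Q \<gamma> js 1 \<otimes> s \<gamma> 0) = Q \<gamma> js (- 1)"
  using assms
proof (induction js)
  case Nil
  then show ?case by (simp add: s_sq)
next
  case (Cons j js)
  have q: "Q \<gamma> js 1 \<in> carrier G" "F \<gamma> (e \<gamma> j) \<in> carrier G" using Cons.prems Q_closed by auto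
  have "s \<gamma> 0 \<otimes> (Q \<gamma> (j # js) 1 \<otimes> s \<gamma> 0)
      = (s \<gamma> 0 \<otimes> (F \<gamma> (e \<gamma> j) \<otimes> s \<gamma> 0)) \<otimes> (s \<gamma> 0 \<otimes> (Q \<gamma> js 1 \<otimes> s \<gamma> 0))"
    using Cons.prems q by (simp add: m_assoc)
  then show ?case using Cons F_reflect[of \<gamma> "e \<gamma> j"] q by (simp add: int_pow_neg)
qed

text \<open>Cancelling a product against that of the inverses in the same order leaves commutators only.\<close>

lemma Q_palindrome_A0:
  assumes "\<gamma> \<in> \<Phi>" "set js \<subseteq> I"
  shows "Q \<gamma> js 1 \<otimes> Q \<gamma> js (- 1) \<in> A0"
  using assms
proof (induction js)
  case Nil
  then show ?case by (simp add: one_A0)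
next
  case (Cons j js)
  let ?f = "F \<gamma> (e \<gamma> j)" and ?q = "Q \<gamma> js 1" and ?q' = "Q \<gamma> js (- 1)"
  let ?X = "(\<lambda>j. F \<gamma> (e \<gamma> j)) ` I"
  have c: "?f \<in> carrier G" "?q \<in> carrier G" "?q' \<in> carrier G" using Cons.prems Q_closed by auto
  have X: "?X \<subseteq> carrier G" using Cons.prems by auto
  have qg: "?q \<in> generate G ?X"
    by (rule lprod_in_subgroup[OF generate_is_subgroup[OF X]]) (use Cons.prems in \<open>auto intro: generate.incl\<close>)
  have fg: "?f \<in> generate G ?X" using Cons.prems by (auto intro: generate.incl)
  have k: "cmt ?f ?q \<in> A0"
    by (rule cmt_generate[OF A0_subgroup A0_center X X _ fg qg])
      (use Cons.prems(1) in \<open>auto intro: cmt_F_A0\<close>)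
  have "Q \<gamma> (j # js) 1 \<otimes> Q \<gamma> (j # js) (- 1) = cmt ?f ?q \<otimes> (?q \<otimes> ?q')"
    using c by (simp add: cmt_def m_assoc int_pow_neg)
  then show ?case using subgroup.m_closed[OF A0_subgroup k] Cons by auto
qed

text \<open>
  Reflecting in \<open>\<gamma>\<close> inverts each \<open>F \<gamma>\<close> but fixes the central element \<open>z\<close>. Comparing the two
  factorizations of the inverse of \<open>F\<close> at the sum leaves only commutators in the square of \<open>z\<close>.
\<close>

lemma z_square:
  assumes "p \<in> zidx" shows "z p \<otimes> z p \<in> A0"
  using assms
proof (cases rule: zidx_cases)
  case (1 \<gamma> J js)
  define w f q q' where "w = z p" and "f = F \<gamma> (\<Sum>j\<in>J. e \<gamma> j)" and "q = Q \<gamma> js 1" and "q' = Q \<gamma> js (- 1)"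
  have S: "(\<Sum>j\<in>J. e \<gamma> j) \<in> S \<gamma>" using 1(3) by (simp add: fam_def)
  have c: "f \<in> carrier G" "q \<in> carrier G" "q' \<in> carrier G" "w \<in> center" "w \<in> carrier G"
    "s \<gamma> 0 \<in> carrier G"
    unfolding f_def q_def q'_def w_def
    using F_closed[OF 1(2) S] Q_closed[OF 1(2), of js] 1(4,6) z_center[OF assms]
      center_carrier[OF z_center[OF assms]] s_closed[OF 1(2) S_zero[OF 1(2)]] by simp_all
  have f: "f = w \<otimes> q" using 1(7) c by (simp add: w_def f_def q_def m_assoc)
  have "inv f = s \<gamma> 0 \<otimes> (f \<otimes> s \<gamma> 0)" using F_reflect[OF 1(2) S] by (simp add: f_def)
  also have "\<dots> = w \<otimes> (s \<gamma> 0 \<otimes> (q \<otimes> s \<gamma> 0))"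
    unfolding f using c center_left_comm[OF c(4), of "s \<gamma> 0" "q \<otimes> s \<gamma> 0"] by (simp add: m_assoc)
  also have "s \<gamma> 0 \<otimes> (q \<otimes> s \<gamma> 0) = q'" using Q_reflect 1 by (simp add: q_def q'_def)
  finally have "f \<otimes> (w \<otimes> q') = \<one>" using c r_inv[OF c(1)] by simp
  then have "(w \<otimes> w) \<otimes> (q \<otimes> q') = \<one>"
    unfolding f using c center_left_comm[OF c(4), of q q'] by (simp add: m_assoc)
  then have "w \<otimes> w = inv (q \<otimes> q')" using c inv_equality by simp
  then show ?thesis
    using Q_palindrome_A0[OF 1(2), of js] 1 A0_inv by (simp add: w_def q_def q'_def)
qed

definition A :: "'a set" where
  "A = generate G (A0 \<union> z ` zidx)"

lemma A_gen_center: "A0 \<union> z ` zidx \<subseteq> center"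
  using A0_center z_center by auto

lemma A_subgroup: "subgroup A G"
  unfolding A_def by (rule generate_is_subgroup) (use A_gen_center center_carrier in auto)

lemma A_center: "A \<subseteq> center"
  unfolding A_def by (rule generate_subgroup_incl[OF A_gen_center subgroup_center])

lemma A0_A: "A0 \<subseteq> A"
  unfolding A_def by (auto intro: generate.incl)

lemma z_A: "p \<in> zidx \<Longrightarrow> z p \<in> A"
  unfolding A_def by (auto intro: generate.incl)

definition Fgen :: "'v \<Rightarrow> 'a set" where
  "Fgen \<gamma> = generate G (A \<union> (\<lambda>j. F \<gamma> (e \<gamma> j)) ` I)"

lemma Fgen_base: "\<gamma> \<in> \<Phi> \<Longrightarrow> A \<union> (\<lambda>j. F \<gamma> (e \<gamma> j)) ` I \<subseteq> carrier G"
  using A_center center_carrier by auto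

lemma Fgen_subgroup: "\<gamma> \<in> \<Phi> \<Longrightarrow> subgroup (Fgen \<gamma>) G"
  unfolding Fgen_def by (rule generate_is_subgroup[OF Fgen_base])

lemma Fgen_A: "A \<subseteq> Fgen \<gamma>"
  unfolding Fgen_def by (auto intro: generate.incl)

lemma Fgen_F: "j \<in> I \<Longrightarrow> F \<gamma> (e \<gamma> j) \<in> Fgen \<gamma>"
  unfolding Fgen_def by (auto intro: generate.incl)

lemma cmt_F_Fgen:
  assumes "\<alpha> \<in> \<Phi>" "i \<in> I" "\<gamma> \<in> \<Phi>" "x \<in> Fgen \<gamma>"
  shows "cmt (F \<alpha> (of_int u *\<^sub>R e \<alpha> i)) x \<in> A0"
proof (rule cmt_generate[OF A0_subgroup A0_center _ Fgen_base[OF assms(3)]])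
  show "{F \<alpha> (e \<alpha> i)} \<subseteq> carrier G" using assms by simp
  show "x \<in> generate G (A \<union> (\<lambda>j. F \<gamma> (e \<gamma> j)) ` I)" using assms(4) by (simp add: Fgen_def)
  show "F \<alpha> (of_int u *\<^sub>R e \<alpha> i) \<in> generate G {F \<alpha> (e \<alpha> i)}"
    using assms by (simp add: F_int) (intro subgroup_int_pow_closed generate_is_subgroup generate.incl; simp)
  fix a y assume a: "a \<in> {F \<alpha> (e \<alpha> i)}" and y: "y \<in> A \<union> (\<lambda>j. F \<gamma> (e \<gamma> j)) ` I"
  then show "cmt a y \<in> A0"
  proof (cases "y \<in> A")
    case True
    then have "y \<in> center" using A_center by blast
    then have "cmt a y = \<one>"
      using a assms center_conj[of y a] center_carrier by (simp add: cmt_def)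
    then show ?thesis using one_A0 by simp
  qed (use a y assms cmt_F_A0 in auto)
qed

text \<open>
  Shifting by a good basis element costs only a commutator, and shifting by twice any basis
  element costs nothing. This reduces a general shift to a sum over a subset of \<open>D\<close>, where
  subsets with at most two members are covered by \<open>A0\<close> and the others by the elements \<open>z\<close>.
\<close>

lemma F_Fgen_rep:
  assumes gam: "\<gamma> \<in> {\<gamma>s, \<gamma>l}" and v: "v \<in> S \<gamma>"
  shows "F \<gamma> v \<in> Fgen \<gamma>"
proof -
  have gP: "\<gamma> \<in> \<Phi>" using gam by auto
  note sub = Fgen_subgroup[OF gP]
  note mcl = subgroup.m_closed[OF sub] and icl = subgroup.m_inv_closed[OF sub]
  define Y where "Y = {v \<in> S \<gamma>. F \<gamma> v \<in> Fgen \<gamma>}"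
  define u where "u j = (if j \<in> D \<gamma> then 2 *\<^sub>R e \<gamma> j else e \<gamma> j)" for j
  have two: "y + 2 *\<^sub>R e \<gamma> j \<in> Y" "y - 2 *\<^sub>R e \<gamma> j \<in> Y" if "y \<in> Y" "j \<in> I" for y j
    using that gP F_plus_2[of \<gamma> "e \<gamma> j" y] F_minus_2[of \<gamma> "e \<gamma> j" y] S_plus_2[of \<gamma> "e \<gamma> j" y]
    by (auto simp: Y_def intro!: mcl icl Fgen_F)
  have S_u: "y + u j \<in> S \<gamma> \<and> y - u j \<in> S \<gamma>" if h: "y \<in> S \<gamma>" "j \<in> I" for y j
  proof (cases "j \<in> D \<gamma>")
    case True
    then show ?thesis
      using S_plus_2[of \<gamma> "e \<gamma> j" y] h gP by (simp_all add: u_def)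
  next
    case False
    obtain \<alpha> i w where a: "\<alpha> \<in> \<Phi>" "i \<in> I" "e \<gamma> j = of_int (n \<gamma> \<alpha>) *\<^sub>R (of_int w *\<^sub>R e \<alpha> i)"
      using good[OF gam] h False by blast
    have m: "of_int w *\<^sub>R e \<alpha> i \<in> S \<alpha>" using a by simp
    show ?thesis
      using S_plus[OF a(1) gP m h(1)] S_shift[OF a(1) gP m h(1)] False
      by (simp_all add: u_def a(3))
  qed
  have goodstep: "y + of_int \<epsilon> *\<^sub>R e \<gamma> j \<in> Y"
    if y: "y \<in> Y" and j: "j \<in> I" "j \<notin> D \<gamma>" and S: "y + of_int \<epsilon> *\<^sub>R e \<gamma> j \<in> S \<gamma>" for y j and \<epsilon> :: int
  proof -
    obtain \<alpha> i w where a: "\<alpha> \<in> \<Phi>" "i \<in> I" "e \<gamma> j = of_int (n \<gamma> \<alpha>) *\<^sub>R (of_int w *\<^sub>R e \<alpha> i)"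
      using good[OF gam] j by blast
    have yS: "y \<in> S \<gamma>" "F \<gamma> y \<in> Fgen \<gamma>" using y by (auto simp: Y_def)
    have e: "of_int \<epsilon> *\<^sub>R e \<gamma> j = of_int (n \<gamma> \<alpha>) *\<^sub>R (of_int (\<epsilon> * w) *\<^sub>R e \<alpha> i)"
      by (simp add: a(3) mult_ac)
    have eS: "of_int \<epsilon> *\<^sub>R e \<gamma> j \<in> S \<gamma>" using gP j by simp
    have c_eq: "c \<gamma> y (of_int \<epsilon> *\<^sub>R e \<gamma> j) = cmt (F \<alpha> (of_int (\<epsilon> * w) *\<^sub>R e \<alpha> i)) (F \<gamma> y)"
      unfolding e by (rule cmt_F[OF a(1) S_int[OF a(1) e_mem[OF a(1,2)]] gP yS(1), symmetric])
    have "c \<gamma> y (of_int \<epsilon> *\<^sub>R e \<gamma> j) \<in> A0"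
      unfolding c_eq by (rule cmt_F_Fgen[OF a(1,2) gP yS(2)])
    then have cF: "c \<gamma> y (of_int \<epsilon> *\<^sub>R e \<gamma> j) \<in> Fgen \<gamma>" using A0_A Fgen_A by blast
    have eF: "F \<gamma> (of_int \<epsilon> *\<^sub>R e \<gamma> j) \<in> Fgen \<gamma>"
      unfolding F_int[OF gP e_mem[OF gP j(1)]]
      by (rule subgroup_int_pow_closed[OF sub Fgen_F[OF j(1)]])
    have "F \<gamma> (y + of_int \<epsilon> *\<^sub>R e \<gamma> j) \<in> Fgen \<gamma>"
      unfolding F_add[OF gP yS(1) eS S] by (intro mcl cF yS(2) eF)
    then show ?thesis using S by (simp add: Y_def)
  qed
  have Y_u: "y + u j \<in> Y" "y - u j \<in> Y" if "y \<in> Y" "j \<in> I" for y j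
    using two[OF that] goodstep[OF that, of 1] goodstep[OF that, of "- 1"] S_u[of y j] that
    by (auto simp: u_def Y_def split: if_splits)
  have base: "(\<Sum>j\<in>J. e \<gamma> j) \<in> Y" if J: "J \<subseteq> D \<gamma>" "(\<Sum>j\<in>J. e \<gamma> j) \<in> S \<gamma>" for J
  proof -
    have JI: "J \<subseteq> I" using J(1) D_sub by blast
    then have fin: "finite J" using finite_subset by blast
    consider "J = {}" | i where "J = {i}" | i j where "J = {i, j}" "i \<noteq> j" | "3 \<le> card J"
    proof -
      have "card J = 0 \<or> card J = 1 \<or> card J = 2 \<or> 3 \<le> card J" by linarith
      then show thesis using that fin by (auto simp: card_1_singleton_iff card_2_iff)
    qed
    then have "F \<gamma> (\<Sum>j\<in>J. e \<gamma> j) \<in> Fgen \<gamma>"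
    proof cases
      case 1 then show ?thesis using subgroup.one_closed[OF sub] gP by simp
    next
      case 2 then show ?thesis using Fgen_F JI by simp
    next
      case 3
      have ij: "i \<in> I" "j \<in> I" and S: "e \<gamma> i + e \<gamma> j \<in> S \<gamma>" using 3 JI J(2) by auto
      have "c \<gamma> (e \<gamma> i) (e \<gamma> j) \<in> A0" using c_plane_A0[OF gam ij 3(2), of 1] S by simp
      then have "c \<gamma> (e \<gamma> i) (e \<gamma> j) \<in> Fgen \<gamma>" using A0_A Fgen_A by blast
      then have "F \<gamma> (e \<gamma> i + e \<gamma> j) \<in> Fgen \<gamma>"
        unfolding F_add[OF gP e_mem[OF gP ij(1)] e_mem[OF gP ij(2)] S] using ij by (intro mcl Fgen_F)
      then show ?thesis using 3 by simp
    next
      case 4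
      then have p: "(\<gamma>, J) \<in> zidx" using gam J by (auto simp: zidx_def fam_def)
      let ?q = "Q \<gamma> (sorted_list_of_set J) 1"
      have q: "?q \<in> Fgen \<gamma>" by (rule lprod_in_subgroup[OF sub]) (use JI fin Fgen_F in auto)
      then have "?q \<in> carrier G" using subgroup.mem_carrier[OF sub] by blast
      then have "F \<gamma> (\<Sum>j\<in>J. e \<gamma> j) = z (\<gamma>, J) \<otimes> ?q" using gP J(2) by (simp add: z_def m_assoc)
      then show ?thesis using mcl[OF _ q] z_A[OF p] Fgen_A by auto
    qed
    then show ?thesis using J(2) by (simp add: Y_def)
  qed
  obtain m :: "nat \<Rightarrow> int" where m: "v = (\<Sum>j\<in>I. of_int (m j) *\<^sub>R e \<gamma> j)" using e_span[OF gam v] by blast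
  \<comment> \<open>Steps by twice a basis shift leave only the parities of the coefficients in \<open>D\<close>.\<close>
  define J where "J = {j \<in> D \<gamma>. odd (m j)}"
  define k' where "k' j = (if j \<in> D \<gamma> then m j div 2 else m j)" for j
  have JI: "J \<subseteq> I" using D_sub by (auto simp: J_def)
  have "(\<Sum>j\<in>J. e \<gamma> j) + (\<Sum>j\<in>I. of_int (k' j) *\<^sub>R u j)
      = (\<Sum>j\<in>I. (if j \<in> J then e \<gamma> j else 0) + of_int (k' j) *\<^sub>R u j)"
    using JI by (simp add: sum.distrib sum.inter_restrict[symmetric] Int_absorb1)
  also have "\<dots> = v"
    unfolding m
  proof (rule sum.cong)
    fix j assume "j \<in> I"
    show "(if j \<in> J then e \<gamma> j else 0) + of_int (k' j) *\<^sub>R u j = of_int (m j) *\<^sub>R e \<gamma> j"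
    proof (cases "odd (m j)")
      case True
      then obtain i where "m j = 2 * i + 1" by (rule oddE)
      then show ?thesis by (auto simp: J_def k'_def u_def algebra_simps)
    next
      case False
      then obtain i where "m j = 2 * i" by blast
      then show ?thesis by (auto simp: J_def k'_def u_def algebra_simps)
    qed
  qed simp
  finally have v_eq: "v = (\<Sum>j\<in>J. e \<gamma> j) + (\<Sum>j\<in>I. of_int (k' j) *\<^sub>R u j)" by simp
  have "v + (\<Sum>j\<in>I. of_int (- k' j) *\<^sub>R u j) \<in> S \<gamma>"
    by (rule closed_add_combination[OF _ v]) (use S_u in auto)
  then have "(\<Sum>j\<in>J. e \<gamma> j) \<in> S \<gamma>" unfolding v_eq by (simp add: sum_negf)
  then have "(\<Sum>j\<in>J. e \<gamma> j) \<in> Y" by (rule base[rotated]) (auto simp: J_def)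
  then have "(\<Sum>j\<in>J. e \<gamma> j) + (\<Sum>j\<in>I. of_int (k' j) *\<^sub>R u j) \<in> Y"
    by (rule closed_add_combination[rotated]) (use Y_u in auto)
  then have "v \<in> Y" by (simp only: v_eq[symmetric])
  then show ?thesis by (simp add: Y_def)
qed

lemma A_conj: "a \<in> A \<Longrightarrow> y \<in> carrier G \<Longrightarrow> y \<otimes> (a \<otimes> inv y) = a"
  using center_conj[of a y] A_center center_carrier[of a] by (auto simp: m_assoc)

text \<open>Simple reflections fix \<open>A\<close> and carry the lifts for one root to the lifts for another.\<close>

lemma F_Fgen:
  assumes "\<gamma> \<in> \<Phi>" "v \<in> S \<gamma>"
  shows "F \<gamma> v \<in> Fgen \<gamma>"
  using assms
proof (induction arbitrary: v rule: orbit_induct)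
  case (rep \<beta>) then show ?case using F_Fgen_rep by blast
next
  case (step \<beta> i)
  let ?y = "s (b i) 0" and ?r = "r (b i) \<beta>"
  have bi: "b i \<in> \<Phi>" using b_in step by blast
  have v: "v \<in> S \<beta>" using S_r[OF bi step(1)] step(4) by simp
  have "?y \<otimes> (F \<beta> v \<otimes> inv ?y) \<in> Fgen ?r"
  proof (rule generate_conj)
    show "subgroup (Fgen ?r) G" using Fgen_subgroup bi step(1) by simp
    show "F \<beta> v \<in> generate G (A \<union> (\<lambda>j. F \<beta> (e \<beta> j)) ` I)"
      using step(3)[OF v] by (simp add: Fgen_def)
    show "A \<union> (\<lambda>j. F \<beta> (e \<beta> j)) ` I \<subseteq> carrier G" by (rule Fgen_base[OF step(1)])
    fix h assume "h \<in> A \<union> (\<lambda>j. F \<beta> (e \<beta> j)) ` I"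
    then show "?y \<otimes> (h \<otimes> inv ?y) \<in> Fgen ?r"
    proof
      assume "h \<in> A"
      then show ?thesis using A_conj[of h ?y] bi Fgen_A by auto
    next
      assume "h \<in> (\<lambda>j. F \<beta> (e \<beta> j)) ` I"
      then obtain j where j: "j \<in> I" "h = F \<beta> (e \<beta> j)" by blast
      have "?y \<otimes> (h \<otimes> inv ?y) = F ?r (e ?r j)"
        using F_r[OF bi step(1)] e_r[OF bi step(1)] j step(1) bi by simp
      then show ?thesis using Fgen_F[OF j(1)] by simp
    qed
  qed (use bi in simp)
  then show ?case using F_r[OF bi step(1) v] bi by simp
qed

definition T :: "'a set" where
  "T = generate G (A \<union> (\<lambda>(i, j). F (b i) (e (b i) j)) ` ({1..l} \<times> I))"

lemma T_base: "A \<union> (\<lambda>(i, j). F (b i) (e (b i) j)) ` ({1..l} \<times> I) \<subseteq> carrier G"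
  using A_center center_carrier b_in by auto

lemma T_subgroup: "subgroup T G"
  unfolding T_def by (rule generate_is_subgroup[OF T_base])

lemma F_simple_T: "i \<in> {1..l} \<Longrightarrow> v \<in> S (b i) \<Longrightarrow> F (b i) v \<in> T"
  using F_Fgen[OF b_in, of i v]
    mono_generate[of "A \<union> (\<lambda>j. F (b i) (e (b i) j)) ` I"
      "A \<union> (\<lambda>(i, j). F (b i) (e (b i) j)) ` ({1..l} \<times> I)"]
  by (fastforce simp: T_def Fgen_def)

text \<open>
  The reflected root need not be simple, but \<open>F_decompose\<close> expresses its lift by those of two simple
  roots.
\<close>

lemma T_conj_simple:
  assumes j: "j \<in> {1..l}" and x: "x \<in> T"
  shows "s (b j) 0 \<otimes> (x \<otimes> inv (s (b j) 0)) \<in> T"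
proof (rule generate_conj[OF T_subgroup _ T_base _ x[unfolded T_def]])
  have bj: "b j \<in> \<Phi>" using j b_in by blast
  then show y: "s (b j) 0 \<in> carrier G" by simp
  fix h assume "h \<in> A \<union> (\<lambda>(i, j). F (b i) (e (b i) j)) ` ({1..l} \<times> I)"
  then show "s (b j) 0 \<otimes> (h \<otimes> inv (s (b j) 0)) \<in> T"
  proof
    assume "h \<in> A"
    then show ?thesis using A_conj[OF _ y] T_def by (auto intro: generate.incl)
  next
    assume "h \<in> (\<lambda>(i, j). F (b i) (e (b i) j)) ` ({1..l} \<times> I)"
    then obtain i m where i: "i \<in> {1..l}" "m \<in> I" "h = F (b i) (e (b i) m)" by auto
    define \<eta> where "\<eta> = of_int (n (b j) (b i)) *\<^sub>R e (b i) m"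
    have bi: "b i \<in> \<Phi>" and em: "e (b i) m \<in> S (b i)" using i b_in by auto
    have \<eta>: "\<eta> \<in> S (b j)" unfolding \<eta>_def by (rule S_plus_n[OF bi bj em])
    have Fr: "F (r (b j) (b i)) (e (b i) m) \<in> carrier G" using bi bj em S_r[OF bj bi] by simp
    have "h = F (b j) \<eta> \<otimes> F (r (b j) (b i)) (e (b i) m)"
      unfolding i(3) \<eta>_def by (rule F_decompose[OF bj bi em])
    then have "F (r (b j) (b i)) (e (b i) m) = inv (F (b j) \<eta>) \<otimes> h"
      using Fr F_closed[OF bj \<eta>] by simp
    moreover have "s (b j) 0 \<otimes> (h \<otimes> inv (s (b j) 0)) = F (r (b j) (b i)) (e (b i) m)"
      using F_r[OF bj bi em] bj i(3) by simp
    moreover have "h \<in> T" unfolding i(3) by (rule F_simple_T[OF i(1) em])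
    moreover have "F (b j) \<eta> \<in> T" by (rule F_simple_T[OF j \<eta>])
    ultimately show ?thesis
      using subgroup.m_closed[OF T_subgroup] subgroup.m_inv_closed[OF T_subgroup] by simp
  qed
qed

lemma F_T:
  assumes "\<gamma> \<in> \<Phi>" "v \<in> S \<gamma>"
  shows "F \<gamma> v \<in> T"
  using assms
proof (induction arbitrary: v rule: orbit_induct)
  case (rep \<beta>) then show ?case using F_simple_T reps by blast
next
  case (step \<beta> i)
  have bi: "b i \<in> \<Phi>" using b_in step by blast
  have v: "v \<in> S \<beta>" using S_r[OF bi step(1)] step(4) by simp
  show ?case using T_conj_simple[OF step(2) step(3)[OF v]] F_r[OF bi step(1) v] bi by simp
qed

definition wd :: "nat list \<Rightarrow> 'a" where
  "wd is = foldr (\<lambda>i x. s (b i) 0 \<otimes> x) is \<one>"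

lemma wd_simps [simp]: "wd [] = \<one>" "wd (i # is) = s (b i) 0 \<otimes> wd is"
  by (simp_all add: wd_def)

lemma wd_closed [simp]: "set is \<subseteq> {1..l} \<Longrightarrow> wd is \<in> carrier G"
  by (induction "is") (use b_in in auto)

lemma wd_append:
  "set is \<subseteq> {1..l} \<Longrightarrow> set js \<subseteq> {1..l} \<Longrightarrow> wd (is @ js) = wd is \<otimes> wd js"
  by (induction "is") (use b_in in \<open>auto simp: m_assoc\<close>)

lemma T_conj_wd:
  assumes "set is \<subseteq> {1..l}" "x \<in> T"
  shows "wd is \<otimes> (x \<otimes> inv (wd is)) \<in> T"
  using assms(1)
proof (induction "is")
  case Nil
  then show ?case using assms(2) subgroup.mem_carrier[OF T_subgroup] by simp
next
  case (Cons i "is")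
  have c: "s (b i) 0 \<in> carrier G" "wd is \<in> carrier G" "x \<in> carrier G"
    using Cons.prems b_in assms(2) subgroup.mem_carrier[OF T_subgroup] by auto
  have "wd (i # is) \<otimes> (x \<otimes> inv (wd (i # is)))
      = s (b i) 0 \<otimes> ((wd is \<otimes> (x \<otimes> inv (wd is))) \<otimes> inv (s (b i) 0))"
    using c unfolding wd_simps by (simp only: inv_mult_group m_assoc inv_closed m_closed)
  then show ?case using T_conj_simple[of i] Cons by simp
qed

lemma s_wd: "\<gamma> \<in> \<Phi> \<Longrightarrow> \<exists>is. set is \<subseteq> {1..l} \<and> s \<gamma> 0 = wd is"
proof (induction rule: orbit_induct)
  case (rep \<beta>)
  then obtain i where "i \<in> {1..l}" "\<beta> = b i" using reps by auto
  then show ?case using b_in by (intro exI[of _ "[i]"]) simp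
next
  case (step \<beta> i)
  then obtain "is" where w: "set is \<subseteq> {1..l}" "s \<beta> 0 = wd is" by blast
  have bi: "b i \<in> \<Phi>" using b_in step by blast
  have "s (r (b i) \<beta>) 0 = wd (i # is @ [i])"
    using s_conj[OF bi step(1), of 0 0] bi step(1,2) w wd_append[OF w(1), of "[i]"] by simp
  then show ?case using w step(2) by (intro exI[of _ "i # is @ [i]"]) simp
qed

text \<open>
  The subgroup \<open>T\<close> is normalized by the simple reflections, and together they produce every
  generator; collecting in \<open>T\<close> modulo its central part gives a normal form.
\<close>

lemma T_wd:
  assumes "x \<in> carrier G"
  shows "\<exists>y\<in>T. \<exists>is. set is \<subseteq> {1..l} \<and> x = y \<otimes> wd is"
proof -
  let ?X = "{s \<alpha> \<sigma> | \<alpha> \<sigma>. \<alpha> \<in> \<Phi> \<and> \<sigma> \<in> S \<alpha>}"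
  define M where "M = {y \<otimes> wd is | y is. y \<in> T \<and> set is \<subseteq> {1..l}}"
  have Tc: "y \<in> carrier G" if "y \<in> T" for y using that by (rule subgroup.mem_carrier[OF T_subgroup])
  have Mc: "M \<subseteq> carrier G" using Tc by (auto simp: M_def)
  have gen: "s \<alpha> \<delta> \<otimes> y \<in> M" if a: "\<alpha> \<in> \<Phi>" "\<delta> \<in> S \<alpha>" and y: "y \<in> M" for \<alpha> \<delta> y
  proof -
    obtain y' "is" where y': "y' \<in> T" "set is \<subseteq> {1..l}" "y = y' \<otimes> wd is" using y unfolding M_def by blast
    obtain js where js: "set js \<subseteq> {1..l}" "s \<alpha> 0 = wd js" using s_wd[OF a(1)] by blast
    define t' where "t' = wd js \<otimes> (y' \<otimes> inv (wd js))"
    have t': "t' \<in> T" unfolding t'_def by (rule T_conj_wd[OF js(1) y'(1)])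
    have "s \<alpha> \<delta> \<otimes> y = (F \<alpha> \<delta> \<otimes> t') \<otimes> wd (js @ is)"
      using y' js Tc a by (simp add: s_eq_F[OF a] t'_def wd_append m_assoc)
    moreover have "F \<alpha> \<delta> \<otimes> t' \<in> T" using subgroup.m_closed[OF T_subgroup F_T[OF a] t'] .
    moreover have "set (js @ is) \<subseteq> {1..l}" using js(1) y'(2) by simp
    ultimately show ?thesis unfolding M_def by blast
  qed
  have "x \<in> generate G ?X" using assms generated by simp
  then have "\<forall>y\<in>M. x \<otimes> y \<in> M"
  proof induction
    case one then show ?case using Mc by auto
  next
    case (incl h) then show ?case using gen by blast
  next
    case (inv h)
    then obtain \<alpha> \<delta> where "\<alpha> \<in> \<Phi>" "\<delta> \<in> S \<alpha>" "h = s \<alpha> \<delta>" by blast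
    then show ?case using gen by simp
  next
    case (eng h1 h2)
    have "h1 \<in> carrier G" "h2 \<in> carrier G"
      using eng.hyps by (simp_all only: generated)
    then show ?case using eng.IH Mc m_assoc by (metis subsetD)
  qed
  moreover have "\<one> \<otimes> wd [] \<in> M" unfolding M_def using subgroup.one_closed[OF T_subgroup]
    by (intro CollectI exI[of _ \<one>] exI[of _ "[]"]) simp
  ultimately have "x \<otimes> \<one> \<in> M" by simp
  then show ?thesis using assms unfolding M_def by auto
qed

definition fidx :: "(nat \<times> nat) list" where
  "fidx = List.product [1..<Suc l] [1..<Suc \<nu>]"

lemma set_fidx: "set fidx = {1..l} \<times> I" and distinct_fidx: "distinct fidx"
  by (auto simp: fidx_def intro!: distinct_product)

abbreviation Fprod :: "(nat \<times> nat \<Rightarrow> int) \<Rightarrow> 'a" where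
  "Fprod \<equiv> lprod (\<lambda>p. F (b (fst p)) (e (b (fst p)) (snd p))) fidx"

theorem normal_form:
  assumes "x \<in> carrier G"
  shows "\<exists>a\<in>A. \<exists>m is. set is \<subseteq> {1..l} \<and> x = a \<otimes> Fprod m \<otimes> wd is"
proof -
  let ?f = "\<lambda>p. F (b (fst p)) (e (b (fst p)) (snd p))"
  obtain y "is" where y: "y \<in> T" "set is \<subseteq> {1..l}" "x = y \<otimes> wd is" using T_wd[OF assms] by blast
  have "(\<lambda>(i, j). F (b i) (e (b i) j)) = ?f" by auto
  then have yT: "y \<in> generate G (A \<union> ?f ` set fidx)" using y(1) by (simp add: T_def set_fidx)
  have "\<exists>a\<in>A. \<exists>m. y = a \<otimes> Fprod m"
  proof (rule generate_collect[OF A_subgroup A_center _ _ distinct_fidx yT])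
    show "?f ` set fidx \<subseteq> carrier G" using b_in by (auto simp: set_fidx)
    fix p q assume "p \<in> set fidx" "q \<in> set fidx"
    then show "cmt (?f p) (?f q) \<in> A"
      using A0_A b_in by (auto simp: set_fidx intro!: subsetD[OF A0_A] cmt_F_A0)
  qed
  then show ?thesis using y by blast
qed

end

section \<open>Words in simple reflections\<close>

context affine_reflection_group
begin

abbreviation act :: "nat list \<Rightarrow> 'v \<Rightarrow> 'v" where
  "act is \<beta> \<equiv> foldr (\<lambda>i. r (b i)) is \<beta>"

lemma act_in: "set is \<subseteq> {1..l} \<Longrightarrow> \<beta> \<in> \<Phi> \<Longrightarrow> act is \<beta> \<in> \<Phi>"
  by (induction "is") (use b_in in auto)

lemma wd_conj:
  assumes "set is \<subseteq> {1..l}" "\<beta> \<in> \<Phi>"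
  shows "wd is \<otimes> s \<beta> 0 = s (act is \<beta>) 0 \<otimes> wd is"
  using assms(1)
proof (induction "is")
  case Nil then show ?case using assms(2) by simp
next
  case (Cons i "is")
  have i: "b i \<in> \<Phi>" "set is \<subseteq> {1..l}" using Cons.prems b_in by auto
  let ?\<gamma> = "act is \<beta>"
  have g: "?\<gamma> \<in> \<Phi>" using act_in i assms(2) by blast
  have "s (r (b i) ?\<gamma>) 0 = s (b i) 0 \<otimes> (s ?\<gamma> 0 \<otimes> s (b i) 0)"
    using s_conj[OF i(1) g, of 0 0] i g by simp
  then have "s (r (b i) ?\<gamma>) 0 \<otimes> (s (b i) 0 \<otimes> wd is) = s (b i) 0 \<otimes> (s ?\<gamma> 0 \<otimes> wd is)"
    using i g by (simp add: m_assoc)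
  then show ?case using Cons.IH[OF i(2)] i g assms(2) by (simp add: m_assoc)
qed

text \<open>
  The conjugation relations turn a change of sign of a root under a word directly into
  the removal of two letters, so a word acting trivially collapses to the identity.
\<close>

lemma wd_trivial:
  fixes P :: "'v \<Rightarrow> bool"
  assumes P_b: "\<And>i. i \<in> {1..l} \<Longrightarrow> P (b i)" "\<And>i. i \<in> {1..l} \<Longrightarrow> \<not> P (- b i)"
    and P_r: "\<And>i \<beta>. i \<in> {1..l} \<Longrightarrow> \<beta> \<in> \<Phi> \<Longrightarrow> P \<beta> \<Longrightarrow> \<beta> \<noteq> b i \<Longrightarrow> P (r (b i) \<beta>)"
    and r_minus: "\<And>\<alpha> \<beta>. \<alpha> \<in> \<Phi> \<Longrightarrow> \<beta> \<in> \<Phi> \<Longrightarrow> r \<alpha> (- \<beta>) = - r \<alpha> \<beta>"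
    and r_r: "\<And>\<alpha> \<beta> \<gamma>. \<alpha> \<in> \<Phi> \<Longrightarrow> \<beta> \<in> \<Phi> \<Longrightarrow> \<gamma> \<in> \<Phi> \<Longrightarrow> r (r \<alpha> \<beta>) (r \<alpha> \<gamma>) = r \<alpha> (r \<beta> \<gamma>)"
    and w: "set is \<subseteq> {1..l}" "\<And>j. j \<in> {1..l} \<Longrightarrow> act is (b j) = b j"
  shows "wd is = \<one>"
  using w
proof (induction "is" rule: length_induct)
  case (1 "is")
  show ?case
  proof (cases "is" rule: rev_cases)
    case Nil then show ?thesis by simp
  next
    case (snoc js j)
    have js: "set js \<subseteq> {1..l}" and j: "j \<in> {1..l}" and bj: "b j \<in> \<Phi>"
      using "1.prems"(1) snoc b_in by auto
    have minus: "act ks (- \<beta>) = - act ks \<beta>" if "set ks \<subseteq> {1..l}" "\<beta> \<in> \<Phi>" for ks \<beta>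
      using that(1) by (induction ks) (use b_in act_in that(2) r_minus in auto)
    have act_r: "act ks (r \<beta> \<gamma>) = r (act ks \<beta>) (act ks \<gamma>)"
      if "set ks \<subseteq> {1..l}" "\<beta> \<in> \<Phi>" "\<gamma> \<in> \<Phi>" for ks \<beta> \<gamma>
      using that(1) by (induction ks) (use b_in act_in that(2,3) r_r in auto)
    have "b j = act js (- b j)" using "1.prems"(2)[OF j] snoc r_self[OF bj] by simp
    then have "act js (b j) = - b j" using minus[OF js bj] by (metis minus_minus)
    then have "\<not> P (act js (b j))" using P_b(2)[OF j] by simp
    then have "\<exists>u i v. js = u @ i # v \<and> P (act v (b j)) \<and> \<not> P (act (i # v) (b j))"
    proof (induction js)
      case Nil then show ?case using P_b(1)[OF j] by simp
    next
      case (Cons a js)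
      show ?case
      proof (cases "P (act js (b j))")
        case True then show ?thesis using Cons.prems by (intro exI[of _ "[]"]) auto
      next
        case False
        then obtain u i v where "js = u @ i # v" "P (act v (b j))" "\<not> P (act (i # v) (b j))"
          using Cons.IH by blast
        then show ?thesis by (intro exI[of _ "a # u"]) auto
      qed
    qed
    then obtain u i v where uv: "js = u @ i # v" "P (act v (b j))" "\<not> P (act (i # v) (b j))"
      by blast
    have mem: "set u \<subseteq> {1..l}" "i \<in> {1..l}" "set v \<subseteq> {1..l}" using js uv(1) by auto
    have vj: "act v (b j) = b i"
      using P_r[OF mem(2) act_in[OF mem(3) bj] uv(2)] uv(3) by auto
    have "wd v \<otimes> s (b j) 0 = s (b i) 0 \<otimes> wd v" using wd_conj[OF mem(3) bj] vj by simp
    then have "wd is = wd (u @ v)"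
      using mem j b_in by (simp add: snoc uv(1) wd_append m_assoc)
    moreover have "act is \<beta> = act (u @ v) \<beta>" if "\<beta> \<in> \<Phi>" for \<beta>
      using act_r[OF mem(3) bj that] act_in[OF mem(3) that] b_in[OF mem(2)]
      by (simp add: snoc uv(1) vj)
    ultimately show ?thesis
      using "1.IH" "1.prems"(2) mem b_in snoc uv(1) by auto
  qed
qed

end

section \<open>Root systems with a base of given Cartan type\<close>

fun type_int :: "nsl_type \<Rightarrow> int" where
  "type_int TypeG2 = 3"
| "type_int _ = 2"

lemma type_k_int: "type_k X = of_int (type_int X)"
  by (cases X) auto

fun short_node :: "nsl_type \<Rightarrow> nat" where
  "short_node (TypeB l) = l"
| "short_node (TypeC l) = l - 1"
| "short_node TypeF4 = 3"
| "short_node TypeG2 = 1"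

fun long_node :: "nsl_type \<Rightarrow> nat" where
  "long_node (TypeB l) = l - 1"
| "long_node (TypeC l) = l"
| "long_node TypeF4 = 2"
| "long_node TypeG2 = 2"

locale based_roots =
  fixes X :: nsl_type and B :: "'v::real_vector \<Rightarrow> 'v \<Rightarrow> real" and Vd Rd :: "'v set"
    and b :: "nat \<Rightarrow> 'v" and l :: nat and k :: int
  defines "l \<equiv> type_rank X" and "k \<equiv> type_int X"
  assumes adm: "admissible X" and bil: "bilinear B" and sym: "\<And>u v. B u v = B v u"
    and roots: "finite_root_system B Vd Rd" and base: "root_base Rd l b"
    and cartan: "\<And>i j. i \<in> {1..l} \<Longrightarrow> j \<in> {1..l} \<Longrightarrow>
      2 * B (b i) (b j) / B (b j) (b j) = of_int (cartan_entry X i j)"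
begin

abbreviation "\<Phi> \<equiv> Rd - {0}"
abbreviation "r \<equiv> reflection B"

text \<open>The quotient is integral for roots, so the floor only changes the type.\<close>

definition n :: "'v \<Rightarrow> 'v \<Rightarrow> int" where
  "n \<beta> \<alpha> = \<lfloor>2 * B \<beta> \<alpha> / B \<alpha> \<alpha>\<rfloor>"

lemma norm_pos: "\<alpha> \<in> \<Phi> \<Longrightarrow> 0 < B \<alpha> \<alpha>"
  using roots by (simp add: finite_root_system_def)

lemma of_int_n: "\<alpha> \<in> \<Phi> \<Longrightarrow> \<beta> \<in> \<Phi> \<Longrightarrow> of_int (n \<beta> \<alpha>) = 2 * B \<beta> \<alpha> / B \<alpha> \<alpha>"
  using roots unfolding finite_root_system_def n_def by (metis DiffD1 Ints_cases floor_of_int)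

lemma B_n: "\<alpha> \<in> \<Phi> \<Longrightarrow> \<beta> \<in> \<Phi> \<Longrightarrow> 2 * B \<beta> \<alpha> = of_int (n \<beta> \<alpha>) * B \<alpha> \<alpha>"
  using of_int_n[of \<alpha> \<beta>] norm_pos[of \<alpha>] by (simp add: field_simps)

lemma r_eq: "\<alpha> \<in> \<Phi> \<Longrightarrow> \<beta> \<in> \<Phi> \<Longrightarrow> r \<alpha> \<beta> = \<beta> - of_int (n \<beta> \<alpha>) *\<^sub>R \<alpha>"
  by (simp add: reflection_alt[OF bil] of_int_n)

lemma refl:
  assumes "\<alpha> \<in> \<Phi>"
  shows "r \<alpha> (r \<alpha> u) = u" "B (r \<alpha> u) (r \<alpha> v) = B u v"
    "r \<alpha> (r \<beta> (r \<alpha> u)) = r (r \<alpha> \<beta>) u" "r \<alpha> (u + v) = r \<alpha> u + r \<alpha> v" "r \<alpha> (c *\<^sub>R u) = c *\<^sub>R r \<alpha> u"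
  using reflection_conj[OF bil sym, of \<alpha>] norm_pos[OF assms] by auto

lemma r_minus: "\<alpha> \<in> \<Phi> \<Longrightarrow> r \<alpha> (- u) = - r \<alpha> u"
  using refl(5)[of \<alpha> "- 1" u] by simp

lemma r_zero: "r \<alpha> 0 = 0"
  by (simp add: reflection_alt[OF bil] bilinear_lzero[OF bil])

lemma r_in: "\<alpha> \<in> \<Phi> \<Longrightarrow> \<beta> \<in> \<Phi> \<Longrightarrow> r \<alpha> \<beta> \<in> \<Phi>"
  using roots refl(1)[of \<alpha> \<beta>] r_zero unfolding finite_root_system_def by fastforce

lemma n_self: "\<alpha> \<in> \<Phi> \<Longrightarrow> n \<alpha> \<alpha> = 2"
  using norm_pos[of \<alpha>] by (simp add: n_def)

lemma r_self: "\<alpha> \<in> \<Phi> \<Longrightarrow> r \<alpha> \<alpha> = - \<alpha>"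
  by (simp add: r_eq n_self scaleR_2)

lemma n_r: "\<alpha> \<in> \<Phi> \<Longrightarrow> n (r \<alpha> \<beta>) (r \<alpha> \<gamma>) = n \<beta> \<gamma>"
  by (simp add: n_def refl)

lemma n_r': "\<alpha> \<in> \<Phi> \<Longrightarrow> n (r \<alpha> \<beta>) \<gamma> = n \<beta> (r \<alpha> \<gamma>)"
  using n_r[of \<alpha> \<beta> "r \<alpha> \<gamma>"] refl(1) by simp

lemma neg_in: "\<alpha> \<in> \<Phi> \<Longrightarrow> - \<alpha> \<in> \<Phi>"
  using r_in[of \<alpha> \<alpha>] r_self[of \<alpha>] by simp

lemma n_minus_right: "\<alpha> \<in> \<Phi> \<Longrightarrow> \<beta> \<in> \<Phi> \<Longrightarrow> n \<beta> (- \<alpha>) = - n \<beta> \<alpha>"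
proof -
  assume a: "\<alpha> \<in> \<Phi>" "\<beta> \<in> \<Phi>"
  have "real_of_int (n \<beta> (- \<alpha>)) = - real_of_int (n \<beta> \<alpha>)"
    using of_int_n[of "- \<alpha>" \<beta>] of_int_n[of \<alpha> \<beta>] a neg_in
    by (simp add: bilinear_rneg[OF bil] bilinear_lneg[OF bil])
  then show ?thesis by linarith
qed

lemma n_refl: "\<alpha> \<in> \<Phi> \<Longrightarrow> \<beta> \<in> \<Phi> \<Longrightarrow> n (r \<alpha> \<beta>) \<alpha> = - n \<beta> \<alpha>"
  using n_r'[of \<alpha> \<beta> \<alpha>] r_self[of \<alpha>] n_minus_right[of \<alpha> \<beta>] by simp

lemma n_r_left:
  assumes "\<alpha> \<in> \<Phi>" "\<beta> \<in> \<Phi>" "\<gamma> \<in> \<Phi>"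
  shows "n (r \<alpha> \<beta>) \<gamma> = n \<beta> \<gamma> - n \<beta> \<alpha> * n \<alpha> \<gamma>"
proof -
  have "real_of_int (n (r \<alpha> \<beta>) \<gamma>) = real_of_int (n \<beta> \<gamma> - n \<beta> \<alpha> * n \<alpha> \<gamma>)"
    using assms r_in
    by (simp add: of_int_n[of \<gamma>] r_eq bilinear_lsub[OF bil] bilinear_lmul[OF bil]
        diff_divide_distrib right_diff_distrib)
  then show ?thesis by linarith
qed

lemma b_in: "i \<in> {1..l} \<Longrightarrow> b i \<in> \<Phi>"
  using base unfolding root_base_def by blast

lemma n_b: "i \<in> {1..l} \<Longrightarrow> j \<in> {1..l} \<Longrightarrow> n (b i) (b j) = cartan_entry X i j"
  using cartan[of i j] by (simp add: n_def)

lemma base_independent: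
  fixes c :: "nat \<Rightarrow> real"
  assumes "(\<Sum>i\<in>{1..l}. c i *\<^sub>R b i) = 0" "i \<in> {1..l}"
  shows "c i = 0"
proof -
  have inj: "inj_on b {1..l}" and ind: "independent (b ` {1..l})"
    using base by (auto simp: root_base_def)
  have "(\<Sum>v\<in>b ` {1..l}. c (inv_into {1..l} b v) *\<^sub>R v) = (\<Sum>i\<in>{1..l}. c i *\<^sub>R b i)"
    unfolding sum.reindex[OF inj] by (rule sum.cong) (simp_all only: o_def inv_into_f_f[OF inj])
  then have "c (inv_into {1..l} b (b i)) = 0"
    using independentD[OF ind, of "b ` {1..l}" "\<lambda>v. c (inv_into {1..l} b v)" "b i"] assms by auto
  then show ?thesis using inv_into_f_f[OF inj assms(2)] by simp
qed

definition pos :: "'v \<Rightarrow> bool" where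
  "pos \<beta> \<longleftrightarrow> (\<exists>c :: nat \<Rightarrow> nat. \<beta> = (\<Sum>i\<in>{1..l}. of_nat (c i) *\<^sub>R b i))"

lemma pos_or_neg: "\<beta> \<in> \<Phi> \<Longrightarrow> pos \<beta> \<or> pos (- \<beta>)"
  using base unfolding root_base_def pos_def by (metis DiffD1 minus_minus)

lemma b_sum: "i \<in> {1..l} \<Longrightarrow> (\<Sum>j\<in>{1..l}. (if j = i then m else 0) *\<^sub>R b j) = m *\<^sub>R b i"
proof -
  assume i: "i \<in> {1..l}"
  have "(\<Sum>j\<in>{1..l}. (if j = i then m else 0) *\<^sub>R b j) = (\<Sum>j\<in>{1..l}. if j = i then m *\<^sub>R b j else 0)"
    by (rule sum.cong) auto
  then show ?thesis using i by simp
qed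

lemma pos_b: "i \<in> {1..l} \<Longrightarrow> pos (b i)"
  unfolding pos_def using b_sum[of i 1]
  by (intro exI[of _ "\<lambda>j. if j = i then 1 else 0"]) (simp add: if_distrib[of real] cong: if_cong)

lemma pos_not_neg:
  assumes "\<beta> \<in> \<Phi>" "pos \<beta>" shows "\<not> pos (- \<beta>)"
proof
  assume "pos (- \<beta>)"
  then obtain c d :: "nat \<Rightarrow> nat" where c: "\<beta> = (\<Sum>i\<in>{1..l}. of_nat (c i) *\<^sub>R b i)"
    and d: "- \<beta> = (\<Sum>i\<in>{1..l}. of_nat (d i) *\<^sub>R b i)"
    using assms(2) by (auto simp: pos_def)
  have "(\<Sum>i\<in>{1..l}. (of_nat (c i) + of_nat (d i)) *\<^sub>R b i) = \<beta> + - \<beta>"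
    unfolding c[symmetric] d by (simp add: c scaleR_left_distrib sum.distrib)
  then have "real (c i) + real (d i) = 0" if "i \<in> {1..l}" for i
    using base_independent[of "\<lambda>i. of_nat (c i) + of_nat (d i)"] that by simp
  then have "c i = 0" if "i \<in> {1..l}" for i using that by fastforce
  then have "\<beta> = 0" unfolding c by simp
  then show False using assms(1) by simp
qed

text \<open>A simple reflection changes only one coefficient, so it cannot make another root negative.\<close>

lemma pos_r:
  assumes i: "i \<in> {1..l}" and bt: "\<beta> \<in> \<Phi>" "pos \<beta>" "\<beta> \<noteq> b i"
  shows "pos (r (b i) \<beta>)"
proof (rule ccontr)
  assume "\<not> pos (r (b i) \<beta>)"
  moreover have rP: "r (b i) \<beta> \<in> \<Phi>" using r_in b_in i bt by blast
  ultimately have "pos (- r (b i) \<beta>)" using pos_or_neg by blast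
  then obtain c d :: "nat \<Rightarrow> nat" where c: "\<beta> = (\<Sum>i\<in>{1..l}. of_nat (c i) *\<^sub>R b i)"
    and d: "- r (b i) \<beta> = (\<Sum>i\<in>{1..l}. of_nat (d i) *\<^sub>R b i)"
    using bt(2) by (auto simp: pos_def)
  \<comment> \<open>Away from \<open>i\<close> the coefficients of the root and of its reflection agree.\<close>
  define m where "m = real_of_int (n \<beta> (b i))"
  have "(\<Sum>j\<in>{1..l}. (of_nat (c j) + of_nat (d j) - (if j = i then m else 0)) *\<^sub>R b j)
      = (\<beta> + - r (b i) \<beta>) - (\<Sum>j\<in>{1..l}. (if j = i then m else 0) *\<^sub>R b j)"
    unfolding d by (subst c) (simp add: scaleR_left_distrib scaleR_left_diff_distrib sum.distrib sum_subtractf)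
  also have "(\<Sum>j\<in>{1..l}. (if j = i then m else 0) *\<^sub>R b j) = m *\<^sub>R b i" by (rule b_sum[OF i])
  also have "\<beta> + - r (b i) \<beta> = m *\<^sub>R b i"
    using r_eq[OF b_in[OF i] bt(1)] by (simp add: m_def)
  finally have z: "(\<Sum>j\<in>{1..l}. (of_nat (c j) + of_nat (d j) - (if j = i then m else 0)) *\<^sub>R b j) = 0"
    by simp
  have "c j = 0" if "j \<in> {1..l}" "j \<noteq> i" for j
    using base_independent[OF z that(1)] that(2) by simp
  then have "\<beta> = (\<Sum>j\<in>{1..l}. (if j = i then real (c i) else 0) *\<^sub>R b j)"
    by (subst c) (rule sum.cong, auto)
  also have "\<dots> = real (c i) *\<^sub>R b i" by (rule b_sum[OF i])
  finally have e: "\<beta> = real (c i) *\<^sub>R b i" .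
  then have "real (c i) = 1 \<or> real (c i) = - 1"
    using roots b_in[OF i] bt(1) unfolding finite_root_system_def by blast
  then show False using e bt(3) by auto
qed

lemma orbit_trans:
  "\<beta> \<in> refl_orbit r b l \<gamma> \<Longrightarrow> \<gamma> \<in> refl_orbit r b l \<delta> \<Longrightarrow> \<beta> \<in> refl_orbit r b l \<delta>"
  by (induction rule: refl_orbit.induct) (auto intro: refl_orbit.intros)

lemma orbit_norm: "\<beta> \<in> refl_orbit r b l \<gamma> \<Longrightarrow> B \<beta> \<beta> = B \<gamma> \<gamma>"
  by (induction rule: refl_orbit.induct) (use refl(2) b_in in auto)

lemma root_in_orbit:
  assumes "\<beta> \<in> \<Phi>"
  shows "\<exists>j\<in>{1..l}. \<beta> \<in> refl_orbit r b l (b j)"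
proof -
  have pos_case: "\<exists>j\<in>{1..l}. \<beta> \<in> refl_orbit r b l (b j)"
    if "\<beta> \<in> \<Phi>" "\<beta> = (\<Sum>i\<in>{1..l}. of_nat (c i) *\<^sub>R b i)" for \<beta> and c :: "nat \<Rightarrow> nat"
    using that
  proof (induction "\<Sum>i\<in>{1..l}. c i" arbitrary: \<beta> c rule: less_induct)
    case less
    show ?case
    proof (cases "\<exists>i\<in>{1..l}. \<beta> = b i")
      case True then show ?thesis by (auto intro: refl_orbit.start)
    next
      case False
      \<comment> \<open>Some simple root has positive product with the root; reflecting in it lowers the height.\<close>
      have "\<exists>i\<in>{1..l}. 0 < B \<beta> (b i)"
      proof (rule ccontr)
        assume "\<not> ?thesis"
        then have "(\<Sum>i\<in>{1..l}. real (c i) * B \<beta> (b i)) \<le> 0"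
          by (intro sum_nonpos) (auto simp: not_less intro: mult_nonneg_nonpos)
        moreover have "B \<beta> \<beta> = (\<Sum>i\<in>{1..l}. real (c i) * B \<beta> (b i))"
          using bil by (subst (2) less.prems(2))
            (simp add: bilinear_def linear_sum linear_cmul)
        ultimately show False using norm_pos[OF less.prems(1)] by linarith
      qed
      then obtain i where i: "i \<in> {1..l}" "0 < B \<beta> (b i)" by blast
      let ?\<beta> = "r (b i) \<beta>" and ?m = "n \<beta> (b i)"
      have bi: "b i \<in> \<Phi>" using b_in i by blast
      have m: "0 < ?m" using i(2) of_int_n[OF bi less.prems(1)] norm_pos[OF bi]
        by (metis divide_pos_pos mult_pos_pos of_int_0_less_iff zero_less_numeral)
      have "pos ?\<beta>"
        using pos_r[OF i(1) less.prems(1)] less.prems(2) False i(1) by (auto simp: pos_def)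
      then obtain d :: "nat \<Rightarrow> nat" where d: "?\<beta> = (\<Sum>i\<in>{1..l}. of_nat (d i) *\<^sub>R b i)"
        by (auto simp: pos_def)
      have z: "(\<Sum>j\<in>{1..l}. (of_nat (c j) - of_nat (d j) - (if j = i then of_int ?m else 0)) *\<^sub>R b j) = 0"
      proof -
        have "(\<Sum>j\<in>{1..l}. (if j = i then of_int ?m else 0) *\<^sub>R b j) = of_int ?m *\<^sub>R b i"
          by (rule b_sum[OF i(1)])
        moreover have "(\<Sum>j\<in>{1..l}. of_nat (c j) *\<^sub>R b j) - (\<Sum>j\<in>{1..l}. of_nat (d j) *\<^sub>R b j) = of_int ?m *\<^sub>R b i"
          unfolding d[symmetric] less.prems(2)[symmetric] using r_eq[OF bi less.prems(1)] by simp
        ultimately show ?thesis by (simp add: scaleR_left_diff_distrib sum_subtractf)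
      qed
      have cd: "real (c j) = real (d j) + (if j = i then of_int ?m else 0)" if "j \<in> {1..l}" for j
        using base_independent[OF z that] by simp
      have "(\<Sum>i\<in>{1..l}. d i) < (\<Sum>i\<in>{1..l}. c i)"
      proof (rule sum_strict_mono_ex1)
        have "d j \<le> c j" if "j \<in> {1..l}" for j
        proof -
          have "real (d j) \<le> real (c j)" using cd[OF that] m by (auto split: if_splits)
          then show ?thesis by simp
        qed
        then show "\<forall>j\<in>{1..l}. d j \<le> c j" by blast
        have "real (d i) < real (c i)" using cd[OF i(1)] m by simp
        then show "\<exists>j\<in>{1..l}. d j < c j" using i(1) by auto
      qed simp
      then obtain j where "j \<in> {1..l}" "?\<beta> \<in> refl_orbit r b l (b j)"
        using less.hyps[OF _ r_in[OF bi less.prems(1)] d] by blast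
      then show ?thesis using refl_orbit.step[of ?\<beta> r b l "b j" i] i(1) refl(1)[OF bi] by auto
    qed
  qed
  have neg: "- \<beta> \<in> refl_orbit r b l (b j)" if "\<beta> \<in> refl_orbit r b l (b j)" "j \<in> {1..l}" for \<beta> j
    using that
  proof (induction rule: refl_orbit.induct)
    case start
    then have "r (b j) (b j) \<in> refl_orbit r b l (b j)"
      by (intro refl_orbit.step refl_orbit.start)
    then show ?case using start r_self[OF b_in] by simp
  next
    case (step \<beta> i)
    then show ?case using r_minus[OF b_in, of i \<beta>] refl_orbit.step by metis
  qed
  show ?thesis
    using pos_or_neg[OF assms]
  proof
    assume "pos \<beta>"
    then show ?thesis using pos_case[OF assms] unfolding pos_def by blast
  next
    assume "pos (- \<beta>)"
    then obtain j where "j \<in> {1..l}" "- \<beta> \<in> refl_orbit r b l (b j)"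
      using pos_case[OF neg_in[OF assms]] unfolding pos_def by blast
    then show ?thesis using neg[of "- \<beta>" j] by auto
  qed
qed

subsection \<open>Short and long roots\<close>

abbreviation "\<gamma>s \<equiv> b (short_node X)"
abbreviation "\<gamma>l \<equiv> b (long_node X)"

fun node_short :: "nsl_type \<Rightarrow> nat \<Rightarrow> bool" where
  "node_short (TypeB m) i \<longleftrightarrow> i = m"
| "node_short (TypeC m) i \<longleftrightarrow> i < m"
| "node_short TypeF4 i \<longleftrightarrow> 3 \<le> i"
| "node_short TypeG2 i \<longleftrightarrow> i = 1"

lemma nodes_in: "short_node X \<in> {1..l}" "long_node X \<in> {1..l}"
  using adm by (cases X; auto simp: l_def)+

lemma reps_in: "\<gamma>s \<in> \<Phi>" "\<gamma>l \<in> \<Phi>"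
  using nodes_in b_in by blast+

lemma n_reps: "n \<gamma>s \<gamma>l = - 1" "n \<gamma>l \<gamma>s = - k"
  using n_b[OF nodes_in] n_b[OF nodes_in(2,1)] adm
  by (cases X; auto simp: cartan_entry_def k_def)+

lemma k_ge_2: "2 \<le> k"
  by (cases X) (auto simp: k_def)

text \<open>Reflecting in two simple roots joined by a single bond carries one of them to the other.\<close>

lemma adjacent_orbit:
  assumes ij: "i \<in> {1..l}" "j \<in> {1..l}" and n: "n (b i) (b j) = - 1" "n (b j) (b i) = - 1"
  shows "b i \<in> refl_orbit r b l (b j)"
proof -
  have e: "r (b i) (b j) = b j + b i" using r_eq[OF b_in[OF ij(1)] b_in[OF ij(2)]] n by simp
  have "r (b j) (r (b i) (b j)) = r (b j) (b j) + r (b j) (b i)"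
    unfolding e by (rule refl(4)[OF b_in[OF ij(2)]])
  also have "\<dots> = b i"
    using r_self[OF b_in[OF ij(2)]] r_eq[OF b_in[OF ij(2)] b_in[OF ij(1)]] n by simp
  finally have "r (b j) (r (b i) (b j)) = b i" .
  moreover have "r (b j) (r (b i) (b j)) \<in> refl_orbit r b l (b j)"
    by (intro refl_orbit.step refl_orbit.start ij)
  ultimately show ?thesis by simp
qed

lemma chain_orbit:
  assumes m: "m \<in> {1..l}" and i: "1 \<le> i" "i \<le> m"
    and a: "\<And>i. 1 \<le> i \<Longrightarrow> Suc i \<le> m \<Longrightarrow> cartan_entry X i (Suc i) = - 1 \<and> cartan_entry X (Suc i) i = - 1"
  shows "b i \<in> refl_orbit r b l (b m)"
  using i(2,1)
proof (induction rule: inc_induct)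
  case base show ?case by (rule refl_orbit.start)
next
  case (step i)
  then have "b i \<in> refl_orbit r b l (b (Suc i))"
    using m a[of i] by (intro adjacent_orbit) (simp_all add: n_b)
  then show ?case using step orbit_trans by simp
qed

lemma node_orbit:
  assumes i: "i \<in> {1..l}"
  shows "b i \<in> refl_orbit r b l (if node_short X i then \<gamma>s else \<gamma>l)"
proof (cases X)
  case (TypeB m)
  show ?thesis
  proof (cases "i = m")
    case True then show ?thesis using TypeB by (simp add: refl_orbit.start)
  next
    case False
    then have "1 \<le> i" "i \<le> m - 1" "m - 1 \<in> {1..l}" using i nodes_in TypeB by (auto simp: l_def)
    then have "b i \<in> refl_orbit r b l (b (m - 1))"
      by (intro chain_orbit) (auto simp: TypeB cartan_entry_def)
    then show ?thesis using False TypeB by simp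
  qed
next
  case (TypeC m)
  show ?thesis
  proof (cases "i = m")
    case True then show ?thesis using TypeC by (simp add: refl_orbit.start)
  next
    case False
    then have "1 \<le> i" "i \<le> m - 1" "m - 1 \<in> {1..l}" using i nodes_in TypeC by (auto simp: l_def)
    then have "b i \<in> refl_orbit r b l (b (m - 1))"
      by (intro chain_orbit) (auto simp: TypeC cartan_entry_def)
    then show ?thesis using False i TypeC by (simp add: l_def)
  qed
next
  case TypeF4
  have "b 1 \<in> refl_orbit r b l (b 2)" "b 4 \<in> refl_orbit r b l (b 3)"
    by (rule adjacent_orbit; simp add: n_b l_def TypeF4 cartan_entry_def)+
  moreover have "i = 1 \<or> i = 2 \<or> i = 3 \<or> i = 4" using i by (auto simp: l_def TypeF4)
  ultimately show ?thesis by (auto simp: TypeF4 intro: refl_orbit.start)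
next
  case TypeG2
  moreover have "i = 1 \<or> i = 2" using i by (auto simp: l_def TypeG2)
  ultimately show ?thesis by (auto intro: refl_orbit.start)
qed

text \<open>The squared length of a short root; that of a long root is \<open>k\<close> times as large.\<close>

definition L where "L = B \<gamma>s \<gamma>s"

lemma L_pos: "0 < L"
  unfolding L_def by (rule norm_pos[OF reps_in(1)])

lemma norm_long: "B \<gamma>l \<gamma>l = of_int k * L"
  using B_n[OF reps_in] B_n[OF reps_in(2,1)] sym[of \<gamma>l \<gamma>s] n_reps by (simp add: L_def)

lemma kL: "L < of_int k * L"
  using L_pos k_ge_2 by (simp add: mult_less_cancel_right1)

definition is_short :: "'v \<Rightarrow> bool" where
  "is_short \<beta> \<longleftrightarrow> B \<beta> \<beta> = L"

lemma is_short_reps: "is_short \<gamma>s" "\<not> is_short \<gamma>l"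
  using kL norm_long by (auto simp: is_short_def L_def)

lemma is_short_r: "\<alpha> \<in> \<Phi> \<Longrightarrow> is_short (r \<alpha> \<beta>) = is_short \<beta>"
  by (simp add: is_short_def refl(2))

lemma orbit_rep:
  assumes "\<beta> \<in> \<Phi>"
  shows "\<beta> \<in> refl_orbit r b l (if is_short \<beta> then \<gamma>s else \<gamma>l)"
proof -
  obtain j where j: "j \<in> {1..l}" "\<beta> \<in> refl_orbit r b l (b j)" using root_in_orbit[OF assms] by blast
  have o: "\<beta> \<in> refl_orbit r b l (if node_short X j then \<gamma>s else \<gamma>l)"
    using orbit_trans[OF j(2) node_orbit[OF j(1)]] .
  have "is_short \<beta> = node_short X j"
    using orbit_norm[OF o] kL norm_long by (auto simp: is_short_def L_def split: if_splits)
  then show ?thesis using o by simp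
qed

lemma norm_cases: "\<beta> \<in> \<Phi> \<Longrightarrow> B \<beta> \<beta> = (if is_short \<beta> then L else of_int k * L)"
  using orbit_norm[OF orbit_rep, of \<beta>] norm_long by (auto simp: L_def split: if_splits)

lemma short_roots_eq: "short_roots B Rd = {\<beta> \<in> \<Phi>. is_short \<beta>}"
proof -
  have "\<beta> \<in> short_roots B Rd \<longleftrightarrow> is_short \<beta>" if "\<beta> \<in> \<Phi>" for \<beta>
  proof
    assume "\<beta> \<in> short_roots B Rd"
    then have "B \<beta> \<beta> \<le> L" using reps_in by (auto simp: short_roots_def L_def)
    then show "is_short \<beta>" using norm_cases[OF that] kL by (auto split: if_splits)
  next
    assume "is_short \<beta>"
    then have "B \<beta> \<beta> \<le> B \<gamma> \<gamma>" if "\<gamma> \<in> \<Phi>" for \<gamma>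
      using norm_cases[OF that] kL unfolding is_short_def by (cases "B \<gamma> \<gamma> = L") simp_all
    then show "\<beta> \<in> short_roots B Rd" using that by (auto simp: short_roots_def)
  qed
  then show ?thesis by (auto simp: short_roots_def)
qed

lemma long_roots_eq: "long_roots B Rd = {\<beta> \<in> \<Phi>. \<not> is_short \<beta>}"
proof -
  have "\<beta> \<in> long_roots B Rd \<longleftrightarrow> \<not> is_short \<beta>" if "\<beta> \<in> \<Phi>" for \<beta>
  proof
    assume "\<beta> \<in> long_roots B Rd"
    then have "B \<gamma>l \<gamma>l \<le> B \<beta> \<beta>" using reps_in(2) unfolding long_roots_def by blast
    then show "\<not> is_short \<beta>" using kL norm_long unfolding is_short_def by linarith
  next
    assume "\<not> is_short \<beta>"
    then have "B \<gamma> \<gamma> \<le> B \<beta> \<beta>" if "\<gamma> \<in> \<Phi>" for \<gamma>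
      using norm_cases[OF that] norm_cases[OF \<open>\<beta> \<in> \<Phi>\<close>] kL by auto
    then show "\<beta> \<in> long_roots B Rd" using that by (auto simp: long_roots_def)
  qed
  then show ?thesis by (auto simp: long_roots_def)
qed

lemma n_long_short:
  assumes "\<alpha> \<in> \<Phi>" "\<beta> \<in> \<Phi>" "is_short \<alpha>" "\<not> is_short \<beta>"
  shows "n \<beta> \<alpha> = k * n \<alpha> \<beta>"
proof -
  have "of_int (n \<beta> \<alpha>) * L = of_int (n \<alpha> \<beta>) * (of_int k * L)"
    using B_n[OF assms(1,2)] B_n[OF assms(2,1)] norm_cases[OF assms(1)] norm_cases[OF assms(2)]
      assms(3,4) sym[of \<alpha> \<beta>] by simp
  then have "real_of_int (n \<beta> \<alpha>) = real_of_int (k * n \<alpha> \<beta>)" using L_pos by simp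
  then show ?thesis by linarith
qed

lemma n_same_length:
  assumes "\<alpha> \<in> \<Phi>" "\<beta> \<in> \<Phi>" "is_short \<alpha> = is_short \<beta>"
  shows "n \<beta> \<alpha> = n \<alpha> \<beta>"
  using norm_cases[OF assms(1)] norm_cases[OF assms(2)] assms(3) sym[of \<alpha> \<beta>] by (simp add: n_def)

text \<open>
  In types \<open>B\<close> and \<open>C\<close> an even column or row of the Cartan matrix propagates along the orbits, so
  roots of the distinguished length pair evenly with each other.
\<close>

lemma even_column:
  assumes j: "j \<in> {1..l}" and col: "\<And>i. i \<in> {1..l} \<Longrightarrow> even (cartan_entry X i j)" and bt: "\<beta> \<in> \<Phi>"
  shows "even (n \<beta> (b j))"
proof -
  obtain i where i: "i \<in> {1..l}" "\<beta> \<in> refl_orbit r b l (b i)" using root_in_orbit[OF bt] by blast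
  from i(2) have "\<beta> \<in> \<Phi> \<and> even (n \<beta> (b j))"
  proof induction
    case start then show ?case using n_b[OF i(1) j] col[OF i(1)] b_in[OF i(1)] by simp
  next
    case (step \<beta> m)
    have "even (n (b m) (b j))" using n_b[OF step(2) j] col[OF step(2)] by simp
    then show ?case
      using n_r_left[OF b_in[OF step(2)] _ b_in[OF j], of \<beta>] step r_in[OF b_in[OF step(2)]] by simp
  qed
  then show ?thesis by blast
qed

lemma even_row:
  assumes j: "j \<in> {1..l}" and row: "\<And>i. i \<in> {1..l} \<Longrightarrow> even (cartan_entry X j i)" and bt: "\<beta> \<in> \<Phi>"
  shows "even (n (b j) \<beta>)"
proof -
  obtain i where i: "i \<in> {1..l}" "\<beta> \<in> refl_orbit r b l (b i)" using root_in_orbit[OF bt] by blast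
  from i(2) have "\<beta> \<in> \<Phi> \<and> even (n (b j) \<beta>)"
  proof induction
    case start then show ?case using n_b[OF j i(1)] row[OF i(1)] b_in[OF i(1)] by simp
  next
    case (step \<beta> m)
    have m: "b m \<in> \<Phi>" using b_in[OF step(2)] .
    have "n (b j) (r (b m) \<beta>) = n (b j) \<beta> - n (b j) (b m) * n (b m) \<beta>"
      using n_r'[OF m, of "b j" \<beta>] n_r_left[OF m b_in[OF j], of \<beta>] step by simp
    moreover have "even (n (b j) (b m))" using n_b[OF j step(2)] row[OF step(2)] by simp
    ultimately show ?case using step r_in[OF m] by simp
  qed
  then show ?thesis by blast
qed

lemma even_orbit:
  assumes e: "\<And>\<beta>. \<beta> \<in> \<Phi> \<Longrightarrow> P \<beta> \<Longrightarrow> even (n \<beta> \<gamma>)" and P: "\<And>\<alpha> \<beta>. \<alpha> \<in> \<Phi> \<Longrightarrow> P (r \<alpha> \<beta>) = P \<beta>"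
    and a: "\<alpha> \<in> refl_orbit r b l \<gamma>" "\<gamma> \<in> \<Phi>" and bt: "\<beta> \<in> \<Phi>" "P \<beta>"
  shows "even (n \<beta> \<alpha>)"
  using a(1) bt
proof (induction arbitrary: \<beta>)
  case start then show ?case using e by blast
next
  case (step \<alpha> i)
  then show ?case
    using n_r'[OF b_in[OF step(2)], of \<beta> \<alpha>] P[OF b_in[OF step(2)], of \<beta>] r_in[OF b_in[OF step(2)], of \<beta>]
    by metis
qed

lemma even_short:
  assumes "X = TypeB m" "\<alpha> \<in> \<Phi>" "\<beta> \<in> \<Phi>" "is_short \<alpha>"
  shows "even (n \<beta> \<alpha>)"
proof (rule even_orbit[of "\<lambda>_. True" \<gamma>s])
  show "\<alpha> \<in> refl_orbit r b l \<gamma>s" using orbit_rep[OF assms(2)] assms(4) by simp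
  show "even (n \<beta> \<gamma>s)" if "\<beta> \<in> \<Phi>" for \<beta>
    by (rule even_column[OF nodes_in(1) _ that]) (use assms(1) in \<open>auto simp: cartan_entry_def l_def\<close>)
qed (use assms reps_in in auto)

lemma even_long:
  assumes "X = TypeB 2 \<or> X = TypeC m" "\<alpha> \<in> \<Phi>" "\<beta> \<in> \<Phi>" "\<not> is_short \<alpha>" "\<not> is_short \<beta>"
  shows "even (n \<beta> \<alpha>)"
proof (rule even_orbit[of "\<lambda>\<beta>. \<not> is_short \<beta>" \<gamma>l])
  show "\<alpha> \<in> refl_orbit r b l \<gamma>l" using orbit_rep[OF assms(2)] assms(4) by simp
  show "even (n \<beta> \<gamma>l)" if "\<beta> \<in> \<Phi>" "\<not> is_short \<beta>" for \<beta>
  proof -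
    have "even (n \<gamma>l \<beta>)"
      by (rule even_row[OF nodes_in(2) _ that(1)])
        (use assms(1) in \<open>auto simp: cartan_entry_def l_def\<close>)
    then show ?thesis using n_same_length[OF reps_in(2) that(1)] that(2) is_short_reps by simp
  qed
qed (use assms reps_in is_short_r in auto)

text \<open>
  Outside these types a root of the same length at an angle of 60 or 120 degrees is available; in
  type \<open>G2\<close> it is not simple.
\<close>

lemma short_neighbour:
  assumes "\<And>m. X \<noteq> TypeB m"
  shows "\<exists>\<alpha>\<in>\<Phi>. is_short \<alpha> \<and> n \<gamma>s \<alpha> = - 1"
proof -
  have simple: ?thesis if "i \<in> {1..l}" "node_short X i" "cartan_entry X (short_node X) i = - 1" for i
  proof (intro bexI conjI)
    show "b i \<in> \<Phi>" using b_in that(1) .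
    show "is_short (b i)" using orbit_norm[OF node_orbit[OF that(1)]] that(2) by (simp add: is_short_def L_def)
    show "n \<gamma>s (b i) = - 1" using n_b[OF nodes_in(1) that(1)] that(3) by simp
  qed
  show ?thesis
  proof (cases X)
    case (TypeB m) then show ?thesis using assms by blast
  next
    case (TypeC m)
    define q where "q = m - 3"
    then have "X = TypeC (q + 3)" using TypeC adm by simp
    then show ?thesis by (intro simple[of "q + 1"]) (simp_all add: l_def cartan_entry_def)
  next
    case TypeF4
    then show ?thesis using simple[of 4] by (simp add: l_def cartan_entry_def)
  next
    case TypeG2
    have "n (r \<gamma>l \<gamma>s) \<gamma>s = - 1"
      using n_r_left[OF reps_in(2,1,1)] n_reps n_self[OF reps_in(1)] TypeG2 by (simp add: k_def)
    then have "n \<gamma>s (r \<gamma>l \<gamma>s) = - 1"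
      using n_same_length[of \<gamma>s "r \<gamma>l \<gamma>s"] reps_in r_in is_short_r by simp
    then show ?thesis using r_in[OF reps_in(2,1)] is_short_r[OF reps_in(2)] is_short_reps by blast
  qed
qed

lemma long_neighbour:
  assumes "X \<noteq> TypeB 2" "\<And>m. X \<noteq> TypeC m"
  shows "\<exists>\<alpha>\<in>\<Phi>. \<not> is_short \<alpha> \<and> n \<gamma>l \<alpha> = - 1"
proof -
  have simple: ?thesis if "i \<in> {1..l}" "\<not> node_short X i" "cartan_entry X (long_node X) i = - 1" for i
  proof (intro bexI conjI)
    show "b i \<in> \<Phi>" using b_in that(1) .
    show "\<not> is_short (b i)"
      using orbit_norm[OF node_orbit[OF that(1)]] that(2) is_short_reps by (simp add: is_short_def)
    show "n \<gamma>l (b i) = - 1" using n_b[OF nodes_in(2) that(1)] that(3) by simp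
  qed
  show ?thesis
  proof (cases X)
    case (TypeB m)
    define q where "q = m - 3"
    then have "X = TypeB (q + 3)" using TypeB adm assms(1) by auto
    then show ?thesis by (intro simple[of "q + 1"]) (simp_all add: l_def cartan_entry_def)
  next
    case (TypeC m) then show ?thesis using assms by blast
  next
    case TypeF4
    then show ?thesis using simple[of 1] by (simp add: l_def cartan_entry_def)
  next
    case TypeG2
    have "n (r \<gamma>s \<gamma>l) \<gamma>l = - 1"
      using n_r_left[OF reps_in(1,2,2)] n_reps n_self[OF reps_in(2)] TypeG2 by (simp add: k_def)
    then have "n \<gamma>l (r \<gamma>s \<gamma>l) = - 1"
      using n_same_length[of \<gamma>l "r \<gamma>s \<gamma>l"] reps_in r_in is_short_r by simp
    then show ?thesis using r_in[OF reps_in] is_short_r[OF reps_in(1)] is_short_reps by blast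
  qed
qed

end

section \<open>Semilattices with a basis\<close>

lemma zbasisE:
  assumes "zbasis I \<sigma> L" "x \<in> L"
  obtains c :: "'i \<Rightarrow> int" where "x = (\<Sum>i\<in>I. of_int (c i) *\<^sub>R \<sigma> i)"
  using assms by (auto simp: zbasis_def)

lemma zbasisI: "zbasis I \<sigma> L \<Longrightarrow> (\<Sum>i\<in>I. of_int (c i) *\<^sub>R \<sigma> i) \<in> L"
  by (auto simp: zbasis_def)

lemma zbasis_closed:
  fixes I :: "'i set"
  assumes "zbasis I \<sigma> L"
  shows "0 \<in> L" "x \<in> L \<Longrightarrow> y \<in> L \<Longrightarrow> x + y \<in> L" "x \<in> L \<Longrightarrow> of_int m *\<^sub>R x \<in> L"
    "x \<in> L \<Longrightarrow> y \<in> L \<Longrightarrow> x - y \<in> L"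
proof -
  show "0 \<in> L" using zbasisI[OF assms, of "\<lambda>_. 0"] by simp
  show add: "x + y \<in> L" if h: "x \<in> L" "y \<in> L" for x y
  proof -
    obtain c :: "'i \<Rightarrow> int" where c: "x = (\<Sum>i\<in>I. of_int (c i) *\<^sub>R \<sigma> i)"
      using zbasisE[OF assms h(1)] by blast
    obtain d :: "'i \<Rightarrow> int" where "y = (\<Sum>i\<in>I. of_int (d i) *\<^sub>R \<sigma> i)"
      using zbasisE[OF assms h(2)] by blast
    with c have "x + y = (\<Sum>i\<in>I. of_int (c i + d i) *\<^sub>R \<sigma> i)"
      by (simp add: scaleR_left_distrib sum.distrib)
    then show ?thesis using zbasisI[OF assms] by metis
  qed
  show scale: "of_int m *\<^sub>R x \<in> L" if h: "x \<in> L" for x m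
  proof -
    obtain c :: "'i \<Rightarrow> int" where "x = (\<Sum>i\<in>I. of_int (c i) *\<^sub>R \<sigma> i)"
      using zbasisE[OF assms h] by blast
    then have "of_int m *\<^sub>R x = (\<Sum>i\<in>I. of_int (m * c i) *\<^sub>R \<sigma> i)"
      by (simp add: scaleR_sum_right)
    then show ?thesis using zbasisI[OF assms] by metis
  qed
  show "x - y \<in> L" if "x \<in> L" "y \<in> L"
    using add[OF that(1) scale[OF that(2), of "- 1"]] by simp
qed

lemma zspan_superset: "S \<subseteq> zspan S"
proof
  fix x assume "x \<in> S"
  then show "x \<in> zspan S"
    unfolding zspan_def by (intro CollectI exI[of _ "{x}"] exI[of _ "\<lambda>_. 1"]) simp
qed

lemma zspan_subset_span: "zspan S \<subseteq> span S"
  by (auto simp: zspan_def intro!: span_sum span_scale intro: span_base)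

lemma semilattice_even_shift:
  assumes S: "semilattice_in U S" and x: "x \<in> S" and y: "y \<in> zspan S" and m: "even m"
  shows "x - of_int m *\<^sub>R y \<in> S"
proof -
  have S_eq: "S = {x + 2 *\<^sub>R y | x y. x \<in> S \<and> y \<in> S} \<union> {x - 2 *\<^sub>R y | x y. x \<in> S \<and> y \<in> S}"
    using S by (simp add: semilattice_in_def)
  have cl: "a + 2 *\<^sub>R c \<in> S" "a - 2 *\<^sub>R c \<in> S" if "a \<in> S" "c \<in> S" for a c
    using that by (subst S_eq, blast)+
  obtain T and c :: "'a \<Rightarrow> int" where T: "finite T" "T \<subseteq> S" "y = (\<Sum>u\<in>T. of_int (c u) *\<^sub>R u)"
    using y by (auto simp: zspan_def)
  obtain j where j: "m = 2 * j" using m by blast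
  have "x + (\<Sum>u\<in>T. of_int (- j * c u) *\<^sub>R (2 *\<^sub>R u)) \<in> S"
    by (rule closed_add_combination[OF T(1) x]) (use cl T(2) in auto)
  also have "(\<Sum>u\<in>T. of_int (- j * c u) *\<^sub>R (2 *\<^sub>R u)) = - (of_int m *\<^sub>R y)"
    by (simp add: T(3) j scaleR_sum_right sum_negf mult_ac)
  finally show ?thesis by simp
qed

section \<open>The extended affine setting\<close>

text \<open>A formal inverse letter represents the inverse of a generator by the cancellation relation.\<close>

lemma word_generate:
  fixes E
  assumes "u \<in> words N"
  shows "pres_rel N E `` {u} \<in> generate (presented_group N E) (pres_gen N E ` N)"
proof -
  let ?G = "presented_group N E"
  interpret group ?G by (rule group_presented_group)
  show ?thesis
    using assms
  proof (induction u)
    case Nil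
    then show ?case using generate.one[of ?G] by (simp add: presented_group_one)
  next
    case (Cons a u)
    obtain x p where a: "a = (x, p)" by force
    have x: "x \<in> N" and u: "u \<in> words N" using Cons.prems a by auto
    have g: "pres_gen N E x \<in> carrier ?G" by (rule pres_gen_carrier[OF x])
    have letter: "pres_rel N E `` {[(x, p)]} \<in> generate ?G (pres_gen N E ` N)"
    proof (cases p)
      case True
      then have "pres_rel N E `` {[(x, p)]} = pres_gen N E x" by (simp add: pres_gen_def)
      then show ?thesis using x by (auto intro: generate.incl)
    next
      case False
      have w: "[(x, p)] \<in> words N" "[(x, True)] \<in> words N" using x by auto
      have "pres_rel N E `` {[(x, p)]} \<otimes>\<^bsub>?G\<^esub> pres_gen N E x = \<one>\<^bsub>?G\<^esub>"
        using pres_cancel[OF x, of False E] w False x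
        by (simp add: pres_gen_def presented_group_mult presented_group_one pres_class_eq)
      moreover have "pres_rel N E `` {[(x, p)]} \<in> carrier ?G"
        using w(1) presented_group_carrier by blast
      ultimately have "inv\<^bsub>?G\<^esub> (pres_gen N E x) = pres_rel N E `` {[(x, p)]}"
        using inv_equality g by blast
      then show ?thesis using x generate.inv[of "pres_gen N E x" "pres_gen N E ` N" ?G] by auto
    qed
    have "pres_rel N E `` {a # u} = pres_rel N E `` {[(x, p)]} \<otimes>\<^bsub>?G\<^esub> pres_rel N E `` {u}"
      using presented_group_mult[of "[(x, p)]" N u E] x u a by simp
    then show ?case using generate.eng[OF letter Cons.IH[OF u]] by simp
  qed
qed

text \<open>The data of the theorem together with a base of the finite root system.\<close>

locale ears_presentation = ears_data X \<nu> t B Vd V1 V2 Rd S1 S2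
  for X \<nu> t and B :: "'v::euclidean_space \<Rightarrow> 'v \<Rightarrow> real" and Vd V1 V2 Rd S1 S2 +
  fixes R :: "'v set" and \<sigma> :: "nat \<Rightarrow> 'v" and b :: "nat \<Rightarrow> 'v"
    and \<psi> :: "('v \<times> bool) list set \<Rightarrow> ('v \<times> ('v \<Rightarrow>\<^sub>L real) \<Rightarrow> 'v \<times> ('v \<Rightarrow>\<^sub>L real))"
  assumes R_eq: "R = ears_roots X B Rd S1 S2"
    and sigma1: "\<sigma> ` {1..t} \<subseteq> S1" "zbasis {1..t} \<sigma> (zspan S1)"
    and sigma2: "\<sigma> ` {t+1..\<nu>} \<subseteq> S2" "zbasis {t+1..\<nu>} \<sigma> (zspan S2)"
    and psi_epi: "\<psi> \<in> epi (conj_group B R) (weyl_group B Vd R)"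
    and psi_gen: "\<And>\<alpha>. \<alpha> \<in> nonisotropic B R \<Longrightarrow> \<psi> (conj_gen B R \<alpha>) = weyl_reflection B Vd \<alpha>"
    and base: "root_base Rd (type_rank X) b"
    and cartan: "\<And>i j. i \<in> {1..type_rank X} \<Longrightarrow> j \<in> {1..type_rank X} \<Longrightarrow>
      2 * B (b i) (b j) / B (b j) (b j) = of_int (cartan_entry X i j)"
begin

sublocale roots: based_roots X B Vd Rd b "type_rank X" "type_int X"
  using finite_roots type_X form_bilinear form_sym base cartan
  by unfold_locales (auto simp: root_system_of_type_def)

abbreviation "\<Phi> \<equiv> Rd - {0}"
abbreviation "k \<equiv> type_int X"
abbreviation "\<gamma>s \<equiv> b (short_node X)"
abbreviation "\<gamma>l \<equiv> b (long_node X)"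
abbreviation "short \<equiv> roots.is_short"

definition Sh :: "'v \<Rightarrow> 'v set" where
  "Sh \<gamma> = (if short \<gamma> then S1 + zspan S2 else (\<lambda>x. of_int k *\<^sub>R x) ` zspan S1 + S2)"

definition sg :: "'v \<Rightarrow> 'v \<Rightarrow> ('v \<times> bool) list set" where
  "sg \<gamma> \<delta> = conj_gen B R (\<gamma> + \<delta>)"

text \<open>
  The directions in which the shifts of a root may form a semilattice that is not a lattice. For the
  other directions a second root pairs with the given one in the way that \<open>ee_good\<close> records.
\<close>

definition Dset :: "'v \<Rightarrow> nat set" where
  "Dset \<gamma> = (if short \<gamma> then if \<exists>m. X = TypeB m then {1..t} else {}
     else if X = TypeB 2 \<or> (\<exists>m. X = TypeC m) then {t+1..\<nu>} else {})"

lemma S_V: "S1 \<subseteq> V1" "zspan S1 \<subseteq> V1" "S2 \<subseteq> V2" "zspan S2 \<subseteq> V2"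
  using semilattice_S1 semilattice_S2 zspan_subset_span[of S1] zspan_subset_span[of S2]
  by (auto simp: semilattice_in_def)

lemma zero_S: "0 \<in> S1" "0 \<in> S2"
  using semilattice_S1 semilattice_S2 by (auto simp: semilattice_in_def)

lemmas L1 = zbasis_closed[OF sigma1(2)] and L2 = zbasis_closed[OF sigma2(2)]
lemmas S1_sub = subsetD[OF zspan_superset[of S1]] and S2_sub = subsetD[OF zspan_superset[of S2]]

lemma V12: "v \<in> V1 \<Longrightarrow> v \<in> V1 + V2" "v \<in> V2 \<Longrightarrow> v \<in> V1 + V2"
proof -
  show "v \<in> V1 + V2" if "v \<in> V1" using set_plus_intro[OF that subspace_0[OF subspaces(3)]] by simp
  show "v \<in> V1 + V2" if "v \<in> V2" using set_plus_intro[OF subspace_0[OF subspaces(2)] that] by simp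
qed

lemma B_rad: "v \<in> V1 + V2 \<Longrightarrow> B v u = 0" "v \<in> V1 + V2 \<Longrightarrow> B u v = 0"
proof -
  show *: "B v u = 0" if "v \<in> V1 + V2" for u using radical that by blast
  show "B u v = 0" if "v \<in> V1 + V2" unfolding form_sym[of u v] by (rule *[OF that])
qed

lemma subspace_V0: "subspace (V1 + V2)"
  unfolding radical[symmetric]
  by (auto simp: subspace_def bilinear_ladd[OF form_bilinear] bilinear_lmul[OF form_bilinear]
      bilinear_lzero[OF form_bilinear])

lemma Sh_short: "short \<gamma> \<Longrightarrow> \<delta> \<in> Sh \<gamma> \<longleftrightarrow> (\<exists>x\<in>S1. \<exists>y\<in>zspan S2. \<delta> = x + y)"
  by (auto simp: Sh_def set_plus_def)

lemma Sh_long: "\<not> short \<gamma> \<Longrightarrow> \<delta> \<in> Sh \<gamma> \<longleftrightarrow> (\<exists>x\<in>zspan S1. \<exists>y\<in>S2. \<delta> = of_int k *\<^sub>R x + y)"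
  by (auto simp: Sh_def set_plus_def)

lemma Sh_rad:
  assumes "\<delta> \<in> Sh \<gamma>" shows "\<delta> \<in> V1 + V2"
proof (cases "short \<gamma>")
  case True
  then obtain x y where "x \<in> S1" "y \<in> zspan S2" "\<delta> = x + y" using assms Sh_short by blast
  then show ?thesis using S_V by (metis set_plus_intro subsetD)
next
  case False
  then obtain x y where xy: "x \<in> zspan S1" "y \<in> S2" "\<delta> = of_int k *\<^sub>R x + y" using assms Sh_long by blast
  then have "of_int k *\<^sub>R x \<in> V1" using S_V subspace_scale[OF subspaces(2)] by blast
  then show ?thesis using xy S_V by (metis set_plus_intro subsetD)
qed

lemma Sh_zero: "0 \<in> Sh \<gamma>"
proof (cases "short \<gamma>")
  case True
  then show ?thesis using zero_S(1) L2(1) by (subst Sh_short) (auto intro!: bexI[of _ 0])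
next
  case False
  then show ?thesis using zero_S(2) L1(1) by (subst Sh_long) (auto intro!: bexI[of _ 0])
qed

lemma B_shift: "\<delta> \<in> V1 + V2 \<Longrightarrow> \<epsilon> \<in> V1 + V2 \<Longrightarrow> B (u + \<delta>) (v + \<epsilon>) = B u v"
  using B_rad by (simp add: bilinear_ladd[OF form_bilinear] bilinear_radd[OF form_bilinear])

lemma nonisotropic_iff: "\<alpha> \<in> nonisotropic B R \<longleftrightarrow> (\<exists>\<gamma>\<in>\<Phi>. \<exists>\<delta>\<in>Sh \<gamma>. \<alpha> = \<gamma> + \<delta>)"
proof
  assume a: "\<alpha> \<in> nonisotropic B R"
  have "\<alpha> \<notin> (S1 + zspan S2) + (S1 + zspan S2)"
  proof
    assume "\<alpha> \<in> (S1 + zspan S2) + (S1 + zspan S2)"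
    moreover have "S1 + zspan S2 \<subseteq> V1 + V2" using S_V set_plus_mono2 by blast
    ultimately have "\<alpha> \<in> V1 + V2"
      using subspace_add[OF subspace_V0] by (elim set_plus_elim[of \<alpha>]) (simp add: subset_iff)
    then show False using a B_rad(1)[of \<alpha> \<alpha>] by (simp add: nonisotropic_def)
  qed
  then have "\<alpha> \<in> short_roots B Rd + (S1 + zspan S2) \<or>
      \<alpha> \<in> long_roots B Rd + ((\<lambda>x. of_int k *\<^sub>R x) ` zspan S1 + S2)"
    using a by (auto simp: nonisotropic_def R_eq ears_roots_def type_k_int)
  then show "\<exists>\<gamma>\<in>\<Phi>. \<exists>\<delta>\<in>Sh \<gamma>. \<alpha> = \<gamma> + \<delta>"
    by (elim disjE set_plus_elim[of \<alpha>])
      (auto simp: roots.short_roots_eq roots.long_roots_eq Sh_def)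
next
  assume "\<exists>\<gamma>\<in>\<Phi>. \<exists>\<delta>\<in>Sh \<gamma>. \<alpha> = \<gamma> + \<delta>"
  then obtain \<gamma> \<delta> where g: "\<gamma> \<in> \<Phi>" "\<delta> \<in> Sh \<gamma>" "\<alpha> = \<gamma> + \<delta>" by blast
  have "\<alpha> \<in> R"
  proof (cases "short \<gamma>")
    case True
    then have "\<alpha> \<in> short_roots B Rd + (S1 + zspan S2)"
      using g by (auto simp: roots.short_roots_eq Sh_def)
    then show ?thesis by (simp add: R_eq ears_roots_def)
  next
    case False
    then have "\<alpha> \<in> long_roots B Rd + ((\<lambda>x. of_int k *\<^sub>R x) ` zspan S1 + S2)"
      using g unfolding Sh_def by (auto simp: roots.long_roots_eq)
    then show ?thesis by (simp add: R_eq ears_roots_def type_k_int)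
  qed
  moreover have "B \<alpha> \<alpha> = B \<gamma> \<gamma>" using B_shift g(3) Sh_rad[OF g(2)] by simp
  ultimately show "\<alpha> \<in> nonisotropic B R"
    using roots.norm_pos[OF g(1)] by (simp add: nonisotropic_def)
qed

lemma in_nonisotropic: "\<gamma> \<in> \<Phi> \<Longrightarrow> \<delta> \<in> Sh \<gamma> \<Longrightarrow> \<gamma> + \<delta> \<in> nonisotropic B R"
  using nonisotropic_iff by blast

lemma S1_shift:
  assumes "x \<in> S1" "y \<in> zspan S1" "even m \<or> is_lattice S1"
  shows "x - of_int m *\<^sub>R y \<in> S1"
proof (cases "even m")
  case True then show ?thesis using semilattice_even_shift[OF semilattice_S1 assms(1,2)] by blast
next
  case False
  then have "S1 = zspan S1" using assms(3) by (simp add: is_lattice_def)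
  then show ?thesis using L1(3)[OF assms(2)] L1(4) assms(1) by metis
qed

lemma S2_shift:
  assumes "x \<in> S2" "y \<in> zspan S2" "even m \<or> is_lattice S2"
  shows "x - of_int m *\<^sub>R y \<in> S2"
proof (cases "even m")
  case True then show ?thesis using semilattice_even_shift[OF semilattice_S2 assms(1,2)] by blast
next
  case False
  then have "S2 = zspan S2" using assms(3) by (simp add: is_lattice_def)
  then show ?thesis using L2(3)[OF assms(2)] L2(4) assms(1) by metis
qed

lemma lattice_if_not_B: "(\<And>m. X \<noteq> TypeB m) \<Longrightarrow> is_lattice S1"
  using lattice_C lattice_FG by (cases X) auto

lemma lattice_if_not_C: "X \<noteq> TypeB 2 \<Longrightarrow> (\<And>m. X \<noteq> TypeC m) \<Longrightarrow> is_lattice S2"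
  using lattice_B lattice_FG type_X by (cases X) auto

lemma k_even: "even k \<or> is_lattice S1" "even k \<or> is_lattice S2"
  using lattice_FG by (cases X; simp)+

text \<open>
  The reflections preserve the affine roots. Between roots of equal length odd multiples of a
  shift occur only where the semilattice is assumed to be a lattice.
\<close>

lemma Sh_shift:
  assumes a: "\<alpha> \<in> \<Phi>" "\<epsilon> \<in> Sh \<alpha>" and bt: "\<beta> \<in> \<Phi>" "\<delta> \<in> Sh \<beta>"
  shows "\<delta> - of_int (roots.n \<beta> \<alpha>) *\<^sub>R \<epsilon> \<in> Sh \<beta>"
proof -
  define m where "m = roots.n \<beta> \<alpha>"
  show ?thesis
    unfolding m_def[symmetric]
  proof (cases "short \<beta>")
    case True
    then obtain x y where xy: "x \<in> S1" "y \<in> zspan S2" "\<delta> = x + y" using bt(2) Sh_short by blast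
    show "\<delta> - of_int m *\<^sub>R \<epsilon> \<in> Sh \<beta>"
    proof (cases "short \<alpha>")
      case sa: True
      then obtain x' y' where e: "x' \<in> S1" "y' \<in> zspan S2" "\<epsilon> = x' + y'" using a(2) Sh_short by blast
      have "even m \<or> is_lattice S1"
        using roots.even_short[OF _ a(1) bt(1) sa] lattice_if_not_B unfolding m_def by blast
      then have "x - of_int m *\<^sub>R x' \<in> S1" by (rule S1_shift[OF xy(1) S1_sub[OF e(1)]])
      moreover have "y - of_int m *\<^sub>R y' \<in> zspan S2" by (rule L2(4)[OF xy(2) L2(3)[OF e(2)]])
      moreover have "\<delta> - of_int m *\<^sub>R \<epsilon> = (x - of_int m *\<^sub>R x') + (y - of_int m *\<^sub>R y')"
        by (simp add: xy e algebra_simps)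
      ultimately show ?thesis using Sh_short[OF True] by blast
    next
      case False
      then obtain x' y' where e: "x' \<in> zspan S1" "y' \<in> S2" "\<epsilon> = of_int k *\<^sub>R x' + y'" using a(2) Sh_long by blast
      have "even (m * k) \<or> is_lattice S1" using k_even by auto
      then have "x - of_int (m * k) *\<^sub>R x' \<in> S1" by (rule S1_shift[OF xy(1) e(1)])
      moreover have "y - of_int m *\<^sub>R y' \<in> zspan S2" by (rule L2(4)[OF xy(2) L2(3)[OF S2_sub[OF e(2)]]])
      moreover have "\<delta> - of_int m *\<^sub>R \<epsilon> = (x - of_int (m * k) *\<^sub>R x') + (y - of_int m *\<^sub>R y')"
        by (simp add: xy e algebra_simps)
      ultimately show ?thesis using Sh_short[OF True] by blast
    qed
  next
    case False
    then obtain x y where xy: "x \<in> zspan S1" "y \<in> S2" "\<delta> = of_int k *\<^sub>R x + y" using bt(2) Sh_long by blast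
    show "\<delta> - of_int m *\<^sub>R \<epsilon> \<in> Sh \<beta>"
    proof (cases "short \<alpha>")
      case sa: True
      then obtain x' y' where e: "x' \<in> S1" "y' \<in> zspan S2" "\<epsilon> = x' + y'" using a(2) Sh_short by blast
      obtain j where j: "m = k * j"
        using roots.n_long_short[OF a(1) bt(1) sa False] that[of "roots.n \<alpha> \<beta>"] by (simp add: m_def)
      have "x - of_int j *\<^sub>R x' \<in> zspan S1" by (rule L1(4)[OF xy(1) L1(3)[OF S1_sub[OF e(1)]]])
      moreover have "y - of_int (k * j) *\<^sub>R y' \<in> S2"
        by (rule S2_shift[OF xy(2) e(2)]) (use k_even in auto)
      moreover have "\<delta> - of_int m *\<^sub>R \<epsilon> = of_int k *\<^sub>R (x - of_int j *\<^sub>R x') + (y - of_int (k * j) *\<^sub>R y')"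
        by (simp add: xy e j algebra_simps)
      ultimately show ?thesis using Sh_long[OF False] by blast
    next
      case la: False
      then obtain x' y' where e: "x' \<in> zspan S1" "y' \<in> S2" "\<epsilon> = of_int k *\<^sub>R x' + y'" using a(2) Sh_long by blast
      have "even m \<or> is_lattice S2"
        using roots.even_long[OF _ a(1) bt(1) la False] lattice_if_not_C unfolding m_def by blast
      then have "y - of_int m *\<^sub>R y' \<in> S2" by (rule S2_shift[OF xy(2) S2_sub[OF e(2)]])
      moreover have "x - of_int m *\<^sub>R x' \<in> zspan S1" by (rule L1(4)[OF xy(1) L1(3)[OF e(1)]])
      moreover have "\<delta> - of_int m *\<^sub>R \<epsilon> = of_int k *\<^sub>R (x - of_int m *\<^sub>R x') + (y - of_int m *\<^sub>R y')"
        by (simp add: xy e algebra_simps)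
      ultimately show ?thesis using Sh_long[OF False] by blast
    qed
  qed
qed

lemma sg_conj:
  assumes a: "\<alpha> \<in> \<Phi>" "\<epsilon> \<in> Sh \<alpha>" and bt: "\<beta> \<in> \<Phi>" "\<delta> \<in> Sh \<beta>"
  shows "sg \<alpha> \<epsilon> \<otimes>\<^bsub>conj_group B R\<^esub> (sg \<beta> \<delta> \<otimes>\<^bsub>conj_group B R\<^esub> sg \<alpha> \<epsilon>) =
    sg (reflection B \<alpha> \<beta>) (\<delta> - of_int (roots.n \<beta> \<alpha>) *\<^sub>R \<epsilon>)"
proof -
  let ?N = "nonisotropic B R" and ?E = "conj_relations B R"
  have rad: "\<epsilon> \<in> V1 + V2" "\<delta> \<in> V1 + V2" using a bt Sh_rad by auto
  have N: "\<alpha> + \<epsilon> \<in> ?N" "\<beta> + \<delta> \<in> ?N" using a bt in_nonisotropic by auto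
  have "reflection B (\<alpha> + \<epsilon>) (\<beta> + \<delta>) = \<beta> + \<delta> - (2 * B \<beta> \<alpha> / B \<alpha> \<alpha>) *\<^sub>R (\<alpha> + \<epsilon>)"
    using rad by (simp add: reflection_alt[OF form_bilinear] B_shift)
  also have "\<dots> = reflection B \<alpha> \<beta> + (\<delta> - of_int (roots.n \<beta> \<alpha>) *\<^sub>R \<epsilon>)"
    using roots.of_int_n[OF a(1) bt(1)] by (simp add: reflection_alt[OF form_bilinear] algebra_simps)
  finally have r: "reflection B (\<alpha> + \<epsilon>) (\<beta> + \<delta>) = reflection B \<alpha> \<beta> + (\<delta> - of_int (roots.n \<beta> \<alpha>) *\<^sub>R \<epsilon>)" .
  have "Sh (reflection B \<alpha> \<beta>) = Sh \<beta>" using roots.is_short_r[OF a(1)] by (simp add: Sh_def)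
  then have rN: "reflection B (\<alpha> + \<epsilon>) (\<beta> + \<delta>) \<in> ?N"
    unfolding r using in_nonisotropic[OF roots.r_in[OF a(1) bt(1)]] Sh_shift[OF a bt] by simp
  have rel: "([(\<alpha> + \<epsilon>, True), (\<beta> + \<delta>, True), (\<alpha> + \<epsilon>, True)], [(reflection B (\<alpha> + \<epsilon>) (\<beta> + \<delta>), True)])
      \<in> pres_rel ?N ?E"
    by (rule pres_relator) (use N rN in \<open>auto simp: conj_relations_def\<close>)
  have w: "[(\<alpha> + \<epsilon>, True)] \<in> words ?N" "[(\<beta> + \<delta>, True)] \<in> words ?N"
    "[(\<beta> + \<delta>, True), (\<alpha> + \<epsilon>, True)] \<in> words ?N" using N by auto
  show ?thesis
    using pres_class_eq[THEN iffD2, OF _ _ rel] N rN w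
    by (simp add: sg_def conj_gen_def pres_gen_def conj_group_def presented_group_mult r)
qed

lemma sg_sq:
  assumes a: "\<alpha> \<in> \<Phi>" "\<epsilon> \<in> Sh \<alpha>"
  shows "sg \<alpha> \<epsilon> \<otimes>\<^bsub>conj_group B R\<^esub> sg \<alpha> \<epsilon> = \<one>\<^bsub>conj_group B R\<^esub>"
proof -
  let ?N = "nonisotropic B R" and ?E = "conj_relations B R"
  have N: "\<alpha> + \<epsilon> \<in> ?N" using a in_nonisotropic by auto
  have rel: "([(\<alpha> + \<epsilon>, True), (\<alpha> + \<epsilon>, True)], []) \<in> pres_rel ?N ?E"
    by (rule pres_relator) (use N in \<open>auto simp: conj_relations_def\<close>)
  show ?thesis
    using pres_class_eq[THEN iffD2, OF _ _ rel] N
    by (simp add: sg_def conj_gen_def pres_gen_def conj_group_def presented_group_mult presented_group_one)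
qed

lemma sg_generate:
  "carrier (conj_group B R) = generate (conj_group B R) {sg \<alpha> \<epsilon> | \<alpha> \<epsilon>. \<alpha> \<in> \<Phi> \<and> \<epsilon> \<in> Sh \<alpha>}"
proof -
  let ?N = "nonisotropic B R" and ?E = "conj_relations B R"
  interpret group "conj_group B R" unfolding conj_group_def by (rule group_presented_group)
  have eq: "{sg \<alpha> \<epsilon> | \<alpha> \<epsilon>. \<alpha> \<in> \<Phi> \<and> \<epsilon> \<in> Sh \<alpha>} = pres_gen ?N ?E ` ?N"
    using nonisotropic_iff by (force simp: sg_def conj_gen_def)
  have "pres_gen ?N ?E ` ?N \<subseteq> carrier (conj_group B R)"
    using pres_gen_carrier by (auto simp: conj_group_def)
  then have "generate (conj_group B R) (pres_gen ?N ?E ` ?N) \<subseteq> carrier (conj_group B R)"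
    using generate_in_carrier by blast
  moreover have "carrier (conj_group B R) \<subseteq> generate (conj_group B R) (pres_gen ?N ?E ` ?N)"
    using word_generate by (auto simp: conj_group_def presented_group_carrier)
  ultimately show ?thesis unfolding eq by blast
qed

abbreviation "rp \<equiv> \<lambda>\<gamma>. if short \<gamma> then \<gamma>s else \<gamma>l"
abbreviation "ee \<equiv> \<lambda>\<gamma> j. if \<not> short \<gamma> \<and> j \<le> t then of_int k *\<^sub>R \<sigma> j else \<sigma> j"

lemma sigma_S: "j \<in> {1..\<nu>} \<Longrightarrow> j \<le> t \<Longrightarrow> \<sigma> j \<in> S1" "j \<in> {1..\<nu>} \<Longrightarrow> \<not> j \<le> t \<Longrightarrow> \<sigma> j \<in> S2"
  using sigma1(1) sigma2(1) by (auto simp: image_subset_iff)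

lemma ShI_short: "short \<gamma> \<Longrightarrow> x \<in> S1 \<Longrightarrow> y \<in> zspan S2 \<Longrightarrow> x + y \<in> Sh \<gamma>"
  using Sh_short by blast

lemma ShI_long: "\<not> short \<gamma> \<Longrightarrow> x \<in> zspan S1 \<Longrightarrow> y \<in> S2 \<Longrightarrow> of_int k *\<^sub>R x + y \<in> Sh \<gamma>"
  using Sh_long by blast

lemma ee_Sh:
  assumes j: "j \<in> {1..\<nu>}"
  shows "ee \<gamma> j \<in> Sh \<gamma>"
proof (cases "short \<gamma>")
  case True
  then show ?thesis
    using ShI_short[OF True, of "\<sigma> j" 0] ShI_short[OF True, of 0 "\<sigma> j"] sigma_S[OF j] zero_S L2(1) S2_sub
    by (cases "j \<le> t") auto
next
  case False
  then show ?thesis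
    using ShI_long[OF False, of "\<sigma> j" 0] ShI_long[OF False, of 0 "\<sigma> j"] sigma_S[OF j] zero_S L1(1) S1_sub
    by (cases "j \<le> t") auto
qed

lemma ee_sum_short:
  assumes ij: "i \<in> {1..\<nu>}" "j \<in> {1..\<nu>}" "t < j" and g: "short \<gamma>"
  shows "ee \<gamma> i + ee \<gamma> j \<in> Sh \<gamma>"
proof -
  have j: "\<sigma> j \<in> zspan S2" using sigma_S(2)[OF ij(2)] ij(3) S2_sub by simp
  show ?thesis
    using ShI_short[OF g, of "\<sigma> i" "\<sigma> j"] ShI_short[OF g, of 0 "\<sigma> i + \<sigma> j"] sigma_S[OF ij(1)] zero_S j
      L2(2)[OF S2_sub j] g
    by (cases "i \<le> t") auto
qed

lemma ee_sum_long:
  assumes ij: "i \<in> {1..\<nu>}" "j \<in> {1..\<nu>}" "i \<le> t" and g: "\<not> short \<gamma>"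
  shows "ee \<gamma> i + ee \<gamma> j \<in> Sh \<gamma>"
proof -
  have i: "\<sigma> i \<in> zspan S1" using sigma_S(1)[OF ij(1)] ij(3) S1_sub by simp
  show ?thesis
    using ShI_long[OF g, of "\<sigma> i" "\<sigma> j"] ShI_long[OF g, of "\<sigma> i + \<sigma> j" 0] sigma_S[OF ij(2)] zero_S i
      L1(2)[OF i S1_sub] g ij(3)
    by (cases "j \<le> t") (auto simp: scaleR_right_distrib)
qed

lemma split_index: "{1..\<nu>} = {1..t} \<union> {t+1..\<nu>}" "{1..t} \<inter> {t+1..\<nu>} = {}"
  using twist_le by auto

lemma ee_span:
  assumes v: "v \<in> Sh \<gamma>"
  shows "\<exists>m :: nat \<Rightarrow> int. v = (\<Sum>j\<in>{1..\<nu>}. of_int (m j) *\<^sub>R ee \<gamma> j)"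
proof -
  define \<kappa> :: int where "\<kappa> = (if short \<gamma> then 1 else k)"
  obtain x y where xy: "x \<in> zspan S1" "y \<in> zspan S2" "v = of_int \<kappa> *\<^sub>R x + y"
  proof (cases "short \<gamma>")
    case True
    then obtain x y where "x \<in> S1" "y \<in> zspan S2" "v = x + y" using v Sh_short by blast
    then show thesis using that[of x y] True S1_sub by (simp add: \<kappa>_def)
  next
    case False
    then obtain x y where "x \<in> zspan S1" "y \<in> S2" "v = of_int k *\<^sub>R x + y" using v Sh_long by blast
    then show thesis using that[of x y] False S2_sub by (simp add: \<kappa>_def)
  qed
  obtain c1 :: "nat \<Rightarrow> int" where c1: "x = (\<Sum>i\<in>{1..t}. of_int (c1 i) *\<^sub>R \<sigma> i)"
    using zbasisE[OF sigma1(2) xy(1)] by blast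
  obtain c2 :: "nat \<Rightarrow> int" where c2: "y = (\<Sum>i\<in>{t+1..\<nu>}. of_int (c2 i) *\<^sub>R \<sigma> i)"
    using zbasisE[OF sigma2(2) xy(2)] by blast
  have "(\<Sum>j\<in>{1..\<nu>}. of_int (if j \<le> t then c1 j else c2 j) *\<^sub>R ee \<gamma> j)
      = (\<Sum>j\<in>{1..t}. of_int (if j \<le> t then c1 j else c2 j) *\<^sub>R ee \<gamma> j)
        + (\<Sum>j\<in>{t+1..\<nu>}. of_int (if j \<le> t then c1 j else c2 j) *\<^sub>R ee \<gamma> j)"
    unfolding split_index(1) by (rule sum.union_disjoint) (use split_index(2) in auto)
  also have "(\<Sum>j\<in>{1..t}. of_int (if j \<le> t then c1 j else c2 j) *\<^sub>R ee \<gamma> j) = of_int \<kappa> *\<^sub>R x"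
    unfolding c1 scaleR_sum_right by (rule sum.cong) (auto simp: \<kappa>_def)
  also have "(\<Sum>j\<in>{t+1..\<nu>}. of_int (if j \<le> t then c1 j else c2 j) *\<^sub>R ee \<gamma> j) = y"
    unfolding c2 by (rule sum.cong) auto
  finally have "(\<Sum>j\<in>{1..\<nu>}. of_int (if j \<le> t then c1 j else c2 j) *\<^sub>R ee \<gamma> j) = v"
    unfolding xy(3) .
  then show ?thesis by (intro exI[of _ "\<lambda>j. if j \<le> t then c1 j else c2 j"]) (rule sym)
qed

text \<open>
  Shifts of long roots realize the directions beyond \<open>t\<close> for short roots. Shifts of short roots
  realize the first \<open>t\<close> directions for long roots, as the Cartan integer supplies the factor \<open>k\<close>.
  The remaining directions need a neighbour of the same length.
\<close>

lemma ee_good: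
  assumes g: "\<gamma> \<in> {\<gamma>s, \<gamma>l}" and j: "j \<in> {1..\<nu>} - Dset \<gamma>"
  shows "\<exists>\<alpha>\<in>\<Phi>. \<exists>i\<in>{1..\<nu>}. \<exists>u. ee \<gamma> j = of_int (roots.n \<gamma> \<alpha>) *\<^sub>R (of_int u *\<^sub>R ee \<alpha> i)"
proof -
  have wit: ?thesis if "\<alpha> \<in> \<Phi>" "ee \<gamma> j = - (of_int (roots.n \<gamma> \<alpha>) *\<^sub>R ee \<alpha> j)" for \<alpha>
    using that j by (intro bexI[of _ \<alpha>] bexI[of _ j] exI[of _ "- 1"]) auto
  show ?thesis
  proof (cases "\<gamma> = \<gamma>s")
    case True
    have gs: "short \<gamma>" using True roots.is_short_reps by simp
    show ?thesis
    proof (cases "\<exists>m. X = TypeB m")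
      case True': True
      then have "\<not> j \<le> t" using j gs by (auto simp: Dset_def)
      then show ?thesis
        using wit[OF roots.reps_in(2)] roots.n_reps(1) True by simp
    next
      case False
      then obtain \<alpha> where "\<alpha> \<in> \<Phi>" "short \<alpha>" "roots.n \<gamma>s \<alpha> = - 1" using roots.short_neighbour by blast
      then show ?thesis using wit[of \<alpha>] True gs by simp
    qed
  next
    case False
    then have gl: "\<gamma> = \<gamma>l" "\<not> short \<gamma>" using g roots.is_short_reps by auto
    show ?thesis
    proof (cases "X = TypeB 2 \<or> (\<exists>m. X = TypeC m)")
      case True
      then have "j \<le> t" using j gl(2) by (auto simp: Dset_def)
      then show ?thesis
        using wit[OF roots.reps_in(1)] roots.n_reps(2) gl roots.is_short_reps by simp
    next
      case False
      then obtain \<alpha> where "\<alpha> \<in> \<Phi>" "\<not> short \<alpha>" "roots.n \<gamma>l \<alpha> = - 1" using roots.long_neighbour by blast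
      then show ?thesis using wit[of \<alpha>] gl by simp
    qed
  qed
qed

lemma Dset_sub: "Dset \<gamma> \<subseteq> {1..\<nu>}"
  using twist_le by (auto simp: Dset_def)

sublocale W: affine_reflection_group "conj_group B R" \<Phi> Sh roots.n "reflection B" sg b "type_rank X"
    \<gamma>s \<gamma>l short k \<nu> t \<sigma> Dset rp ee
proof -
  interpret grp: group "conj_group B R" unfolding conj_group_def by (rule group_presented_group)
  show "affine_reflection_group (conj_group B R) \<Phi> Sh roots.n (reflection B) sg b (type_rank X)
    \<gamma>s \<gamma>l short k \<nu> t \<sigma> Dset"
  proof (unfold_locales, goal_cases)
    case (1 \<alpha> \<beta>) then show ?case by (rule roots.r_in)
  next
    case (2 \<alpha>) then show ?case by (rule roots.r_self)
  next
    case (3 \<alpha> \<beta>) then show ?case using roots.refl(1) by blast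
  next
    case (4 \<alpha>) then show ?case by (rule roots.n_self)
  next
    case (5 \<alpha> \<beta>) then show ?case by (rule roots.n_refl)
  next
    case (6 \<alpha> \<beta>) then show ?case by (simp add: Sh_def roots.is_short_r)
  next
    case (7 \<alpha>) show ?case by (rule Sh_zero)
  next
    case (8 \<alpha> \<beta> \<epsilon> \<delta>) then show ?case by (intro Sh_shift)
  next
    case (9 \<alpha> \<epsilon>)
    then show ?case
      using pres_gen_carrier[OF in_nonisotropic] by (simp add: sg_def conj_gen_def conj_group_def)
  next
    case (10 \<alpha> \<epsilon>) then show ?case by (rule sg_sq)
  next
    case (11 \<alpha> \<beta> \<epsilon> \<delta>) then show ?case by (intro sg_conj)
  next
    case 12 then show ?case by (rule sg_generate)
  next
    case (13 i) then show ?case by (rule roots.b_in)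
  next
    case 14 then show ?case using roots.nodes_in by blast
  next
    case 15 then show ?case using roots.nodes_in by blast
  next
    case 16 then show ?case by (rule roots.is_short_reps)
  next
    case 17 then show ?case by (rule roots.is_short_reps)
  next
    case (18 \<alpha> \<beta>) show ?case by (rule roots.is_short_r[OF 18(1)])
  next
    case 19 then show ?case by (rule roots.n_reps)
  next
    case 20 then show ?case by (rule roots.n_reps)
  next
    case (21 \<gamma>) then show ?case by (rule roots.orbit_rep)
  next
    case (22 \<gamma> j) then show ?case by (intro ee_Sh)
  next
    case (23 \<gamma> v) then show ?case by (intro ee_span)
  next
    case (24 i j) then show ?case using ee_sum_short roots.is_short_reps by blast
  next
    case (25 i j) then show ?case using ee_sum_long roots.is_short_reps by blast
  next
    case (26 \<gamma>) then show ?case by (rule Dset_sub)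
  next
    case (27 \<gamma> j) then show ?case by (intro ee_good)
  qed
qed

end

context ears_presentation
begin

section \<open>The action of the Weyl group\<close>

abbreviation "G \<equiv> conj_group B R"
abbreviation "Vt \<equiv> ext_space Vd"

lemma group_W: "group (weyl_group B Vd R)"
  unfolding weyl_group_def
  by (rule group.group_subgroup_generated[OF group_GL_group[OF subspace_ext_space]])

lemma psi_hom: "group_hom G (weyl_group B Vd R) \<psi>"
  using psi_epi group_W W.is_group
  by (simp add: group_hom_def group_hom_axioms_def epi_def)

lemma W_carrier: "f \<in> carrier (weyl_group B Vd R) \<Longrightarrow> f \<in> Bij Vt"
  using group.carrier_subgroup_generated_subset[OF group_GL_group[OF subspace_ext_space[of Vd]]]
  by (fastforce simp: weyl_group_def GL_group_def)

lemma psi_T: "x \<in> carrier G \<Longrightarrow> u \<in> Vt \<Longrightarrow> \<psi> x u \<in> Vt"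
  using W_carrier[OF group_hom.hom_closed[OF psi_hom]] by (auto simp: Bij_def bij_betw_def)

lemma psi_mult:
  assumes x: "x \<in> carrier G" and y: "y \<in> carrier G" and u: "u \<in> Vt"
  shows "\<psi> (x \<otimes>\<^bsub>G\<^esub> y) u = \<psi> x (\<psi> y u)"
proof -
  have "\<psi> (x \<otimes>\<^bsub>G\<^esub> y) = \<psi> x \<otimes>\<^bsub>weyl_group B Vd R\<^esub> \<psi> y"
    using group_hom.hom_mult[OF psi_hom x y] .
  also have "\<dots> = compose Vt (\<psi> x) (\<psi> y)"
    using W_carrier[OF group_hom.hom_closed[OF psi_hom x]] W_carrier[OF group_hom.hom_closed[OF psi_hom y]]
    by (simp add: weyl_group_def subgroup_generated_def GL_group_def BijGroup_def)
  finally show ?thesis using u by (simp add: compose_def)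
qed

lemma one_W: "\<one>\<^bsub>weyl_group B Vd R\<^esub> = (\<lambda>x\<in>Vt. x)"
  by (simp add: weyl_group_def subgroup_generated_def GL_group_def BijGroup_def)

lemma psi_one: "u \<in> Vt \<Longrightarrow> \<psi> \<one>\<^bsub>G\<^esub> u = u"
  using group_hom.hom_one[OF psi_hom] one_W by simp

lemma psi_inv: "x \<in> carrier G \<Longrightarrow> u \<in> Vt \<Longrightarrow> \<psi> (inv\<^bsub>G\<^esub> x) (\<psi> x u) = u"
  using psi_mult[of "inv\<^bsub>G\<^esub> x" x u] psi_one[of u] by simp

lemma T_iff: "(v, f) \<in> Vt \<longleftrightarrow> (\<forall>w\<in>Vd. blinfun_apply f w = 0)"
  by (simp add: ext_space_def)

lemma T_zero: "(v, 0) \<in> Vt"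
  by (simp add: T_iff)

lemma root_Vd: "\<gamma> \<in> \<Phi> \<Longrightarrow> \<gamma> \<in> Vd"
  using finite_roots span_base[of \<gamma> Rd] by (auto simp: root_system_of_type_def finite_root_system_def)

definition N :: "'v \<Rightarrow> 'v \<Rightarrow> real" where
  "N v \<gamma> = 2 * B v \<gamma> / B \<gamma> \<gamma>"

lemma N_simps:
  "N (u + v) \<gamma> = N u \<gamma> + N v \<gamma>" "N (u - v) \<gamma> = N u \<gamma> - N v \<gamma>" "N (c *\<^sub>R v) \<gamma> = c * N v \<gamma>"
  by (simp_all add: N_def bilinear_ladd[OF form_bilinear] bilinear_lsub[OF form_bilinear]
      bilinear_lmul[OF form_bilinear] add_divide_distrib diff_divide_distrib distrib_left right_diff_distrib)

lemma N_rad: "w \<in> V1 + V2 \<Longrightarrow> N w \<gamma> = 0"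
  using B_rad(1) by (simp add: N_def)

lemma N_self: "\<gamma> \<in> \<Phi> \<Longrightarrow> N \<gamma> \<gamma> = 2"
  using roots.norm_pos[of \<gamma>] by (simp add: N_def)

lemma psi_sg:
  assumes g: "\<gamma> \<in> \<Phi>" "\<delta> \<in> Sh \<gamma>" and f: "(v, f) \<in> Vt"
  shows "\<psi> (sg \<gamma> \<delta>) (v, f) = (v - (N v \<gamma> + 2 / B \<gamma> \<gamma> * blinfun_apply f \<delta>) *\<^sub>R (\<gamma> + \<delta>), f)"
proof -
  have d: "\<delta> \<in> V1 + V2" using Sh_rad[OF g(2)] .
  have "blinfun_apply f (\<gamma> + \<delta>) = blinfun_apply f \<delta>"
    using f root_Vd[OF g(1)] by (simp add: T_iff blinfun.bilinear_simps)
  moreover have "B v (\<gamma> + \<delta>) = B v \<gamma>" "B (\<gamma> + \<delta>) (\<gamma> + \<delta>) = B \<gamma> \<gamma>"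
    using B_shift[of 0 \<delta> v \<gamma>] B_shift[OF d d] d subspace_0[OF subspace_V0] by simp_all
  ultimately have "ext_form B (v, f) (\<gamma> + \<delta>, 0) = B v \<gamma> + blinfun_apply f \<delta>"
    "ext_form B (\<gamma> + \<delta>, 0) (\<gamma> + \<delta>, 0) = B \<gamma> \<gamma>" by (simp_all add: ext_form_def)
  then have "reflection (ext_form B) (\<gamma> + \<delta>, 0) (v, f)
      = (v, f) - (2 * (B v \<gamma> + blinfun_apply f \<delta>) / B \<gamma> \<gamma>) *\<^sub>R (\<gamma> + \<delta>, 0)"
    by (simp only: reflection_alt[OF ext_form_bilinear[OF form_bilinear]])
  then show ?thesis
    using psi_gen[OF in_nonisotropic[OF g]] f
    by (simp add: sg_def weyl_reflection_def N_def add_divide_distrib distrib_left)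
qed

text \<open>
  The multiple of \<open>\<gamma>\<close> that a dual component contributes is moved in turn by the next lift, which is
  why two lifts commute only up to a twist along the radical.
\<close>

lemma psi_F:
  assumes g: "\<gamma> \<in> \<Phi>" "\<delta> \<in> Sh \<gamma>" and f: "(v, f) \<in> Vt"
  defines "q \<equiv> 2 / B \<gamma> \<gamma> * blinfun_apply f \<delta>"
  shows "\<psi> (W.F \<gamma> \<delta>) (v, f) = (v + (N v \<gamma> - q) *\<^sub>R \<delta> - q *\<^sub>R \<gamma>, f)"
proof -
  have 1: "\<psi> (sg \<gamma> 0) (v, f) = (v - N v \<gamma> *\<^sub>R \<gamma>, f)"
    using psi_sg[OF g(1) Sh_zero f] by simp
  have f': "(v - N v \<gamma> *\<^sub>R \<gamma>, f) \<in> Vt" using f by (simp add: T_iff)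
  have "\<psi> (W.F \<gamma> \<delta>) (v, f) = \<psi> (sg \<gamma> \<delta>) (\<psi> (sg \<gamma> 0) (v, f))"
    unfolding W.F_def by (rule psi_mult) (use g f Sh_zero in auto)
  also have "\<dots> = (v - N v \<gamma> *\<^sub>R \<gamma> - (- N v \<gamma> + q) *\<^sub>R (\<gamma> + \<delta>), f)"
    unfolding 1 psi_sg[OF g f'] q_def using N_self[OF g(1)] by (simp add: N_simps)
  finally show ?thesis by (simp add: algebra_simps)
qed

text \<open>
  On vectors without a dual component the affine part acts by translations along the radical.
\<close>

definition moves :: "('v \<times> bool) list set \<Rightarrow> ('v \<Rightarrow> 'v) \<Rightarrow> bool" where
  "moves x \<tau> \<longleftrightarrow> x \<in> carrier G \<and> (\<forall>v. \<tau> v \<in> V1 + V2) \<and>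
     (\<forall>v w. w \<in> V1 + V2 \<longrightarrow> \<tau> (v + w) = \<tau> v) \<and> (\<forall>v. \<psi> x (v, 0) = (v + \<tau> v, 0))"

lemma moves_one: "moves \<one>\<^bsub>G\<^esub> (\<lambda>_. 0)"
  using subspace_0[OF subspace_V0] by (simp add: moves_def psi_one T_zero)

lemma moves_mult:
  assumes "moves x \<tau>" "moves y \<tau>'"
  shows "moves (x \<otimes>\<^bsub>G\<^esub> y) (\<lambda>v. \<tau>' v + \<tau> v)"
  using assms subspace_add[OF subspace_V0]
  by (auto simp: moves_def psi_mult T_zero add.assoc)

lemma moves_inv:
  assumes x: "moves x \<tau>" shows "moves (inv\<^bsub>G\<^esub> x) (\<lambda>v. - \<tau> v)"
proof -
  have c: "x \<in> carrier G" "\<And>v. \<tau> v \<in> V1 + V2" "\<And>v w. w \<in> V1 + V2 \<Longrightarrow> \<tau> (v + w) = \<tau> v"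
    "\<And>v. \<psi> x (v, 0) = (v + \<tau> v, 0)" using x by (auto simp: moves_def)
  have m: "- \<tau> v \<in> V1 + V2" for v using subspace_neg[OF subspace_V0 c(2)] .
  have "\<psi> (inv\<^bsub>G\<^esub> x) (v, 0) = (v + - \<tau> v, 0)" for v
    using psi_inv[OF c(1) T_zero, of "v + - \<tau> v"] c(4)[of "v + - \<tau> v"] c(3)[OF m, of v v] by simp
  then show ?thesis using c m by (simp add: moves_def)
qed

lemma moves_F:
  assumes "\<gamma> \<in> \<Phi>" "\<delta> \<in> Sh \<gamma>" shows "moves (W.F \<gamma> \<delta>) (\<lambda>v. N v \<gamma> *\<^sub>R \<delta>)"
  using psi_F[OF assms T_zero] assms subspace_scale[OF subspace_V0 Sh_rad[OF assms(2)]]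
  by (simp add: moves_def N_simps N_rad)

lemma moves_lprod:
  assumes "\<And>p. p \<in> set ps \<Longrightarrow> \<alpha> p \<in> \<Phi> \<and> x p \<in> Sh (\<alpha> p)"
  shows "moves (W.lprod (\<lambda>p. W.F (\<alpha> p) (x p)) ps m) (\<lambda>v. \<Sum>p\<leftarrow>ps. (N v (\<alpha> p) * of_int (m p)) *\<^sub>R x p)"
  using assms
proof (induction ps)
  case Nil
  show ?case using moves_one by simp
next
  case (Cons p ps)
  have p: "\<alpha> p \<in> \<Phi>" "x p \<in> Sh (\<alpha> p)" using Cons.prems by auto
  have 1: "moves (W.F (\<alpha> p) (x p) [^]\<^bsub>G\<^esub> m p) (\<lambda>v. N v (\<alpha> p) *\<^sub>R (of_int (m p) *\<^sub>R x p))"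
    unfolding W.F_int[OF p, symmetric] by (rule moves_F) (use p in auto)
  have 2: "moves (W.lprod (\<lambda>p. W.F (\<alpha> p) (x p)) ps m) (\<lambda>v. \<Sum>p\<leftarrow>ps. (N v (\<alpha> p) * of_int (m p)) *\<^sub>R x p)"
    by (rule Cons.IH) (use Cons.prems in auto)
  show ?case using moves_mult[OF 1 2] by (simp add: add.commute)
qed

lemma moves_cong: "moves x \<tau> \<Longrightarrow> (\<And>v. \<tau> v = \<tau>' v) \<Longrightarrow> moves x \<tau>'"
  by (metis ext)

lemma moves_c:
  assumes "\<gamma> \<in> \<Phi>" "\<delta> \<in> Sh \<gamma>" "\<epsilon> \<in> Sh \<gamma>" "\<delta> + \<epsilon> \<in> Sh \<gamma>"
  shows "moves (W.c \<gamma> \<delta> \<epsilon>) (\<lambda>_. 0)"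
  unfolding W.c_def
  by (rule moves_cong[OF moves_mult[OF moves_F moves_mult[OF moves_inv[OF moves_F] moves_inv[OF moves_F]]]])
    (use assms in \<open>auto simp: scaleR_right_distrib\<close>)

lemma moves_plane_gen:
  assumes "\<gamma> \<in> \<Phi>" "\<delta> \<in> Sh \<gamma>" "\<epsilon> \<in> Sh \<gamma>"
  shows "moves (W.plane_gen \<gamma> \<delta> \<epsilon>) (\<lambda>_. 0)"
  using moves_c[of \<gamma> \<delta> \<epsilon>] moves_c[of \<gamma> \<delta> "2 *\<^sub>R \<epsilon>"] W.S_plus_2(1)[of \<gamma> \<epsilon> \<delta>] W.S_plus_2(1)[of \<gamma> \<epsilon> 0] assms
  by (simp add: W.plane_gen_def)

lemma moves_z:
  assumes "p \<in> W.zidx" shows "moves (W.z p) (\<lambda>_. 0)"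
  using assms
proof (cases rule: W.zidx_cases)
  case (1 \<gamma> J js)
  have S: "(\<Sum>j\<in>J. ee \<gamma> j) \<in> Sh \<gamma>" using 1(3) by (simp add: W.fam_def)
  have q: "moves (W.lprod (\<lambda>j. W.F \<gamma> (ee \<gamma> j)) js (\<lambda>_. 1)) (\<lambda>v. \<Sum>j\<leftarrow>js. (N v \<gamma> * of_int 1) *\<^sub>R ee \<gamma> j)"
  proof (rule moves_lprod)
    fix j assume "j \<in> set js"
    then have "j \<in> {1..\<nu>}" using 1(4,6) by blast
    then show "\<gamma> \<in> \<Phi> \<and> ee \<gamma> j \<in> Sh \<gamma>" using 1(2) ee_Sh by blast
  qed
  show ?thesis
    unfolding 1(7)
    by (rule moves_cong[OF moves_mult[OF moves_F[OF 1(2) S] moves_inv[OF q]]])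
      (use 1 in \<open>simp add: sum_list_distinct_conv_sum_set scaleR_sum_right\<close>)
qed

lemma moves_generate:
  assumes "\<And>h. h \<in> H \<Longrightarrow> moves h (\<lambda>_. 0)" "x \<in> generate G H"
  shows "moves x (\<lambda>_. 0)"
  using assms(2)
proof induction
  case one show ?case by (rule moves_one)
next
  case (incl h) then show ?case by (rule assms(1))
next
  case (inv h) then show ?case using moves_inv[OF assms(1)] by simp
next
  case (eng h1 h2) then show ?case using moves_mult by fastforce
qed

lemma g_eq:
  "W.g (i, j) = (let \<gamma> = if i \<le> t then \<gamma>s else \<gamma>l in W.plane_gen \<gamma> (ee \<gamma> i) (ee \<gamma> j))"
  unfolding W.g_def Let_def by (cases "i \<le> t") auto

lemma moves_g:
  assumes "p \<in> W.pairs" shows "moves (W.g p) (\<lambda>_. 0)"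
proof -
  obtain i j where p: "p = (i, j)" "i \<in> {1..\<nu>}" "j \<in> {1..\<nu>}" using assms by (auto simp: W.pairs_def)
  define \<gamma> where "\<gamma> = (if i \<le> t then \<gamma>s else \<gamma>l)"
  have g: "\<gamma> \<in> \<Phi>" using roots.reps_in by (simp add: \<gamma>_def)
  show ?thesis
    unfolding p(1) g_eq Let_def \<gamma>_def[symmetric]
    by (rule moves_plane_gen[OF g ee_Sh[OF p(2)] ee_Sh[OF p(3)]])
qed

lemma moves_A: "a \<in> W.A \<Longrightarrow> moves a (\<lambda>_. 0)"
proof -
  have A0: "moves a (\<lambda>_. 0)" if "a \<in> W.A0" for a
    by (rule moves_generate[OF _ that[unfolded W.A0_def]]) (use moves_g in auto)
  show "moves a (\<lambda>_. 0)" if "a \<in> W.A"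
    by (rule moves_generate[OF _ that[unfolded W.A_def]]) (use A0 moves_z in auto)
qed

lemma psi_wd:
  "set is \<subseteq> {1..type_rank X} \<Longrightarrow> \<psi> (W.wd is) (v, 0) = (W.act is v, 0)"
proof (induction "is")
  case Nil then show ?case using psi_one[OF T_zero] by simp
next
  case (Cons i "is")
  have bi: "b i \<in> \<Phi>" using roots.b_in Cons.prems by simp
  have "\<psi> (W.wd (i # is)) (v, 0) = \<psi> (sg (b i) 0) (\<psi> (W.wd is) (v, 0))"
    unfolding W.wd_simps by (rule psi_mult) (use bi Cons.prems T_zero in auto)
  then show ?case
    using Cons psi_sg[OF bi Sh_zero T_zero] by (simp add: reflection_alt[OF form_bilinear] N_def)
qed

section \<open>Coordinates on the radical\<close>

text \<open>
  The basis shifts together with a basis of \<open>Vd\<close> span the space and are no more than its dimension,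
  so they are linearly independent over the reals and admit coordinate functionals.
\<close>

lemma dual_basis:
  assumes j: "j \<in> {1..\<nu>}"
  shows "\<exists>f :: 'v \<Rightarrow>\<^sub>L real. (\<forall>v\<in>Vd. blinfun_apply f v = 0) \<and>
    (\<forall>i\<in>{1..\<nu>}. blinfun_apply f (\<sigma> i) = (if i = j then 1 else 0))"
proof -
  have sum_dim: "dim (P + Q) = dim P + dim Q"
    if "subspace P" "subspace Q" "P \<inter> Q = {0}" for P Q :: "'v set"
  proof -
    have "P + Q = {x + y |x y. x \<in> P \<and> y \<in> Q}" by (auto simp: set_plus_def)
    then show ?thesis using dim_sums_Int[OF that(1,2)] that(3) by simp
  qed
  have dim: "dim (UNIV :: 'v set) = dim Vd + \<nu>"
    using sum_dim[OF subspaces(1) subspace_V0 V_direct] sum_dim[OF subspaces(2,3) radical_direct]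
      V_sum dim_V1 dim_V2 twist_le by simp
  obtain E where E: "E \<subseteq> Vd" "independent E" "Vd \<subseteq> span E" "card E = dim Vd"
    using basis_exists by blast
  have finE: "finite E" using independent_imp_finite[OF E(2)] .
  let ?s = "\<sigma> ` {1..\<nu>}"
  let ?W = "E \<union> ?s"
  have lat: "zspan S1 \<subseteq> span ?s" "zspan S2 \<subseteq> span ?s"
  proof -
    have c: "(\<Sum>i\<in>I. of_int (c i) *\<^sub>R \<sigma> i) \<in> span ?s" if "I \<subseteq> {1..\<nu>}" for I and c :: "nat \<Rightarrow> int"
      by (intro span_sum span_scale span_base) (use that in auto)
    show "zspan S1 \<subseteq> span ?s"
    proof
      fix x assume "x \<in> zspan S1"
      then obtain d :: "nat \<Rightarrow> int" where "x = (\<Sum>i\<in>{1..t}. of_int (d i) *\<^sub>R \<sigma> i)"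
        using zbasisE[OF sigma1(2)] by blast
      then show "x \<in> span ?s" using c[of "{1..t}" d] twist_le by simp
    qed
    show "zspan S2 \<subseteq> span ?s"
    proof
      fix x assume "x \<in> zspan S2"
      then obtain d :: "nat \<Rightarrow> int" where "x = (\<Sum>i\<in>{t+1..\<nu>}. of_int (d i) *\<^sub>R \<sigma> i)"
        using zbasisE[OF sigma2(2)] by blast
      then show "x \<in> span ?s" using c[of "{t+1..\<nu>}" d] by simp
    qed
  qed
  have "V1 = span S1" "V2 = span S2"
    using semilattice_S1 semilattice_S2 by (auto simp: semilattice_in_def)
  then have "V1 \<subseteq> span ?s" "V2 \<subseteq> span ?s"
    using lat zspan_superset span_minimal[OF _ subspace_span] by (metis subset_trans)+
  then have V: "V1 \<subseteq> span ?W" "V2 \<subseteq> span ?W" "Vd \<subseteq> span ?W"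
    using span_mono[of ?s ?W] span_mono[of E ?W] E(3) by auto
  have span: "UNIV \<subseteq> span ?W"
    using V unfolding V_sum[symmetric] by (auto elim!: set_plus_elim intro!: span_add)
  have card_s: "card ?s \<le> \<nu>" using card_image_le[of "{1..\<nu>}" \<sigma>] by simp
  have "dim (UNIV :: 'v set) \<le> card ?W" by (rule dim_le_card[OF span]) (use finE in simp)
  moreover have "card ?W \<le> card E + card ?s" by (rule card_Un_le)
  ultimately have "card ?s = \<nu>" "card ?W \<le> dim (UNIV :: 'v set)"
    using card_s dim E(4) by linarith+
  then have inj: "inj_on \<sigma> {1..\<nu>}" and ind: "independent ?W"
    using eq_card_imp_inj_on[of "{1..\<nu>}" \<sigma>] card_le_dim_spanning[of ?W UNIV] span finE by auto
  have disj: "\<sigma> i \<notin> Vd" if i: "i \<in> {1..\<nu>}" for i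
  proof
    assume "\<sigma> i \<in> Vd"
    moreover have "\<sigma> i \<in> V1 + V2" using sigma_S[OF i] S_V V12 by (cases "i \<le> t") auto
    ultimately have "\<sigma> i = 0" using V_direct by blast
    then show False using ind dependent_zero[of ?W] i by (metis UnI2 imageI)
  qed
  obtain h :: "'v \<Rightarrow> real" where h: "linear h" "\<And>x. x \<in> ?W \<Longrightarrow> h x = (if x = \<sigma> j then 1 else 0)"
    using linear_independent_extend[OF ind, of "\<lambda>x. if x = \<sigma> j then 1 else (0::real)"] by blast
  have bl: "blinfun_apply (Blinfun h) = h"
    using h(1) by (intro bounded_linear_Blinfun_apply linear_conv_bounded_linear[THEN iffD1])
  have "h x = 0" if "x \<in> E" for x using h(2)[of x] that disj[OF j] E(1) by auto
  then have "h v = 0" if "v \<in> span E" for v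
    using linear_eq_0_on_span[OF h(1) _ that] by blast
  moreover have "h (\<sigma> i) = (if i = j then 1 else 0)" if "i \<in> {1..\<nu>}" for i
    using h(2)[of "\<sigma> i"] that inj j by (auto simp: inj_on_eq_iff)
  ultimately show ?thesis using E(3) bl by (intro exI[of _ "Blinfun h"]) auto
qed

text \<open>Coordinates along the basis shifts, chosen to vanish on the finite part.\<close>

definition \<phi> :: "nat \<Rightarrow> 'v \<Rightarrow>\<^sub>L real" where
  "\<phi> j = (SOME f. (\<forall>v\<in>Vd. blinfun_apply f v = 0) \<and>
    (\<forall>i\<in>{1..\<nu>}. blinfun_apply f (\<sigma> i) = (if i = j then 1 else 0)))"

lemma \<phi>:
  assumes "j \<in> {1..\<nu>}"
  shows "v \<in> Vd \<Longrightarrow> \<phi> j v = 0" "i \<in> {1..\<nu>} \<Longrightarrow> \<phi> j (\<sigma> i) = (if i = j then 1 else 0)" "(v, \<phi> j) \<in> Vt"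
  using someI_ex[OF dual_basis[OF assms]] unfolding \<phi>_def T_iff by blast+

text \<open>
  Defects move a vector along the radical by an amount determined by its dual component alone.
\<close>

definition twist :: "('v \<times> bool) list set \<Rightarrow> (('v \<Rightarrow>\<^sub>L real) \<Rightarrow> 'v) \<Rightarrow> bool" where
  "twist x \<omega> \<longleftrightarrow> x \<in> carrier G \<and> (\<forall>v f. (v, f) \<in> Vt \<longrightarrow> \<psi> x (v, f) = (v + \<omega> f, f))"

lemma T_fst: "(v, f) \<in> Vt \<Longrightarrow> (w, f) \<in> Vt"
  by (simp add: T_iff)

lemma twist_one: "twist \<one>\<^bsub>G\<^esub> (\<lambda>_. 0)"
  by (simp add: twist_def psi_one)

lemma twist_mult:
  assumes "twist x \<omega>" "twist y \<omega>'"
  shows "twist (x \<otimes>\<^bsub>G\<^esub> y) (\<lambda>f. \<omega>' f + \<omega> f)"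
  using assms T_fst by (auto simp: twist_def psi_mult add.assoc)

lemma twist_inv:
  assumes x: "twist x \<omega>" shows "twist (inv\<^bsub>G\<^esub> x) (\<lambda>f. - \<omega> f)"
proof -
  have c: "x \<in> carrier G" using x by (simp add: twist_def)
  have "\<psi> (inv\<^bsub>G\<^esub> x) (v, f) = (v + - \<omega> f, f)" if f: "(v, f) \<in> Vt" for v f
    using psi_inv[OF c T_fst[OF f], of "v + - \<omega> f"] x T_fst[OF f] by (simp add: twist_def)
  then show ?thesis using c by (simp add: twist_def)
qed

lemma twist_pow:
  assumes x: "twist x \<omega>" shows "twist (x [^]\<^bsub>G\<^esub> (m::int)) (\<lambda>f. of_int m *\<^sub>R \<omega> f)"
proof -
  have c: "x \<in> carrier G" using x by (simp add: twist_def)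
  show ?thesis
  proof (induction m rule: int_induct[of _ 0])
    case base then show ?case using twist_one by simp
  next
    case (step1 i)
    have e: "x [^]\<^bsub>G\<^esub> (i + 1) = x [^]\<^bsub>G\<^esub> i \<otimes>\<^bsub>G\<^esub> x" using W.int_pow_mult[OF c, of i 1] c by simp
    have "(\<lambda>f. \<omega> f + of_int i *\<^sub>R \<omega> f) = (\<lambda>f. of_int (i + 1) *\<^sub>R \<omega> f)"
      by (simp add: algebra_simps)
    then show ?case unfolding e using twist_mult[OF step1(2) x] by (simp only:)
  next
    case (step2 i)
    show ?case
      using twist_mult[OF step2(2) twist_inv[OF x]] W.int_pow_mult[OF c, of i "- 1"] c
      by (simp add: W.int_pow_neg algebra_simps)
  qed
qed

lemma twist_lprod:
  assumes "\<And>p. p \<in> set ps \<Longrightarrow> twist (h p) (\<omega> p)"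
  shows "twist (W.lprod h ps m) (\<lambda>f. \<Sum>p\<leftarrow>ps. of_int (m p) *\<^sub>R \<omega> p f)"
  using assms
proof (induction ps)
  case Nil then show ?case using twist_one by simp
next
  case (Cons p ps)
  show ?case
    using twist_mult[OF twist_pow[OF Cons.prems, of p] Cons.IH, of "m p"] Cons.prems
    by (simp add: add.commute)
qed

text \<open>
  In the product of the three lifts everything cancels except the bivector of \<open>\<delta>\<close> and \<open>\<epsilon>\<close>.
\<close>

lemma twist_c:
  assumes g: "\<gamma> \<in> \<Phi>" and S: "\<delta> \<in> Sh \<gamma>" "\<epsilon> \<in> Sh \<gamma>" "\<delta> + \<epsilon> \<in> Sh \<gamma>"
  shows "twist (W.c \<gamma> \<delta> \<epsilon>) (\<lambda>f. (2 / B \<gamma> \<gamma>) *\<^sub>R (f \<epsilon> *\<^sub>R \<delta> - f \<delta> *\<^sub>R \<epsilon>))"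
proof -
  let ?y = "W.F \<gamma> \<delta> \<otimes>\<^bsub>G\<^esub> W.F \<gamma> \<epsilon>" and ?c = "W.c \<gamma> \<delta> \<epsilon>"
  have F: "W.F \<gamma> \<delta> \<in> carrier G" "W.F \<gamma> \<epsilon> \<in> carrier G" using g S by simp_all
  have yc: "?y \<in> carrier G" using F by simp
  have cc: "?c \<in> carrier G" using W.center_carrier[OF W.c_center[OF g S]] .
  define q where "q = 2 / B \<gamma> \<gamma>"
  have prod: "\<psi> ?y (v, f) = (v + (N v \<gamma> - q * f \<epsilon>) *\<^sub>R \<epsilon> - (q * f \<epsilon>) *\<^sub>R \<gamma>
      + (N v \<gamma> - q * f \<epsilon> - q * f \<epsilon> - q * f \<delta>) *\<^sub>R \<delta> - (q * f \<delta>) *\<^sub>R \<gamma>, f)" if f: "(v, f) \<in> Vt" for v f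
    using psi_mult[OF F f] psi_F[OF g S(2) f] psi_F[OF g S(1) T_fst[OF f]] N_rad[OF Sh_rad[OF S(2)]] N_self[OF g]
    by (simp add: N_simps q_def)
  have sum: "\<psi> ?c (\<psi> ?y (v, f)) = (v + (N v \<gamma> - q * (f \<delta> + f \<epsilon>)) *\<^sub>R (\<delta> + \<epsilon>) - (q * (f \<delta> + f \<epsilon>)) *\<^sub>R \<gamma>, f)"
    if f: "(v, f) \<in> Vt" for v f
    using psi_mult[OF cc yc f] W.F_add[OF g S] psi_F[OF g S(3) f] by (simp add: q_def blinfun.bilinear_simps)
  have "\<psi> ?c (v, f) = (v + q *\<^sub>R (f \<epsilon> *\<^sub>R \<delta> - f \<delta> *\<^sub>R \<epsilon>), f)" if f: "(v, f) \<in> Vt" for v f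
  proof -
    obtain v' f' where u: "\<psi> (inv\<^bsub>G\<^esub> ?y) (v, f) = (v', f')" by force
    have T': "(v', f') \<in> Vt" using psi_T[OF W.inv_closed[OF yc] f] u by simp
    have y: "\<psi> ?y (v', f') = (v, f)"
      using psi_mult[OF yc W.inv_closed[OF yc] f] psi_one[OF f] yc u by simp
    have ff: "f' = f" and v: "v = v' + (N v' \<gamma> - q * f \<epsilon>) *\<^sub>R \<epsilon> - (q * f \<epsilon>) *\<^sub>R \<gamma>
      + (N v' \<gamma> - q * f \<epsilon> - q * f \<epsilon> - q * f \<delta>) *\<^sub>R \<delta> - (q * f \<delta>) *\<^sub>R \<gamma>"
      using prod[OF T'] y by auto
    define p1 p2 where "p1 = q * f \<delta>" and "p2 = q * f \<epsilon>"
    have "v' + (N v' \<gamma> - (p1 + p2)) *\<^sub>R (\<delta> + \<epsilon>) - (p1 + p2) *\<^sub>R \<gamma> = v + (p2 *\<^sub>R \<delta> - p1 *\<^sub>R \<epsilon>)"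
      unfolding v p1_def[symmetric] p2_def[symmetric]
      by (simp only: scaleR_left_distrib scaleR_left_diff_distrib scaleR_right_distrib) (simp add: algebra_simps)
    then show ?thesis
      using sum[OF T', unfolded y, unfolded ff] unfolding p1_def p2_def
      by (simp add: distrib_left scaleR_diff_right)
  qed
  then show ?thesis using cc by (simp add: twist_def q_def)
qed

lemma k_nonzero: "k \<noteq> 0"
  using roots.k_ge_2 by simp

lemma twist_g:
  assumes "(i, j) \<in> W.pairs"
  shows "\<exists>c. c \<noteq> 0 \<and> twist (W.g (i, j)) (\<lambda>f. c *\<^sub>R (f (\<sigma> j) *\<^sub>R \<sigma> i - f (\<sigma> i) *\<^sub>R \<sigma> j))"
proof -
  have ij: "i \<in> {1..\<nu>}" "j \<in> {1..\<nu>}" using assms by (auto simp: W.pairs_def)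
  define \<gamma> where "\<gamma> = (if i \<le> t then \<gamma>s else \<gamma>l)"
  have g: "\<gamma> \<in> \<Phi>" using roots.reps_in by (simp add: \<gamma>_def)
  define \<kappa> where "\<kappa> m = (if \<not> short \<gamma> \<and> m \<le> t then real_of_int k else 1)" for m
  have \<kappa>: "ee \<gamma> m = \<kappa> m *\<^sub>R \<sigma> m" "\<kappa> m \<noteq> 0" for m using k_nonzero by (auto simp: \<kappa>_def)
  have S: "\<kappa> i *\<^sub>R \<sigma> i \<in> Sh \<gamma>" "\<kappa> j *\<^sub>R \<sigma> j \<in> Sh \<gamma>"
    using ee_Sh[OF ij(1), of \<gamma>] ee_Sh[OF ij(2), of \<gamma>] unfolding \<kappa>(1) by auto
  have q: "2 / B \<gamma> \<gamma> \<noteq> 0" using roots.norm_pos[OF g] by simp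
  have eq: "W.g (i, j) = W.plane_gen \<gamma> (\<kappa> i *\<^sub>R \<sigma> i) (\<kappa> j *\<^sub>R \<sigma> j)"
    unfolding g_eq Let_def \<gamma>_def[symmetric] \<kappa>(1) ..
  have form: "twist (W.c \<gamma> (\<kappa> i *\<^sub>R \<sigma> i) ((a * \<kappa> j) *\<^sub>R \<sigma> j))
      (\<lambda>f. (2 / B \<gamma> \<gamma> * \<kappa> i * (a * \<kappa> j)) *\<^sub>R (f (\<sigma> j) *\<^sub>R \<sigma> i - f (\<sigma> i) *\<^sub>R \<sigma> j))"
    if "(a * \<kappa> j) *\<^sub>R \<sigma> j \<in> Sh \<gamma>" "\<kappa> i *\<^sub>R \<sigma> i + (a * \<kappa> j) *\<^sub>R \<sigma> j \<in> Sh \<gamma>" for a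
    using twist_c[OF g S(1) that] by (simp add: blinfun.bilinear_simps scaleR_diff_right mult_ac)
  show ?thesis
  proof (cases "\<kappa> i *\<^sub>R \<sigma> i + \<kappa> j *\<^sub>R \<sigma> j \<in> Sh \<gamma>")
    case True
    then show ?thesis
      using form[of 1] S q \<kappa>(2) unfolding eq W.plane_gen_def
      by (intro exI[of _ "2 / B \<gamma> \<gamma> * \<kappa> i * (1 * \<kappa> j)"]) simp
  next
    case False
    have "2 *\<^sub>R \<kappa> j *\<^sub>R \<sigma> j \<in> Sh \<gamma>" "\<kappa> i *\<^sub>R \<sigma> i + 2 *\<^sub>R \<kappa> j *\<^sub>R \<sigma> j \<in> Sh \<gamma>"
      using W.S_plus_2(1)[OF g S(2) Sh_zero] W.S_plus_2(1)[OF g S(2,1)] by simp_all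
    then show ?thesis
      using form[of 2] False q \<kappa>(2) unfolding eq W.plane_gen_def
      by (intro exI[of _ "2 / B \<gamma> \<gamma> * \<kappa> i * (2 * \<kappa> j)"]) simp
  qed
qed

lemma finite_pairs: "finite W.pairs"
  by (rule finite_subset[of _ "{1..\<nu>} \<times> {1..\<nu>}"]) (auto simp: W.pairs_def)

text \<open>
  The twists of the generators of \<open>A0\<close> are nonzero multiples of independent bivectors, so no
  nontrivial element of \<open>A0\<close> is in the kernel.
\<close>

lemma A0_faithful:
  assumes x: "x \<in> W.A0" and ker: "\<psi> x = \<one>\<^bsub>weyl_group B Vd R\<^esub>"
  shows "x = \<one>\<^bsub>G\<^esub>"
proof -
  obtain ps where ps: "set ps = W.pairs" "distinct ps" using finite_distinct_list[OF finite_pairs] by blast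
  \<comment> \<open>Collecting modulo the trivial group, since the generators of \<open>A0\<close> commute.\<close>
  have gc: "W.g ` set ps \<subseteq> carrier G" using W.g_center W.center_carrier ps(1) by auto
  have "x \<in> generate G ({\<one>\<^bsub>G\<^esub>} \<union> W.g ` set ps)"
    using x W.mono_generate[of "W.g ` W.pairs" "{\<one>\<^bsub>G\<^esub>} \<union> W.g ` set ps"] ps(1) by (auto simp: W.A0_def)
  then have "\<exists>a\<in>{\<one>\<^bsub>G\<^esub>}. \<exists>m. x = a \<otimes>\<^bsub>G\<^esub> W.lprod W.g ps m"
  proof (rule W.generate_collect[OF _ _ gc _ ps(2), rotated 3])
    show "subgroup {\<one>\<^bsub>G\<^esub>} G" by (rule W.triv_subgroup)
    show "{\<one>\<^bsub>G\<^esub>} \<subseteq> W.center" using subgroup.one_closed[OF W.subgroup_center] by simp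
    fix p q assume "p \<in> set ps" "q \<in> set ps"
    then have "W.g p \<in> W.center" "W.g p \<in> carrier G" "W.g q \<in> carrier G"
      using ps(1) W.g_center W.center_carrier by auto
    then show "W.cmt (W.g p) (W.g q) \<in> {\<one>\<^bsub>G\<^esub>}"
      using W.center_comm[of "W.g p" "W.g q"] by (simp add: W.cmt_def W.m_assoc)
  qed
  then obtain m where xm: "x = W.lprod W.g ps m" using gc by auto
  have "\<forall>p\<in>W.pairs. \<exists>c. c \<noteq> 0 \<and> twist (W.g p) (\<lambda>f. c *\<^sub>R (f (\<sigma> (snd p)) *\<^sub>R \<sigma> (fst p) - f (\<sigma> (fst p)) *\<^sub>R \<sigma> (snd p)))"
    using twist_g by auto
  then obtain c where c: "\<And>p. p \<in> W.pairs \<Longrightarrow> c p \<noteq> 0"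
    "\<And>p. p \<in> W.pairs \<Longrightarrow> twist (W.g p) (\<lambda>f. c p *\<^sub>R (f (\<sigma> (snd p)) *\<^sub>R \<sigma> (fst p) - f (\<sigma> (fst p)) *\<^sub>R \<sigma> (snd p)))"
    unfolding bchoice_iff by blast
  define \<omega> where "\<omega> p f = c p *\<^sub>R (blinfun_apply f (\<sigma> (snd p)) *\<^sub>R \<sigma> (fst p) - f (\<sigma> (fst p)) *\<^sub>R \<sigma> (snd p))" for p f
  have tw: "twist x (\<lambda>f. \<Sum>p\<leftarrow>ps. of_int (m p) *\<^sub>R \<omega> p f)"
    unfolding xm by (rule twist_lprod) (use c(2) ps(1) in \<open>simp add: \<omega>_def\<close>)
  have "m (i, j) = 0" if ij: "(i, j) \<in> W.pairs" for i j
  proof -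
    have I: "i \<in> {1..\<nu>}" "j \<in> {1..\<nu>}" "i < j" using ij by (auto simp: W.pairs_def)
    have Tj: "(0, \<phi> j) \<in> Vt" by (rule \<phi>(3)[OF I(2)])
    have "(\<Sum>p\<leftarrow>ps. of_int (m p) *\<^sub>R \<omega> p (\<phi> j)) = 0"
      using tw Tj ker one_W by (simp add: twist_def)
    then have "\<phi> i (\<Sum>p\<in>W.pairs. of_int (m p) *\<^sub>R \<omega> p (\<phi> j)) = 0"
      using ps by (simp add: sum_list_distinct_conv_sum_set)
    then have "(\<Sum>p\<in>W.pairs. of_int (m p) * \<phi> i (\<omega> p (\<phi> j))) = 0"
      by (simp add: blinfun.sum_right blinfun.scaleR_right)
    also have "(\<Sum>p\<in>W.pairs. of_int (m p) * \<phi> i (\<omega> p (\<phi> j)))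
        = (\<Sum>p\<in>W.pairs. if p = (i, j) then of_int (m (i, j)) * c (i, j) else 0)"
    proof (rule sum.cong[OF refl])
      fix p assume p: "p \<in> W.pairs"
      then have P: "fst p \<in> {1..\<nu>}" "snd p \<in> {1..\<nu>}" "fst p < snd p" by (auto simp: W.pairs_def)
      show "of_int (m p) * \<phi> i (\<omega> p (\<phi> j)) = (if p = (i, j) then of_int (m (i, j)) * c (i, j) else 0)"
        using I P by (cases p) (auto simp: \<omega>_def blinfun.bilinear_simps \<phi>(2)[OF I(1)] \<phi>(2)[OF I(2)])
    qed
    also have "\<dots> = of_int (m (i, j)) * c (i, j)" using ij finite_pairs by simp
    finally show ?thesis using c(1)[OF ij] by simp
  qed
  then have "x = W.lprod W.g ps (\<lambda>_. 0)" unfolding xm using ps(1) by (intro W.lprod_cong) auto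
  then show ?thesis using W.lprod_zero by simp
qed

section \<open>The kernel\<close>

text \<open>
  An element of the kernel moves no vector. Modulo the radical this makes its word in the simple
  reflections act trivially, and then deletion removes the word. The remaining translation vanishes
  only if every exponent does, because the coroots of the base and the basis shifts are independent.
\<close>

lemma kernel_A:
  assumes x: "x \<in> carrier G" and ker: "\<psi> x = \<one>\<^bsub>weyl_group B Vd R\<^esub>"
  shows "x \<in> W.A"
proof -
  obtain a m "is" where a: "a \<in> W.A" and w: "set is \<subseteq> {1..type_rank X}"
    and x_eq: "x = a \<otimes>\<^bsub>G\<^esub> W.Fprod m \<otimes>\<^bsub>G\<^esub> W.wd is"
    using W.normal_form[OF x] by blast
  define y where "y = a \<otimes>\<^bsub>G\<^esub> W.Fprod m"
  define \<tau> where "\<tau> v = (\<Sum>p\<leftarrow>W.fidx. (N v (b (fst p)) * of_int (m p)) *\<^sub>R ee (b (fst p)) (snd p))" for v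
  have "moves (W.Fprod m) \<tau>"
    unfolding \<tau>_def
  proof (rule moves_lprod)
    fix p assume "p \<in> set W.fidx"
    then have "fst p \<in> {1..type_rank X}" "snd p \<in> {1..\<nu>}" by (auto simp: W.set_fidx)
    then show "b (fst p) \<in> \<Phi> \<and> ee (b (fst p)) (snd p) \<in> Sh (b (fst p))"
      using roots.b_in ee_Sh by blast
  qed
  from moves_mult[OF moves_A[OF a] this] have y: "moves y \<tau>" by (simp add: y_def)
  then have yc: "y \<in> carrier G" by (simp add: moves_def)
  have act: "W.act is v + \<tau> (W.act is v) = v" for v
  proof -
    have "(v, 0) = \<psi> x (v, 0)" using ker one_W T_zero[of v] by simp
    also have "\<dots> = \<psi> y (\<psi> (W.wd is) (v, 0))"
      unfolding x_eq y_def by (rule psi_mult[OF yc[unfolded y_def] W.wd_closed[OF w] T_zero])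
    finally have "(v, 0) = \<psi> y (\<psi> (W.wd is) (v, 0))" .
    then show ?thesis using y by (simp add: psi_wd[OF w] moves_def)
  qed
  have fix_b: "W.act is (b j) = b j" if j: "j \<in> {1..type_rank X}" for j
  proof -
    have "W.act is (b j) \<in> Vd" using root_Vd[OF W.act_in[OF w roots.b_in[OF j]]] .
    then have "b j - W.act is (b j) \<in> Vd"
      using subspace_diff[OF subspaces(1)] root_Vd[OF roots.b_in[OF j]] by blast
    moreover have "b j - W.act is (b j) = \<tau> (W.act is (b j))"
      using act[of "b j"] by (simp add: algebra_simps)
    moreover have "\<tau> (W.act is (b j)) \<in> V1 + V2" using y by (simp add: moves_def)
    ultimately have "b j - W.act is (b j) = 0" using V_direct by (metis IntI singletonD)
    then show ?thesis by simp
  qed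
  have "W.wd is = \<one>\<^bsub>G\<^esub>"
  proof (rule W.wd_trivial[where P = roots.pos])
    show "roots.pos (b i)" if "i \<in> {1..type_rank X}" for i using roots.pos_b that .
    show "\<not> roots.pos (- b i)" if "i \<in> {1..type_rank X}" for i
      using roots.pos_not_neg[OF roots.b_in[OF that] roots.pos_b[OF that]] .
    show "roots.pos (reflection B (b i) \<beta>)"
      if "i \<in> {1..type_rank X}" "\<beta> \<in> \<Phi>" "roots.pos \<beta>" "\<beta> \<noteq> b i" for i \<beta>
      using roots.pos_r that .
    show "reflection B \<alpha> (- \<beta>) = - reflection B \<alpha> \<beta>" if "\<alpha> \<in> \<Phi>" "\<beta> \<in> \<Phi>" for \<alpha> \<beta>
      using roots.r_minus[OF that(1)] .
    show "reflection B (reflection B \<alpha> \<beta>) (reflection B \<alpha> \<gamma>) = reflection B \<alpha> (reflection B \<beta> \<gamma>)"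
      if "\<alpha> \<in> \<Phi>" "\<beta> \<in> \<Phi>" "\<gamma> \<in> \<Phi>" for \<alpha> \<beta> \<gamma>
      using roots.refl(1)[OF that(1), of \<gamma>] roots.refl(3)[OF that(1), of \<beta> "reflection B \<alpha> \<gamma>"] by simp
  qed (use w fix_b in auto)
  then have xy: "x = y" using yc unfolding x_eq y_def by simp
  have zero: "\<tau> v = 0" for v
  proof -
    have "(v, 0) = \<psi> y (v, 0)" using ker one_W T_zero[of v] unfolding xy by simp
    then show ?thesis using y by (simp add: moves_def)
  qed
  have "m (i, j) = 0" if i: "i \<in> {1..type_rank X}" and j: "j \<in> {1..\<nu>}" for i j
  proof -
    \<comment> \<open>The \<open>j\<close>-th coordinate of the translation is the product with one vector of \<open>Vd\<close>, which
      must therefore vanish.\<close>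
    define \<kappa> where "\<kappa> i = (if \<not> short (b i) \<and> j \<le> t then real_of_int k else 1)" for i
    define d where "d i = 2 / B (b i) (b i) * (of_int (m (i, j)) * \<kappa> i)" for i
    let ?w = "\<Sum>i\<in>{1..type_rank X}. d i *\<^sub>R b i"
    have "B v ?w = 0" for v
    proof -
      have "0 = \<phi> j (\<tau> v)" by (simp add: zero)
      also have "\<tau> v = (\<Sum>p\<in>{1..type_rank X} \<times> {1..\<nu>}. (N v (b (fst p)) * of_int (m p)) *\<^sub>R ee (b (fst p)) (snd p))"
        unfolding \<tau>_def using W.distinct_fidx W.set_fidx by (simp add: sum_list_distinct_conv_sum_set)
      also have "\<phi> j \<dots> = (\<Sum>p\<in>{1..type_rank X} \<times> {1..\<nu>}. N v (b (fst p)) * of_int (m p) * \<phi> j (ee (b (fst p)) (snd p)))"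
        unfolding blinfun.sum_right by (simp add: blinfun.scaleR_right)
      also have "\<dots> = (\<Sum>i\<in>{1..type_rank X}. \<Sum>j'\<in>{1..\<nu>}. N v (b i) * of_int (m (i, j')) * \<phi> j (ee (b i) j'))"
        by (simp add: sum.cartesian_product split_beta)
      also have "\<dots> = (\<Sum>i\<in>{1..type_rank X}. \<Sum>j'\<in>{1..\<nu>}. if j' = j then N v (b i) * (of_int (m (i, j)) * \<kappa> i) else 0)"
        by (intro sum.cong refl) (auto simp: \<kappa>_def blinfun.scaleR_right \<phi>(2)[OF j])
      also have "\<dots> = (\<Sum>i\<in>{1..type_rank X}. N v (b i) * (of_int (m (i, j)) * \<kappa> i))"
        using j by simp
      also have "\<dots> = (\<Sum>i\<in>{1..type_rank X}. d i * B v (b i))"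
        by (intro sum.cong refl) (simp add: N_def d_def)
      also have "\<dots> = B v ?w"
        using form_bilinear by (simp add: bilinear_def linear_sum linear_cmul)
      finally show ?thesis by simp
    qed
    then have "?w \<in> V1 + V2" using radical form_sym by auto
    moreover have "?w \<in> Vd"
      by (intro subspace_sum[OF subspaces(1)] subspace_scale[OF subspaces(1)] root_Vd roots.b_in)
    ultimately have "?w = 0" using V_direct by blast
    then have "d i = 0" using roots.base_independent i by blast
    moreover have "\<kappa> i \<noteq> 0" using k_nonzero by (simp add: \<kappa>_def)
    ultimately show ?thesis using roots.norm_pos[OF roots.b_in[OF i]] by (simp add: d_def)
  qed
  then have "W.Fprod m = W.Fprod (\<lambda>_. 0)"
    by (intro W.lprod_cong) (auto simp: W.set_fidx)
  also have "\<dots> = \<one>\<^bsub>G\<^esub>" by (rule W.lprod_zero)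
  finally have "y = a" using W.A_center W.center_carrier a unfolding y_def by (simp add: subset_iff)
  then show ?thesis using a xy by simp
qed

text \<open>
  A sum over short directions lies in \<open>V1\<close>, so membership in the sum of both lattices already means
  membership in the semilattice \<open>S1\<close>.
\<close>

lemma fam_short: "card (W.fam \<gamma>s) \<le> (if \<exists>m. X = TypeB m then card (Esupp {1..t} \<sigma> S1) else 0)"
proof (cases "\<exists>m. X = TypeB m")
  case True
  have D: "Dset \<gamma>s = {1..t}" using True roots.is_short_reps by (simp add: Dset_def)
  have "W.fam \<gamma>s \<subseteq> Esupp {1..t} \<sigma> S1"
  proof
    fix J assume J: "J \<in> W.fam \<gamma>s"
    then have Jt: "J \<subseteq> {1..t}" "3 \<le> card J" by (auto simp: W.fam_def D)
    have "(\<Sum>j\<in>J. \<sigma> j) \<in> Sh \<gamma>s" using J roots.is_short_reps(1) by (simp add: W.fam_def)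
    then obtain x y where xy: "x \<in> S1" "y \<in> zspan S2" "(\<Sum>j\<in>J. \<sigma> j) = x + y"
      using Sh_short[OF roots.is_short_reps(1)] by blast
    have "(\<Sum>j\<in>J. \<sigma> j) \<in> V1"
      using Jt(1) sigma1(1) S_V(1) by (intro subspace_sum[OF subspaces(2)]) auto
    then have "(\<Sum>j\<in>J. \<sigma> j) - x \<in> V1" using subspace_diff[OF subspaces(2)] xy(1) S_V(1) by blast
    then have "y \<in> V1" using xy(3) by simp
    then have "y = 0" using xy(2) S_V(4) radical_direct by blast
    then show "J \<in> Esupp {1..t} \<sigma> S1" using xy Jt by (simp add: Esupp_def supp_def)
  qed
  moreover have "finite (Esupp {1..t} \<sigma> S1)"
    by (rule finite_subset[of _ "Pow {1..t}"]) (auto simp: Esupp_def supp_def)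
  ultimately show ?thesis using True card_mono by auto
next
  case False
  then have "Dset \<gamma>s = {}" using roots.is_short_reps by (simp add: Dset_def)
  then have "W.fam \<gamma>s = {}" by (auto simp: W.fam_def)
  then show ?thesis by simp
qed

lemma fam_long:
  "card (W.fam \<gamma>l) \<le> (if X = TypeB 2 \<or> (\<exists>m. X = TypeC m) then card (Esupp {t+1..\<nu>} \<sigma> S2) else 0)"
proof (cases "X = TypeB 2 \<or> (\<exists>m. X = TypeC m)")
  case True
  have D: "Dset \<gamma>l = {t+1..\<nu>}" using True roots.is_short_reps by (simp add: Dset_def)
  have "W.fam \<gamma>l \<subseteq> Esupp {t+1..\<nu>} \<sigma> S2"
  proof
    fix J assume J: "J \<in> W.fam \<gamma>l"
    then have Jt: "J \<subseteq> {t+1..\<nu>}" "3 \<le> card J" by (auto simp: W.fam_def D)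
    have "(\<Sum>j\<in>J. ee \<gamma>l j) = (\<Sum>j\<in>J. \<sigma> j)" by (rule sum.cong) (use Jt(1) in auto)
    then have "(\<Sum>j\<in>J. \<sigma> j) \<in> Sh \<gamma>l" using J by (simp add: W.fam_def)
    then obtain x y where xy: "x \<in> zspan S1" "y \<in> S2" "(\<Sum>j\<in>J. \<sigma> j) = of_int k *\<^sub>R x + y"
      using Sh_long[OF roots.is_short_reps(2)] by blast
    have "(\<Sum>j\<in>J. \<sigma> j) \<in> V2"
      using Jt(1) sigma2(1) S_V(3) by (intro subspace_sum[OF subspaces(3)]) auto
    then have "(\<Sum>j\<in>J. \<sigma> j) - y \<in> V2" using subspace_diff[OF subspaces(3)] xy(2) S_V(3) by blast
    then have "of_int k *\<^sub>R x \<in> V2" using xy(3) by simp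
    moreover have "of_int k *\<^sub>R x \<in> V1" using xy(1) S_V(2) subspace_scale[OF subspaces(2)] by blast
    ultimately have k0: "of_int k *\<^sub>R x = 0" using radical_direct by blast
    have "(\<Sum>j\<in>J. \<sigma> j) = y" unfolding xy(3) k0 by simp
    then show "J \<in> Esupp {t+1..\<nu>} \<sigma> S2" using xy(2) Jt by (simp add: Esupp_def supp_def)
  qed
  moreover have "finite (Esupp {t+1..\<nu>} \<sigma> S2)"
    by (rule finite_subset[of _ "Pow {t+1..\<nu>}"]) (auto simp: Esupp_def supp_def)
  ultimately show ?thesis using True card_mono by auto
next
  case False
  then have "Dset \<gamma>l = {}" using roots.is_short_reps by (simp add: Dset_def)
  then have "W.fam \<gamma>l = {}" by (auto simp: W.fam_def)
  then show ?thesis by simp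
qed

lemma card_zidx: "card W.zidx \<le> card (J_family X \<nu> t \<sigma> S1 S2)"
proof -
  have "card W.zidx \<le> card (W.fam \<gamma>s) + card (W.fam \<gamma>l)"
    unfolding W.zidx_def by (rule order_trans[OF card_Un_le]) (simp add: card_cartesian_product)
  also have "\<dots> \<le> card (J_family X \<nu> t \<sigma> S1 S2)"
  proof (cases X)
    case (TypeB m)
    show ?thesis
    proof (cases "m = 2")
      case True
      have "Esupp {1..t} \<sigma> S1 \<inter> Esupp {t+1..\<nu>} \<sigma> S2 = {}"
      proof (rule equals0I)
        fix J assume "J \<in> Esupp {1..t} \<sigma> S1 \<inter> Esupp {t+1..\<nu>} \<sigma> S2"
        then have "J \<subseteq> {1..t}" "J \<subseteq> {t+1..\<nu>}" "3 \<le> card J" by (auto simp: Esupp_def supp_def)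
        then have "J = {}" using split_index(2) by blast
        then show False using \<open>3 \<le> card J\<close> by simp
      qed
      moreover have "finite (Esupp {1..t} \<sigma> S1)"
        by (rule finite_subset[of _ "Pow {1..t}"]) (auto simp: Esupp_def supp_def)
      moreover have "finite (Esupp {t+1..\<nu>} \<sigma> S2)"
        by (rule finite_subset[of _ "Pow {t+1..\<nu>}"]) (auto simp: Esupp_def supp_def)
      ultimately have "card (J_family X \<nu> t \<sigma> S1 S2) = card (Esupp {1..t} \<sigma> S1) + card (Esupp {t+1..\<nu>} \<sigma> S2)"
        using True TypeB by (simp add: card_Un_disjoint)
      then show ?thesis using fam_short fam_long True TypeB by simp
    qed (use fam_short fam_long TypeB in simp)
  qed (use fam_short fam_long in simp_all)
  finally show ?thesis .
qed

theorem kernel_elementary: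
  "\<exists>n \<le> card (J_family X \<nu> t \<sigma> S1 S2).
    G\<lparr>carrier := kernel G (weyl_group B Vd R) \<psi>\<rparr> \<cong> sum_group {..<n} (\<lambda>_. integer_mod_group 2)"
proof -
  let ?K = "kernel G (weyl_group B Vd R) \<psi>"
  have fin: "finite W.zidx" using W.finite_fam by (simp add: W.zidx_def)
  then obtain ps where ps: "set ps = W.zidx" "distinct ps" using finite_distinct_list by blast
  have K: "subgroup ?K G" by (rule group_hom.subgroup_kernel[OF psi_hom])
  have KA: "?K \<subseteq> generate G (W.A0 \<union> W.z ` set ps)"
    using kernel_A by (auto simp: kernel_def ps(1) W.A_def)
  have "\<one>\<^bsub>G\<^esub> \<in> ?K \<inter> W.A0" using subgroup.one_closed[OF K] W.one_A0 by blast
  then have KA0: "?K \<inter> W.A0 = {\<one>\<^bsub>G\<^esub>}" using A0_faithful by (auto simp: kernel_def)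
  have zc: "W.z ` set ps \<subseteq> W.center" using W.z_center ps(1) by auto
  have zsq: "W.z p \<otimes>\<^bsub>G\<^esub> W.z p \<in> W.A0" if "p \<in> set ps" for p using W.z_square that ps(1) by simp
  note bound = W.elementary_bound[OF W.A0_subgroup W.A0_center zc zsq ps(2) K KA KA0]
  have "length ps = card W.zidx" using ps distinct_card by metis
  then obtain n where "n \<le> card W.zidx" "G\<lparr>carrier := ?K\<rparr> \<cong> sum_group {..<n} (\<lambda>_. integer_mod_group 2)"
    using W.elementary_iso[OF K bound(1,2,3)] by auto
  then show ?thesis using card_zidx order_trans by blast
qed

end

theorem corollary29:
  fixes X :: nsl_type
    and \<nu> t :: nat
    and B :: "'v::euclidean_space \<Rightarrow> 'v \<Rightarrow> real"
    and Vd V1 V2 Rd S1 S2 R :: "'v set"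
    and \<sigma> :: "nat \<Rightarrow> 'v"
    and \<psi> :: "('v \<times> bool) list set \<Rightarrow> ('v \<times> ('v \<Rightarrow>\<^sub>L real) \<Rightarrow> 'v \<times> ('v \<Rightarrow>\<^sub>L real))"
  assumes ears: "ears_data X \<nu> t B Vd V1 V2 Rd S1 S2"
    and R_def: "R = ears_roots X B Rd S1 S2"
    and sigma1: "\<sigma> ` {1..t} \<subseteq> S1" "zbasis {1..t} \<sigma> (zspan S1)"
    and sigma2: "\<sigma> ` {t+1..\<nu>} \<subseteq> S2" "zbasis {t+1..\<nu>} \<sigma> (zspan S2)"
    and psi_epi: "\<psi> \<in> epi (conj_group B R) (weyl_group B Vd R)"
    and psi_gen: "\<And>\<alpha>. \<alpha> \<in> nonisotropic B R \<Longrightarrow> \<psi> (conj_gen B R \<alpha>) = weyl_reflection B Vd \<alpha>"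
  shows "\<exists>n \<le> card (J_family X \<nu> t \<sigma> S1 S2).
    (conj_group B R)\<lparr>carrier := kernel (conj_group B R) (weyl_group B Vd R) \<psi>\<rparr>
      \<cong> sum_group {..<n} (\<lambda>_. integer_mod_group 2)"
proof -
  have "root_system_of_type X B Vd Rd" using ears by (rule ears_data.finite_roots)
  then obtain b where b: "root_base Rd (type_rank X) b"
    "\<forall>i\<in>{1..type_rank X}. \<forall>j\<in>{1..type_rank X}.
      2 * B (b i) (b j) / B (b j) (b j) = of_int (cartan_entry X i j)"
    unfolding root_system_of_type_def by blast
  interpret ears_presentation X \<nu> t B Vd V1 V2 Rd S1 S2 R \<sigma> b \<psi>
    using ears R_def sigma1 sigma2 psi_epi psi_gen b
    by (simp add: ears_presentation_def ears_presentation_axioms_def)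
  show ?thesis by (rule kernel_elementary)
qed

end
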